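(* Let $F_{Z,1}$ and $F_{Z,2}$ be two distributions of development costs with $\mathcal C^1$ densities $f_{Z,1}>0$ and $f_{Z,2}>0$ over $\mathbb R_+$, and let $b_1:[\underline m_1,\beta)\to[x_R,\beta)$ and $b_2:[\underline m_2,\beta)\to[x_R,\beta)$ be the optimal free boundaries under $F_{Z,1}$ and $F_{Z,2}$, respectively. If $F_{Z,2}$ dominates $F_{Z,1}$ in the hazard-rate order, that is, if $$\frac{f_{Z,1}}{1-F_{Z,1}}>\frac{f_{Z,2}}{1-F_{Z,2}}\quad\text{over }\mathbb R_+,$$ then $\underline m_1>\underline m_2$ and $b_2>b_1$ over $[\underline m_1,\beta)$.
   Context: Setting. $r>0$ is a discount rate and $\mathcal I=(\alpha,\beta)$, $-\infty\le\alpha<\beta\le\infty$. $X=(X_t)_{t\ge0}$ is a time-homogeneous diffusion on the canonical space of continuous trajectories, with $X_0=x\in\mathcal I$ under $\mathbf P_x$, the (unique in law) weak solution of $dX_t=\mu(X_t)\,dt+\sigma(X_t)\,dW_t$, with state space $\mathcal I$; $\mu,\sigma$ are continuous with $\sigma>0$ on $\mathcal I$, and $\alpha,\beta$ are natural endpoints. $\mathcal T_X$ is the set of stopping times of the right-continuous filtration generated by $X$; $g(X_\tau)\equiv0$ on $\{\tau=\infty\}$. $\mathcal L u=\mu u'+\frac12\sigma^2u''$, acting on the variable $x$ only for functions of $(x,m)$. Payoffs. $R,U\in\mathcal C^2(\mathcal I)$ with $U>R$, and each $g\in\{R,U\}$ satisfies: (A1) $\mathbf E_x[\sup_{t\ge0}e^{-rt}|g(X_t)|]<\infty$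 for all $x$; (A2) $\lim_{t\to\infty}e^{-rt}g(X_t)=0$ $\mathbf P_x$-a.s. for all $x$; (A3) there is $x_0\in\mathcal I$ (depending on $g$) with $\mathcal L g-rg>0$ on $(\alpha,x_0)$ and $<0$ on $(x_0,\beta)$. Let $V_g(x)\equiv\sup_{\tau\in\mathcal T_X}\mathbf E_x[e^{-r\tau}g(X_\tau)]$. It is part of the setting that the stopping region $\{V_g=g\}$ is $[x_g,\beta)$ for some $x_g\in(x_0,\beta)$, with smooth fit at $x_g$. Put $G\equiv\frac12(V_U+V_R)$ and $P\equiv\frac12(V_U-V_R)$. $G$ is assumed to satisfy: $G\in\mathcal C^1(\mathcal I)$, piecewise $\mathcal C^2$; (A4) $\mathbf E_x[\sup_{t\ge0}e^{-rt}G(X_t)]<\infty$; (A5) $\lim_{t\to\infty}e^{-rt}G(X_t)=0$ $\mathbf P_x$-a.s.; (A6) $G>V_R$ on $\mathcal I$; (A7) $\mathcal LG-rG\le0$ wherever $G''$ is defined. $P$ is assumed to satisfy $P'>0$ on $\mathcal I$ and to map $\mathcal I$ onto $(0,\infty)$. Development cost and breakthrough threshold. Given a distribution $F_Z$ of the development cost $Z$ with density $f_Z$, the breakthrough threshold $Y=P^{-1}(Z)$ has cumulative distribution function $F=F_Z\circ P$ and density $f=P'\,(f_Z\circ P)$; (A8) $f$ is assumed locally Lipschitz and positive on $\mathcal I$. Optimal free boundary. Let $\mathcal J\equiv\{(x,m)\in\mathcal I\times\mathcal I:m\ge x\}$. Given the cumulative distribution function $F=F_Z\circ P$ and the (locally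 Lipschitz, positive) density $f=P'\,(f_Z\circ P)$ of the breakthrough threshold $Y$, consider the variational system of finding $\underline m\in(x_R,\beta)$, $b:[\underline m,\beta)\to[x_R,\beta)$ and $W:\mathcal J\to\mathbb R$ such that, with $\mathcal S\equiv\{(x,m)\in\mathcal J:\underline m\le m<\beta,\ x_R\le x\le b(m)\}$ and $\mathcal C\equiv\mathcal J\setminus\mathcal S$: $b(\underline m)=x_R$; $x_R\le b(m)<m$ for $m\in[\underline m,\beta)$; $\lim_{m\to\beta^-}b(m)=\beta$; $\mathcal LW-rW=0$ on $\mathrm{int}\,\mathcal C$; $W(x,m)=[1-F(m)]R(x)$ on $\mathcal S$; $\frac{\partial W}{\partial x}(b(m),m)=[1-F(m)]R'(b(m))$ for $m\in[\underline m,\beta)$; $\frac{\partial W}{\partial m}(m,m)=-f(m)G(m)$ for $m\in\mathcal I$; $\lim_{x\to\alpha^+}W(x,m)=0$ for $m\in\mathcal I$. This system has a unique solution with $b\in\mathcal C^1([\underline m,\beta))$ and $W\in\mathcal C^0(\mathcal J)$ that is $\mathcal C^1$ on $\mathcal J\setminus\{(x,\underline m):x\in(\alpha,\underline m]\}$ and $\mathcal C^{2,1}$ (twice in $x$, once in $m$, up to the boundary) on each of $\{m\ge\underline m,\,x\le x_R\}$, $\{m\ge\underline m,\,x\ge b(m)\}$, $\{m\le\underline m\}$ (subsets of $\mathcal J$) and $\mathcal S$; its component $b:[\underline m,\beta)\to[x_R,\beta)$ is called the optimal free boundary. (It describes the optimal stopping region $\mathcal S$ of $\sup_{\tau}\mathbf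 E_{x,m}\big[[1-F(M_\tau)]e^{-r\tau}R(X_\tau)+\int_0^\tau e^{-rt}G(M_t)f(M_t)\,dM_t\big]$, where $M_t=m\vee\sup_{s\le t}X_s$.) Here $b_i$, with left endpoint $\underline m_i$, is the optimal free boundary for $F=F_{Z,i}\circ P$, with the same $X,R,U$. *)

theory Defs
  imports "HOL-Probability.Probability"
begin

section \<open>Canonical path space and stopping times\<close>

definition path_space :: "real set \<Rightarrow> (real \<Rightarrow> real) set" where
  "path_space I = {\<omega> \<in> {0..} \<rightarrow>\<^sub>E I. continuous_on {0..} \<omega>}"

text \<open>Time runs over the extended half-line, so that stopping times may be infinite. At the index
  \<open>\<top>\<close> the natural filtration is the \<open>\<sigma>\<close>-algebra generated by all coordinates.\<close>

definition natural_filtration :: "real set \<Rightarrow> ennreal \<Rightarrow> (real \<Rightarrow> real) measure" where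
  "natural_filtration I t = sigma (path_space I)
     (\<Union>s\<in>{s. 0 \<le> s \<and> ennreal s \<le> t}. {(\<lambda>\<omega>. \<omega> s) -` A \<inter> path_space I | A. A \<in> sets borel})"

definition right_filtration :: "real set \<Rightarrow> ennreal \<Rightarrow> (real \<Rightarrow> real) measure" where
  "right_filtration I t =
     (if t = \<top> then natural_filtration I \<top>
      else sigma (path_space I) (\<Inter>s\<in>{t<..}. sets (natural_filtration I s)))"

definition stopped_payoff :: "real \<Rightarrow> (real \<Rightarrow> real) \<Rightarrow> ((real \<Rightarrow> real) \<Rightarrow> ennreal) \<Rightarrow> (real \<Rightarrow> real) \<Rightarrow> real" where
  "stopped_payoff r g \<tau> \<omega> =
     (if \<tau> \<omega> = \<top> then 0 else exp (- r * enn2real (\<tau> \<omega>)) * g (\<omega> (enn2real (\<tau> \<omega>))))"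


section \<open>Weak solutions of stochastic differential equations\<close>

definition brownian_motion :: "'a measure \<Rightarrow> (real \<Rightarrow> 'a measure) \<Rightarrow> (real \<Rightarrow> 'a \<Rightarrow> real) \<Rightarrow> bool" where
  "brownian_motion M F W \<longleftrightarrow>
     (AE \<omega> in M. W 0 \<omega> = 0) \<and>
     (AE \<omega> in M. continuous_on {0..} (\<lambda>t. W t \<omega>)) \<and>
     (\<forall>t\<ge>0. W t \<in> borel_measurable (F t)) \<and>
     (\<forall>s t. 0 \<le> s \<and> s < t \<longrightarrow>
        distributed M lborel (\<lambda>\<omega>. W t \<omega> - W s \<omega>) (\<lambda>y. ennreal (normal_density 0 (sqrt (t - s)) y)) \<and>
        prob_space.indep_set M (sets (F s))
          (sets (vimage_algebra (space M) (\<lambda>\<omega>. W t \<omega> - W s \<omega>) borel)))"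

text \<open>For continuous adapted integrands the Ito integral over \<open>[0, t]\<close> is the limit in probability
  of the left-endpoint Riemann sums; this determines it up to null sets.\<close>

definition has_ito_integral ::
  "'a measure \<Rightarrow> (real \<Rightarrow> 'a \<Rightarrow> real) \<Rightarrow> (real \<Rightarrow> 'a \<Rightarrow> real) \<Rightarrow> real \<Rightarrow> ('a \<Rightarrow> real) \<Rightarrow> bool" where
  "has_ito_integral M H W t J \<longleftrightarrow>
     (\<forall>\<epsilon>>0. (\<lambda>n. measure M {\<omega> \<in> space M.
        \<bar>(\<Sum>k<n. H (t * real k / real n) \<omega> *
            (W (t * real (Suc k) / real n) \<omega> - W (t * real k / real n) \<omega>)) - J \<omega>\<bar> > \<epsilon>})
        \<longlonglongrightarrow> 0)"

text \<open>\<open>Q\<close> is the law on path space of a weak solution started at \<open>x\<close> that stays in \<open>I\<close> forever.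
  As \<open>\<sigma> > 0\<close>, the driving Brownian motion is recovered from the solution, so it is no restriction to
  realise it on path space itself. The filtration is existentially quantified and may thus contain
  the null sets that occur.\<close>

definition weak_solution_law ::
  "real set \<Rightarrow> (real \<Rightarrow> real) \<Rightarrow> (real \<Rightarrow> real) \<Rightarrow> real \<Rightarrow> (real \<Rightarrow> real) measure \<Rightarrow> bool" where
  "weak_solution_law I \<mu> \<sigma> x Q \<longleftrightarrow>
     prob_space Q \<and> sets Q = sets (natural_filtration I \<top>) \<and>
     (\<exists>F W. filtration (space Q) F \<and>
        (\<forall>t. sets (F t) \<subseteq> sets Q) \<and>
        (\<forall>t\<ge>0. (\<lambda>\<omega>. \<omega> t) \<in> borel_measurable (F t)) \<and>
        brownian_motion Q F W \<and>
        (AE \<omega> in Q. \<omega> 0 = x) \<and>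
        (\<forall>t\<ge>0. has_ito_integral Q (\<lambda>s \<omega>. \<sigma> (\<omega> s)) W t
           (\<lambda>\<omega>. \<omega> t - x - (LBINT s=0..ereal t. \<mu> (\<omega> s)))))"


section \<open>Natural endpoints\<close>

definition scale_density :: "(real \<Rightarrow> real) \<Rightarrow> (real \<Rightarrow> real) \<Rightarrow> real \<Rightarrow> real \<Rightarrow> real" where
  "scale_density \<mu> \<sigma> c x = exp (- (LBINT y=ereal c..ereal x. 2 * \<mu> y / (\<sigma> y)\<^sup>2))"

definition speed_density :: "(real \<Rightarrow> real) \<Rightarrow> (real \<Rightarrow> real) \<Rightarrow> real \<Rightarrow> real \<Rightarrow> real" where
  "speed_density \<mu> \<sigma> c x = 2 / ((\<sigma> x)\<^sup>2 * scale_density \<mu> \<sigma> c x)"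

text \<open>Feller's criterion, where \<open>D\<close> is the part of the state space between the interior point \<open>c\<close> and
  the endpoint: the endpoint is natural iff it is neither an exit (first integral finite) nor an
  entrance (second integral finite).\<close>

definition natural_end :: "(real \<Rightarrow> real) \<Rightarrow> (real \<Rightarrow> real) \<Rightarrow> real \<Rightarrow> real set \<Rightarrow> bool" where
  "natural_end \<mu> \<sigma> c D \<longleftrightarrow>
     (\<integral>\<^sup>+x\<in>D. ennreal (scale_density \<mu> \<sigma> c x) *
        (\<integral>\<^sup>+y\<in>{min c x..max c x}. ennreal (speed_density \<mu> \<sigma> c y) \<partial>lborel) \<partial>lborel) = \<infinity> \<and>
     (\<integral>\<^sup>+x\<in>D. ennreal (speed_density \<mu> \<sigma> c x) *
        (\<integral>\<^sup>+y\<in>{min c x..max c x}. ennreal (scale_density \<mu> \<sigma> c y) \<partial>lborel) \<partial>lborel) = \<infinity>"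

definition diffusion ::
  "ereal \<Rightarrow> ereal \<Rightarrow> (real \<Rightarrow> real) \<Rightarrow> (real \<Rightarrow> real) \<Rightarrow> (real \<Rightarrow> (real \<Rightarrow> real) measure) \<Rightarrow> bool" where
  "diffusion \<alpha> \<beta> \<mu> \<sigma> Pr \<longleftrightarrow>
     continuous_on (einterval \<alpha> \<beta>) \<mu> \<and> continuous_on (einterval \<alpha> \<beta>) \<sigma> \<and>
     (\<forall>x\<in>einterval \<alpha> \<beta>. 0 < \<sigma> x) \<and>
     (\<forall>c\<in>einterval \<alpha> \<beta>. natural_end \<mu> \<sigma> c (einterval \<alpha> c) \<and> natural_end \<mu> \<sigma> c (einterval c \<beta>)) \<and>
     (\<forall>x\<in>einterval \<alpha> \<beta>. weak_solution_law (einterval \<alpha> \<beta>) \<mu> \<sigma> x (Pr x) \<and>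
        (\<forall>Q. weak_solution_law (einterval \<alpha> \<beta>) \<mu> \<sigma> x Q \<longrightarrow> Q = Pr x))"

definition generator :: "(real \<Rightarrow> real) \<Rightarrow> (real \<Rightarrow> real) \<Rightarrow> (real \<Rightarrow> real) \<Rightarrow> real \<Rightarrow> real" where
  "generator \<mu> \<sigma> u x = \<mu> x * deriv u x + (\<sigma> x)\<^sup>2 / 2 * deriv (deriv u) x"


section \<open>Payoffs\<close>

definition stopping_value ::
  "real \<Rightarrow> ereal \<Rightarrow> ereal \<Rightarrow> (real \<Rightarrow> (real \<Rightarrow> real) measure) \<Rightarrow> (real \<Rightarrow> real) \<Rightarrow> real \<Rightarrow> real" where
  "stopping_value r \<alpha> \<beta> Pr g x =
     (SUP \<tau>\<in>{\<tau>. stopping_time (right_filtration (einterval \<alpha> \<beta>)) \<tau>}.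
        \<integral>\<omega>. stopped_payoff r g \<tau> \<omega> \<partial>(Pr x))"

text \<open>The coercion truncates negative values; below, \<open>g\<close> is an absolute value or a function that
  dominates a nonnegative value function.\<close>

definition discounted_sup_integrable ::
  "real \<Rightarrow> ereal \<Rightarrow> ereal \<Rightarrow> (real \<Rightarrow> (real \<Rightarrow> real) measure) \<Rightarrow> (real \<Rightarrow> real) \<Rightarrow> bool" where
  "discounted_sup_integrable r \<alpha> \<beta> Pr g \<longleftrightarrow>
     (\<forall>x\<in>einterval \<alpha> \<beta>. (\<integral>\<^sup>+\<omega>. (SUP t\<in>{0..}. ennreal (exp (- r * t) * g (\<omega> t))) \<partial>(Pr x)) < \<infinity>)"

definition discounted_vanishing ::
  "real \<Rightarrow> ereal \<Rightarrow> ereal \<Rightarrow> (real \<Rightarrow> (real \<Rightarrow> real) measure) \<Rightarrow> (real \<Rightarrow> real) \<Rightarrow> bool" where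
  "discounted_vanishing r \<alpha> \<beta> Pr g \<longleftrightarrow>
     (\<forall>x\<in>einterval \<alpha> \<beta>. AE \<omega> in Pr x. ((\<lambda>t. exp (- r * t) * g (\<omega> t)) \<longlongrightarrow> 0) at_top)"

text \<open>The last conjuncts record the shape \<open>[x\<^sub>g, \<beta>)\<close> of the stopping region and smooth fit at \<open>x\<^sub>g\<close>.\<close>

definition admissible_payoff ::
  "real \<Rightarrow> ereal \<Rightarrow> ereal \<Rightarrow> (real \<Rightarrow> real) \<Rightarrow> (real \<Rightarrow> real) \<Rightarrow> (real \<Rightarrow> (real \<Rightarrow> real) measure) \<Rightarrow>
   (real \<Rightarrow> real) \<Rightarrow> real \<Rightarrow> bool" where
  "admissible_payoff r \<alpha> \<beta> \<mu> \<sigma> Pr g x\<^sub>g \<longleftrightarrow>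
     g C1_differentiable_on einterval \<alpha> \<beta> \<and> deriv g C1_differentiable_on einterval \<alpha> \<beta> \<and>
     discounted_sup_integrable r \<alpha> \<beta> Pr (\<lambda>x. \<bar>g x\<bar>) \<and>
     discounted_vanishing r \<alpha> \<beta> Pr g \<and>
     (\<exists>x\<^sub>0\<in>einterval \<alpha> \<beta>.
        (\<forall>x\<in>einterval \<alpha> x\<^sub>0. generator \<mu> \<sigma> g x - r * g x > 0) \<and>
        (\<forall>x\<in>einterval x\<^sub>0 \<beta>. generator \<mu> \<sigma> g x - r * g x < 0) \<and>
        x\<^sub>g \<in> einterval x\<^sub>0 \<beta>) \<and>
     {x \<in> einterval \<alpha> \<beta>. stopping_value r \<alpha> \<beta> Pr g x = g x} = {x. x\<^sub>g \<le> x \<and> ereal x < \<beta>} \<and>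
     (stopping_value r \<alpha> \<beta> Pr g has_real_derivative deriv g x\<^sub>g) (at x\<^sub>g)"

definition mean_value ::
  "real \<Rightarrow> ereal \<Rightarrow> ereal \<Rightarrow> (real \<Rightarrow> (real \<Rightarrow> real) measure) \<Rightarrow> (real \<Rightarrow> real) \<Rightarrow> (real \<Rightarrow> real) \<Rightarrow> real \<Rightarrow> real" where
  "mean_value r \<alpha> \<beta> Pr R U x = (stopping_value r \<alpha> \<beta> Pr U x + stopping_value r \<alpha> \<beta> Pr R x) / 2"

definition half_gain ::
  "real \<Rightarrow> ereal \<Rightarrow> ereal \<Rightarrow> (real \<Rightarrow> (real \<Rightarrow> real) measure) \<Rightarrow> (real \<Rightarrow> real) \<Rightarrow> (real \<Rightarrow> real) \<Rightarrow> real \<Rightarrow> real" where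
  "half_gain r \<alpha> \<beta> Pr R U x = (stopping_value r \<alpha> \<beta> Pr U x - stopping_value r \<alpha> \<beta> Pr R x) / 2"

definition piecewise_C2_on :: "real set \<Rightarrow> (real \<Rightarrow> real) \<Rightarrow> bool" where
  "piecewise_C2_on I g \<longleftrightarrow>
     (\<exists>D. finite D \<and>
        (\<forall>x\<in>I - D. g differentiable at x \<and> deriv g differentiable at x) \<and>
        continuous_on (I - D) (deriv (deriv g)) \<and>
        (\<forall>d\<in>D \<inter> I. (\<exists>l. (deriv (deriv g) \<longlongrightarrow> l) (at_left d)) \<and>
                   (\<exists>l. (deriv (deriv g) \<longlongrightarrow> l) (at_right d))))"

definition mean_value_conditions ::
  "real \<Rightarrow> ereal \<Rightarrow> ereal \<Rightarrow> (real \<Rightarrow> real) \<Rightarrow> (real \<Rightarrow> real) \<Rightarrow> (real \<Rightarrow> (real \<Rightarrow> real) measure) \<Rightarrow>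
   (real \<Rightarrow> real) \<Rightarrow> (real \<Rightarrow> real) \<Rightarrow> bool" where
  "mean_value_conditions r \<alpha> \<beta> \<mu> \<sigma> Pr R G \<longleftrightarrow>
     G C1_differentiable_on einterval \<alpha> \<beta> \<and> piecewise_C2_on (einterval \<alpha> \<beta>) G \<and>
     discounted_sup_integrable r \<alpha> \<beta> Pr G \<and>
     discounted_vanishing r \<alpha> \<beta> Pr G \<and>
     (\<forall>x\<in>einterval \<alpha> \<beta>. G x > stopping_value r \<alpha> \<beta> Pr R x) \<and>
     (\<forall>x\<in>einterval \<alpha> \<beta>. deriv G differentiable at x \<longrightarrow> generator \<mu> \<sigma> G x - r * G x \<le> 0)"

definition half_gain_conditions :: "ereal \<Rightarrow> ereal \<Rightarrow> (real \<Rightarrow> real) \<Rightarrow> bool" where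
  "half_gain_conditions \<alpha> \<beta> P \<longleftrightarrow>
     (\<forall>x\<in>einterval \<alpha> \<beta>. P differentiable at x \<and> deriv P x > 0) \<and>
     P ` einterval \<alpha> \<beta> = {0<..}"


section \<open>Development cost and breakthrough threshold\<close>

definition C1_on :: "real set \<Rightarrow> (real \<Rightarrow> real) \<Rightarrow> bool" where
  "C1_on S u \<longleftrightarrow> (\<exists>u'. (\<forall>x\<in>S. (u has_real_derivative u' x) (at x within S)) \<and> continuous_on S u')"

definition cost_distribution :: "real measure \<Rightarrow> (real \<Rightarrow> real) \<Rightarrow> bool" where
  "cost_distribution D f \<longleftrightarrow>
     prob_space D \<and> D = density lborel (\<lambda>z. ennreal (indicator {0..} z * f z)) \<and>
     C1_on {0..} f \<and> (\<forall>z\<ge>0. f z > 0)"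

definition threshold_density :: "(real \<Rightarrow> real) \<Rightarrow> (real \<Rightarrow> real) \<Rightarrow> real \<Rightarrow> real" where
  "threshold_density P f_Z y = deriv P y * f_Z (P y)"

definition locally_lipschitz_on :: "real set \<Rightarrow> (real \<Rightarrow> real) \<Rightarrow> bool" where
  "locally_lipschitz_on I f \<longleftrightarrow> (\<forall>x\<in>I. \<exists>\<delta>>0. \<exists>L. L-lipschitz_on (cball x \<delta> \<inter> I) f)"


section \<open>The variational system\<close>

text \<open>All derivatives are taken within the slices of \<open>A\<close>, hence are one-sided at its boundary.\<close>

definition C1_on2 :: "(real \<times> real) set \<Rightarrow> (real \<Rightarrow> real \<Rightarrow> real) \<Rightarrow> bool" where
  "C1_on2 A W \<longleftrightarrow>
     (\<exists>Wx Wm.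
        (\<forall>(x, m)\<in>A.
           ((\<lambda>y. W y m) has_real_derivative Wx x m) (at x within {y. (y, m) \<in> A}) \<and>
           ((\<lambda>n. W x n) has_real_derivative Wm x m) (at m within {n. (x, n) \<in> A})) \<and>
        continuous_on A (\<lambda>(x, m). Wx x m) \<and> continuous_on A (\<lambda>(x, m). Wm x m))"

definition C21_on2 :: "(real \<times> real) set \<Rightarrow> (real \<Rightarrow> real \<Rightarrow> real) \<Rightarrow> bool" where
  "C21_on2 A W \<longleftrightarrow>
     (\<exists>Wx Wxx Wm.
        (\<forall>(x, m)\<in>A.
           ((\<lambda>y. W y m) has_real_derivative Wx x m) (at x within {y. (y, m) \<in> A}) \<and>
           ((\<lambda>y. Wx y m) has_real_derivative Wxx x m) (at x within {y. (y, m) \<in> A}) \<and>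
           ((\<lambda>n. W x n) has_real_derivative Wm x m) (at m within {n. (x, n) \<in> A})) \<and>
        continuous_on A (\<lambda>(x, m). Wx x m) \<and> continuous_on A (\<lambda>(x, m). Wxx x m) \<and>
        continuous_on A (\<lambda>(x, m). Wm x m))"

definition state_set :: "ereal \<Rightarrow> ereal \<Rightarrow> (real \<times> real) set" where
  "state_set \<alpha> \<beta> = {(x, m). x \<in> einterval \<alpha> \<beta> \<and> m \<in> einterval \<alpha> \<beta> \<and> x \<le> m}"

definition stopping_set :: "ereal \<Rightarrow> ereal \<Rightarrow> real \<Rightarrow> real \<Rightarrow> (real \<Rightarrow> real) \<Rightarrow> (real \<times> real) set" where
  "stopping_set \<alpha> \<beta> x\<^sub>R m\<^sub>0 b =
     {(x, m). (x, m) \<in> state_set \<alpha> \<beta> \<and> m\<^sub>0 \<le> m \<and> x\<^sub>R \<le> x \<and> x \<le> b m}"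

text \<open>\<open>m\<^sub>0\<close> is the left endpoint of the domain \<open>[m\<^sub>0, \<beta>)\<close> of the boundary \<open>b\<close>; values of \<open>b\<close> elsewhere
  are irrelevant. On the diagonal, the derivative with respect to \<open>m\<close> is one-sided as \<open>W\<close> lives on
  \<open>{(x, m). x \<le> m}\<close>.\<close>

definition variational_system ::
  "real \<Rightarrow> ereal \<Rightarrow> ereal \<Rightarrow> (real \<Rightarrow> real) \<Rightarrow> (real \<Rightarrow> real) \<Rightarrow> (real \<Rightarrow> real) \<Rightarrow> real \<Rightarrow> (real \<Rightarrow> real) \<Rightarrow>
   (real \<Rightarrow> real) \<Rightarrow> (real \<Rightarrow> real) \<Rightarrow> real \<Rightarrow> (real \<Rightarrow> real) \<Rightarrow> (real \<Rightarrow> real \<Rightarrow> real) \<Rightarrow> bool" where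
  "variational_system r \<alpha> \<beta> \<mu> \<sigma> R x\<^sub>R G F f m\<^sub>0 b W \<longleftrightarrow>
     x\<^sub>R < m\<^sub>0 \<and> ereal m\<^sub>0 < \<beta> \<and>
     b m\<^sub>0 = x\<^sub>R \<and>
     (\<forall>m. m\<^sub>0 \<le> m \<and> ereal m < \<beta> \<longrightarrow> x\<^sub>R \<le> b m \<and> b m < m) \<and>
     ((\<lambda>m. ereal (b (real_of_ereal m))) \<longlongrightarrow> \<beta>) (at_left \<beta>) \<and>
     (\<forall>(x, m) \<in> interior (state_set \<alpha> \<beta> - stopping_set \<alpha> \<beta> x\<^sub>R m\<^sub>0 b).
        generator \<mu> \<sigma> (\<lambda>y. W y m) x - r * W x m = 0) \<and>
     (\<forall>(x, m) \<in> stopping_set \<alpha> \<beta> x\<^sub>R m\<^sub>0 b. W x m = (1 - F m) * R x) \<and>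
     (\<forall>m. m\<^sub>0 \<le> m \<and> ereal m < \<beta> \<longrightarrow>
        ((\<lambda>y. W y m) has_real_derivative (1 - F m) * deriv R (b m)) (at (b m))) \<and>
     (\<forall>m\<in>einterval \<alpha> \<beta>. ((\<lambda>n. W m n) has_real_derivative - f m * G m) (at m within {m..})) \<and>
     (\<forall>m\<in>einterval \<alpha> \<beta>. ((\<lambda>x. W (real_of_ereal x) m) \<longlongrightarrow> 0) (at_right \<alpha>))"

definition variational_regularity ::
  "ereal \<Rightarrow> ereal \<Rightarrow> real \<Rightarrow> real \<Rightarrow> (real \<Rightarrow> real) \<Rightarrow> (real \<Rightarrow> real \<Rightarrow> real) \<Rightarrow> bool" where
  "variational_regularity \<alpha> \<beta> x\<^sub>R m\<^sub>0 b W \<longleftrightarrow>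
     C1_on {m. m\<^sub>0 \<le> m \<and> ereal m < \<beta>} b \<and>
     continuous_on (state_set \<alpha> \<beta>) (\<lambda>(x, m). W x m) \<and>
     C1_on2 (state_set \<alpha> \<beta> - {(x, m). m = m\<^sub>0}) W \<and>
     C21_on2 {(x, m) \<in> state_set \<alpha> \<beta>. m\<^sub>0 \<le> m \<and> x \<le> x\<^sub>R} W \<and>
     C21_on2 {(x, m) \<in> state_set \<alpha> \<beta>. m\<^sub>0 \<le> m \<and> b m \<le> x} W \<and>
     C21_on2 {(x, m) \<in> state_set \<alpha> \<beta>. m \<le> m\<^sub>0} W \<and>
     C21_on2 (stopping_set \<alpha> \<beta> x\<^sub>R m\<^sub>0 b) W"

text \<open>\<open>b\<close>, with domain \<open>[m\<^sub>0, \<beta>)\<close>, is the boundary component of the unique regular solution.\<close>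

definition optimal_free_boundary ::
  "real \<Rightarrow> ereal \<Rightarrow> ereal \<Rightarrow> (real \<Rightarrow> real) \<Rightarrow> (real \<Rightarrow> real) \<Rightarrow> (real \<Rightarrow> real) \<Rightarrow> real \<Rightarrow> (real \<Rightarrow> real) \<Rightarrow>
   (real \<Rightarrow> real) \<Rightarrow> (real \<Rightarrow> real) \<Rightarrow> real \<Rightarrow> (real \<Rightarrow> real) \<Rightarrow> bool" where
  "optimal_free_boundary r \<alpha> \<beta> \<mu> \<sigma> R x\<^sub>R G F f m\<^sub>0 b \<longleftrightarrow>
     (\<exists>W. variational_system r \<alpha> \<beta> \<mu> \<sigma> R x\<^sub>R G F f m\<^sub>0 b W \<and> variational_regularity \<alpha> \<beta> x\<^sub>R m\<^sub>0 b W \<and>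
        (\<forall>n\<^sub>0 c V. variational_system r \<alpha> \<beta> \<mu> \<sigma> R x\<^sub>R G F f n\<^sub>0 c V \<and> variational_regularity \<alpha> \<beta> x\<^sub>R n\<^sub>0 c V \<longrightarrow>
           n\<^sub>0 = m\<^sub>0 \<and> (\<forall>m. m\<^sub>0 \<le> m \<and> ereal m < \<beta> \<longrightarrow> c m = b m) \<and>
           (\<forall>(x, m) \<in> state_set \<alpha> \<beta>. V x m = W x m)))"

end

theory Submission
  imports Defs
begin

text \<open>Let \<open>\<psi>\<close> be the solution of \<open>\<L> u = r u\<close> that agrees with \<open>R\<close> to first order at \<open>x\<^sub>R\<close>; it
  vanishes at \<open>\<alpha>\<close>, hence is positive. Divide everything by \<open>\<psi>\<close> and use a scale \<open>\<zeta>\<close> in which solutions of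
  \<open>\<L> u = r u\<close> become affine. Then \<open>\<rho> = R / \<psi>\<close> is concave to the right of \<open>x\<^sub>R\<close>, \<open>\<gamma> = G / \<psi>\<close> is concave, and
  smooth fit makes \<open>W(\<cdot>, m)\<close> to the right of \<open>b m\<close> a multiple of the tangent to \<open>\<rho>\<close> at \<open>b m\<close>. The
  condition on the diagonal becomes a differential equation \<open>b' = h(m) K(m, b)\<close> in which the distribution
  of the threshold enters only through its hazard rate \<open>h\<close>. Concavity of \<open>\<gamma>\<close> gives \<open>K > 0\<close> along a
  boundary, so where \<open>b\<^sub>1\<close> and \<open>b\<^sub>2\<close> meet, \<open>b\<^sub>1\<close> is steeper. It remains to exclude \<open>b\<^sub>1 > b\<^sub>2\<close> at some point.
  In that case the solution of the second equation through that point of the graph of \<open>b\<^sub>1\<close> lies between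
  the two boundaries from there on, so that it tends to \<open>\<beta>\<close>, and backwards it stays above \<open>b\<^sub>2\<close> until it
  reaches \<open>x\<^sub>R\<close>. It yields a second regular solution of the second variational system, contradicting
  uniqueness.\<close>

section \<open>Differential equations with a Lipschitz right-hand side\<close>

text \<open>The equation \<open>b' = h K\<close> has two singularities, which shape the proof.
  \<open>K\<close> is the reciprocal of \<open>inverse_slope\<close>, so it blows up when
  \<open>b\<close> approaches the diagonal; a solution continued backwards might end there before it
  reaches \<open>x\<^sub>R\<close>. The inverse function has the field
  \<open>inverse_slope / h\<close>, which vanishes on the diagonal; since 0 is less than the slope 1
  of the diagonal, a backward trajectory cannot meet it. The other singularity, where the tangent
  meets \<gamma>, is kept away by \<open>b2\<close>: between the diagonal and the inverse of
  \<open>b2\<close>, concavity of \<gamma> leaves the tangent below \<gamma>. Clamping the state to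
  this region gives a globally Lipschitz field, hence a solution on all of
  \<open>[x\<^sub>R, \<beta>)\<close>. The scale \<zeta> comes from reduction of order: \<psi> and
  \<psi> \<zeta> span the solutions. Slopes with respect to \<zeta> are Wronskians with \<psi>
  divided by the scale density, and their derivatives have the sign of \<L> u - r u; so (A3) and
  (A7) turn into concavity. The process enters through value functions: as
  \<open>V\<^sub>R = R\<close> to the right of \<open>x\<^sub>R\<close>, there
  \<open>R \<ge> 0\<close> and \<open>R < G\<close>.\<close>

lemma at_within_between:
  fixes x :: real
  assumes "is_interval T" "a \<in> T" "b \<in> T" "a < x" "x < b"
  shows "at x within T = at x"
proof -
  have "{a<..<b} \<subseteq> T"
    using assms unfolding is_interval_1 by (meson greaterThanLessThan_iff less_imp_le subsetI)
  then have "x \<in> interior T"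
    using assms by (meson greaterThanLessThan_iff interior_maximal open_greaterThanLessThan subsetD)
  then show ?thesis by (rule at_within_interior)
qed

lemma interval_Icc_subset:
  fixes T :: "real set"
  assumes "is_interval T" "a \<in> T" "b \<in> T"
  shows "{a..b} \<subseteq> T"
  using assms unfolding is_interval_1 by (meson atLeastAtMost_iff subsetI)

text \<open>The weight \<open>exp (2 L |t - t0|)\<close> makes integration a contraction by the factor \<open>1/2\<close> on the
  whole interval, whatever its length.\<close>

lemma weighted_integration_bound:
  fixes u :: "real \<Rightarrow> 'a::real_normed_vector"
  assumes T: "is_interval T" "t0 \<in> T" "t \<in> T"
    and u: "\<And>t. t \<in> T \<Longrightarrow> (u has_vector_derivative u' t) (at t within T)"
    and "u t0 = 0" and "0 \<le> C"
    and bd: "\<And>t. t \<in> T \<Longrightarrow> norm (u' t) \<le> L * C * exp (2 * L * \<bar>t - t0\<bar>)"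
  shows "norm (u t) \<le> C / 2 * exp (2 * L * \<bar>t - t0\<bar>)"
proof -
  have cont: "continuous_on T u"
    using u has_vector_derivative_continuous continuous_on_eq_continuous_within by blast
  consider "t = t0" | "t0 < t" | "t < t0" by linarith
  then show ?thesis
  proof cases
    case 1
    then show ?thesis using assms by simp
  next
    case 2
    have sub: "{t0..t} \<subseteq> T" using T by (intro interval_Icc_subset)
    have "norm (u t - u t0) \<le> C / 2 * exp (2 * L * (t - t0)) - C / 2 * exp (2 * L * (t0 - t0))"
    proof (rule differentiable_bound_general[OF 2,
          where \<phi> = "\<lambda>s. C / 2 * exp (2 * L * (s - t0))" and f' = u'
            and \<phi>' = "\<lambda>s. L * C * exp (2 * L * (s - t0))"])
      show "continuous_on {t0..t} u" using cont sub continuous_on_subset by blast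
      show "continuous_on {t0..t} (\<lambda>s. C / 2 * exp (2 * L * (s - t0)))"
        by (intro continuous_intros)
      fix x assume x: "t0 < x" "x < t"
      show "(u has_vector_derivative u' x) (at x)"
        using u[of x] x sub at_within_between[OF T] by (metis atLeastAtMost_iff less_imp_le subsetD)
      show "((\<lambda>s. C / 2 * exp (2 * L * (s - t0))) has_vector_derivative L * C * exp (2 * L * (x - t0))) (at x)"
        unfolding has_real_derivative_iff_has_vector_derivative[symmetric]
        by (auto intro!: derivative_eq_intros)
      show "norm (u' x) \<le> L * C * exp (2 * L * (x - t0))"
        using bd[of x] x sub by (auto simp: subset_iff)
    qed
    then show ?thesis using 2 \<open>u t0 = 0\<close> \<open>0 \<le> C\<close> by simp
  next
    case 3
    have sub: "{t..t0} \<subseteq> T" using T by (intro interval_Icc_subset)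
    have "norm (u t0 - u t) \<le> - (C / 2 * exp (2 * L * (t0 - t0))) - (- (C / 2 * exp (2 * L * (t0 - t))))"
    proof (rule differentiable_bound_general[OF 3,
          where \<phi> = "\<lambda>s. - (C / 2 * exp (2 * L * (t0 - s)))" and f' = u'
            and \<phi>' = "\<lambda>s. L * C * exp (2 * L * (t0 - s))"])
      show "continuous_on {t..t0} u" using cont sub continuous_on_subset by blast
      show "continuous_on {t..t0} (\<lambda>s. - (C / 2 * exp (2 * L * (t0 - s))))"
        by (intro continuous_intros)
      fix x assume x: "t < x" "x < t0"
      show "(u has_vector_derivative u' x) (at x)"
        using u[of x] x sub at_within_between[OF T(1,3,2)] by (metis atLeastAtMost_iff less_imp_le subsetD)
      show "((\<lambda>s. - (C / 2 * exp (2 * L * (t0 - s)))) has_vector_derivative L * C * exp (2 * L * (t0 - x))) (at x)"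
        unfolding has_real_derivative_iff_has_vector_derivative[symmetric]
        by (auto intro!: derivative_eq_intros)
      show "norm (u' x) \<le> L * C * exp (2 * L * (t0 - x))"
        using bd[of x] x sub by (auto simp: subset_iff abs_minus_commute)
    qed
    then show ?thesis using 3 \<open>u t0 = 0\<close> \<open>0 \<le> C\<close> by simp
  qed
qed

text \<open>Each pass through the weighted estimate halves the constant, so the difference of two
  solutions is at most \<open>M / 2 ^ n\<close> times one fixed weight, for every
  \<open>n\<close>.\<close>

lemma ode_unique_compact:
  fixes F :: "real \<Rightarrow> 'a::real_normed_vector \<Rightarrow> 'a"
  assumes t0: "t0 \<in> {a..b}" and t: "t \<in> {a..b}"
    and L: "\<And>t. t \<in> {a..b} \<Longrightarrow> L-lipschitz_on UNIV (F t)"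
    and x: "\<And>t. t \<in> {a..b} \<Longrightarrow> (x has_vector_derivative F t (x t)) (at t within {a..b})"
    and y: "\<And>t. t \<in> {a..b} \<Longrightarrow> (y has_vector_derivative F t (y t)) (at t within {a..b})"
    and eq: "x t0 = y t0"
  shows "x t = y t"
proof -
  let ?d = "\<lambda>t. x t - y t"
  have L0: "0 \<le> L" using L[OF t0] lipschitz_on_nonneg by blast
  have dd: "(?d has_vector_derivative (F t (x t) - F t (y t))) (at t within {a..b})" if "t \<in> {a..b}" for t
    using x y that by (auto intro!: derivative_intros)
  have "continuous_on {a..b} ?d"
    using dd has_vector_derivative_continuous continuous_on_eq_continuous_within by blast
  then have "bounded (?d ` {a..b})" by (intro compact_imp_bounded compact_continuous_image) auto
  then obtain M where M: "\<And>t. t \<in> {a..b} \<Longrightarrow> norm (?d t) \<le> M" unfolding bounded_iff by blast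
  have M0: "0 \<le> M" using M[OF t0] norm_ge_zero order_trans by blast
  have bound: "norm (?d t) \<le> M / 2 ^ n * exp (2 * L * \<bar>t - t0\<bar>)" if "t \<in> {a..b}" for n t
    using that
  proof (induction n arbitrary: t)
    case 0
    have "M * 1 \<le> M * exp (2 * L * \<bar>t - t0\<bar>)"
      using M0 L0 by (intro mult_left_mono) auto
    then show ?case using M[OF 0] by simp
  next
    case (Suc n)
    have "norm (?d t) \<le> (M / 2 ^ n) / 2 * exp (2 * L * \<bar>t - t0\<bar>)"
    proof (rule weighted_integration_bound[OF is_interval_cc t0 Suc.prems dd])
      fix s assume s: "s \<in> {a..b}"
      have "norm (F s (x s) - F s (y s)) \<le> L * norm (?d s)"
        using lipschitz_onD[OF L[OF s], of "x s" "y s"] by (simp add: dist_norm)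
      also have "\<dots> \<le> L * (M / 2 ^ n * exp (2 * L * \<bar>s - t0\<bar>))"
        using Suc.IH[OF s] L0 by (intro mult_left_mono)
      finally show "norm (F s (x s) - F s (y s)) \<le> L * (M / 2 ^ n) * exp (2 * L * \<bar>s - t0\<bar>)"
        by (simp only: mult.assoc)
    qed (use eq M0 in auto)
    then show ?case by simp
  qed
  have "(\<lambda>n. M * exp (2 * L * \<bar>t - t0\<bar>) * (1 / 2) ^ n) \<longlonglongrightarrow> M * exp (2 * L * \<bar>t - t0\<bar>) * 0"
    by (intro tendsto_intros LIMSEQ_realpow_zero) auto
  moreover have "norm (?d t) \<le> M * exp (2 * L * \<bar>t - t0\<bar>) * (1 / 2) ^ n" for n
    using bound[OF t, of n] by (simp add: power_divide)
  ultimately have "norm (?d t) \<le> 0"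
    by (intro LIMSEQ_le_const[where a = "norm (?d t)"]) auto
  then show ?thesis by simp
qed

text \<open>Picard iteration. By the weighted estimate successive iterates differ by geometrically
  decreasing amounts on the whole of \<open>{a..b}\<close>, so no continuation in small time steps
  takes place.\<close>

lemma ode_exists_compact:
  fixes F :: "real \<Rightarrow> 'a::banach \<Rightarrow> 'a"
  assumes t0: "t0 \<in> {a..b}"
    and L: "\<And>t. t \<in> {a..b} \<Longrightarrow> L-lipschitz_on UNIV (F t)"
    and F: "continuous_on ({a..b} \<times> UNIV) (\<lambda>(t, x). F t x)"
  shows "\<exists>x. x t0 = x0 \<and> (\<forall>t\<in>{a..b}. (x has_vector_derivative F t (x t)) (at t within {a..b}))"
proof -
  have L0: "0 \<le> L" using L[OF t0] lipschitz_on_nonneg by blast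
  \<comment> \<open>The signed integral from \<open>t0\<close> to \<open>t\<close>, meaningful on
    both sides of \<open>t0\<close>.\<close>
  define J where "J g t = integral {a..t} g - integral {a..t0} g" for g :: "real \<Rightarrow> 'a" and t
  define X where "X = rec_nat (\<lambda>t. x0) (\<lambda>_ u t. x0 + J (\<lambda>s. F s (u s)) t)"
  have X0: "X 0 = (\<lambda>t. x0)" and XS: "X (Suc n) = (\<lambda>t. x0 + J (\<lambda>s. F s (X n s)) t)" for n
    by (simp_all add: X_def)
  have Fcont: "continuous_on {a..b} (\<lambda>s. F s (u s))" if "continuous_on {a..b} u" for u
    using continuous_on_compose2[OF F, of "{a..b}" "\<lambda>s. (s, u s)"] continuous_on_Pair[OF continuous_on_id that]
    by auto
  have J: "(J g has_vector_derivative g t) (at t within {a..b})" if "continuous_on {a..b} g" "t \<in> {a..b}" for g t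
    unfolding J_def using integral_has_vector_derivative[OF that] by (auto intro!: derivative_eq_intros)
  have XSd: "(X (Suc n) has_vector_derivative F t (X n t)) (at t within {a..b})"
    if "continuous_on {a..b} (X n)" "t \<in> {a..b}" for n t
    unfolding XS using J[OF Fcont[OF that(1)] that(2)] by (auto intro!: derivative_eq_intros)
  have Xc: "continuous_on {a..b} (X n)" for n
  proof (induction n)
    case (Suc n)
    then show ?case
      using XSd has_vector_derivative_continuous continuous_on_eq_continuous_within by blast
  qed (simp add: X0)
  note Xd = XSd[OF Xc]
  have Xt0: "X n t0 = x0" for n by (cases n) (auto simp: X0 XS J_def)
  let ?D = "\<lambda>n t. X (Suc n) t - X n t"
  have "bounded (?D 0 ` {a..b})"
    by (intro compact_imp_bounded compact_continuous_image continuous_on_diff Xc) auto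
  then obtain M where M: "\<And>t. t \<in> {a..b} \<Longrightarrow> norm (?D 0 t) \<le> M" unfolding bounded_iff by blast
  have M0: "0 \<le> M" using M[OF t0] norm_ge_zero order_trans by blast
  have bound: "norm (?D n t) \<le> M / 2 ^ n * exp (2 * L * \<bar>t - t0\<bar>)" if "t \<in> {a..b}" for n t
    using that
  proof (induction n arbitrary: t)
    case 0
    have "M * 1 \<le> M * exp (2 * L * \<bar>t - t0\<bar>)"
      using M0 L0 by (intro mult_left_mono) auto
    then show ?case using M[OF 0] by simp
  next
    case (Suc n)
    have "norm (?D (Suc n) t) \<le> (M / 2 ^ n) / 2 * exp (2 * L * \<bar>t - t0\<bar>)"
    proof (rule weighted_integration_bound[OF is_interval_cc t0 Suc.prems])
      fix s assume s: "s \<in> {a..b}"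
      show "(?D (Suc n) has_vector_derivative (F s (X (Suc n) s) - F s (X n s))) (at s within {a..b})"
        using Xd s by (auto intro!: derivative_intros)
      have "norm (F s (X (Suc n) s) - F s (X n s)) \<le> L * norm (?D n s)"
        using lipschitz_onD[OF L[OF s], of "X (Suc n) s" "X n s"] by (simp add: dist_norm)
      also have "\<dots> \<le> L * (M / 2 ^ n * exp (2 * L * \<bar>s - t0\<bar>))"
        using Suc.IH[OF s] L0 by (intro mult_left_mono)
      finally show "norm (F s (X (Suc n) s) - F s (X n s)) \<le> L * (M / 2 ^ n) * exp (2 * L * \<bar>s - t0\<bar>)"
        by (simp only: mult.assoc)
    qed (use Xt0 M0 in auto)
    then show ?case by simp
  qed
  \<comment> \<open>An upper bound of the weight over \<open>{a..b}\<close>; it turns the pointwise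
    bounds into one summable majorant.\<close>
  let ?K = "exp (2 * L * (b - a))"
  have "uniform_limit {a..b} (\<lambda>n t. \<Sum>i<n. ?D i t) (\<lambda>t. suminf (\<lambda>i. ?D i t)) sequentially"
  proof (rule Weierstrass_m_test)
    show "summable (\<lambda>n. M * ?K * (1 / 2) ^ n)" by (intro summable_mult summable_geometric) auto
    fix n t assume t: "t \<in> {a..b}"
    have "\<bar>t - t0\<bar> \<le> b - a" using t t0 by auto
    then have "M / 2 ^ n * exp (2 * L * \<bar>t - t0\<bar>) \<le> M / 2 ^ n * ?K"
      using M0 L0 by (intro mult_left_mono) (auto intro!: mult_left_mono)
    then show "norm (?D n t) \<le> M * ?K * (1 / 2) ^ n"
      using bound[OF t, of n] by (simp add: power_divide)
  qed
  moreover have "(\<Sum>i<n. ?D i t) = X n t - x0" for n t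
    by (induction n) (auto simp: X0)
  ultimately have "uniform_limit {a..b} (\<lambda>n t. X n t - x0) (\<lambda>t. suminf (\<lambda>i. ?D i t)) sequentially"
    by simp
  then have "uniform_limit {a..b} (\<lambda>n t. X n t - x0 + x0) (\<lambda>t. suminf (\<lambda>i. ?D i t) + x0) sequentially"
    by (intro uniform_limit_intros)
  then obtain x where lim: "uniform_limit {a..b} X x sequentially"
    by (auto simp: eta_contract_eq)
  have pt: "(\<lambda>n. X n t) \<longlonglongrightarrow> x t" if "t \<in> {a..b}" for t
    using tendsto_uniform_limitI[OF lim that] .
  \<comment> \<open>The index is shifted because the derivative of \<open>X (Suc n)\<close> is the
    field along \<open>X n\<close>. By the Lipschitz bound these derivatives converge uniformly,
    which permits differentiating the limit.\<close>
  have "\<exists>g. \<forall>t\<in>{a..b}. (\<lambda>n. X (Suc n) t) \<longlonglongrightarrow> g t \<and> (g has_derivative (\<lambda>h. h *\<^sub>R F t (x t))) (at t within {a..b})"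
  proof (rule has_derivative_sequence[OF _ _ _ t0, where f' = "\<lambda>n t h. h *\<^sub>R F t (X n t)" and l = x0])
    show "(X (Suc n) has_derivative (\<lambda>h. h *\<^sub>R F t (X n t))) (at t within {a..b})" if "t \<in> {a..b}" for n t
      using Xd[OF that] by (simp add: has_vector_derivative_def)
    fix e :: real assume e: "0 < e"
    have "\<forall>\<^sub>F n in sequentially. \<forall>t\<in>{a..b}. dist (X n t) (x t) < e / (L + 1)"
      using lim e L0 by (auto simp: uniform_limit_iff)
    then show "\<forall>\<^sub>F n in sequentially. \<forall>t\<in>{a..b}. \<forall>h. norm (h *\<^sub>R F t (X n t) - h *\<^sub>R F t (x t)) \<le> e * norm h"
    proof (rule eventually_mono, intro ballI allI)
      fix n t and h :: real
      assume *: "\<forall>t\<in>{a..b}. dist (X n t) (x t) < e / (L + 1)" and t: "t \<in> {a..b}"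
      have "norm (F t (X n t) - F t (x t)) \<le> L * dist (X n t) (x t)"
        using lipschitz_onD[OF L[OF t], of "X n t" "x t"] by (simp add: dist_norm)
      also have "\<dots> \<le> (L + 1) * (e / (L + 1))"
        using * t L0 by (intro mult_mono) (auto intro: less_imp_le)
      finally have "norm (F t (X n t) - F t (x t)) \<le> e" using L0 by simp
      then have "norm h * norm (F t (X n t) - F t (x t)) \<le> norm h * e" by (intro mult_left_mono) auto
      then show "norm (h *\<^sub>R F t (X n t) - h *\<^sub>R F t (x t)) \<le> e * norm h"
        by (simp add: scaleR_diff_right[symmetric] mult.commute)
    qed
  qed (use Xt0 in auto)
  then obtain g where g: "\<And>t. t \<in> {a..b} \<Longrightarrow> (\<lambda>n. X (Suc n) t) \<longlonglongrightarrow> g t"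
    "\<And>t. t \<in> {a..b} \<Longrightarrow> (g has_vector_derivative F t (x t)) (at t within {a..b})"
    unfolding has_vector_derivative_def by blast
  have gx: "g t = x t" if "t \<in> {a..b}" for t
    using LIMSEQ_unique[OF g(1)[OF that] LIMSEQ_Suc[OF pt[OF that]]] .
  moreover have "x t0 = x0" using pt[OF t0] Xt0 by (simp add: LIMSEQ_const_iff)
  ultimately show ?thesis using g(2) t0 by (intro exI[of _ g]) auto
qed

text \<open>Reduces derivatives within an interval of any kind to compact intervals:
  \<open>{a..b}\<close> ends at \<open>t\<close> only if \<open>T\<close> does, so both look the
  same near \<open>t\<close>.\<close>

lemma interval_neighbourhood:
  fixes T :: "real set"
  assumes T: "is_interval T" "t0 \<in> T" "t \<in> T"
  obtains a b where "a \<in> T" "b \<in> T" "t0 \<in> {a..b}" "t \<in> {a..b}" "at t within T = at t within {a..b}"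
proof -
  obtain a where a: "a \<in> T" "a \<le> t0" "a \<le> t" "\<And>s. s \<in> T \<Longrightarrow> s < a \<Longrightarrow> a < t"
  proof (cases "\<exists>a\<in>T. a < min t t0")
    case True
    then show ?thesis using that by force
  next
    case False
    then show ?thesis using that[of "min t t0"] assms by (auto simp: min_def)
  qed
  obtain b where b: "b \<in> T" "t0 \<le> b" "t \<le> b" "\<And>s. s \<in> T \<Longrightarrow> b < s \<Longrightarrow> t < b"
  proof (cases "\<exists>b\<in>T. max t t0 < b")
    case True
    then show ?thesis using that by force
  next
    case False
    then show ?thesis using that[of "max t t0"] assms by (auto simp: max_def)
  qed
  have sub: "{a..b} \<subseteq> T" by (rule interval_Icc_subset[OF T(1) a(1) b(1)])
  define U where "U = {if a < t then a else t - 1 <..< if t < b then b else t + 1}"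
  have "at t within T = at t within {a..b}"
  proof (rule at_within_nhd[of t U])
    have "s \<in> {a..b}" if "s \<in> T" "s \<in> U" for s
      using that a(3,4) b(3,4) by (cases "s < a"; cases "b < s") (auto simp: U_def)
    then show "T \<inter> U - {t} = {a..b} \<inter> U - {t}"
      using sub by blast
  qed (auto simp: U_def)
  then show ?thesis using that a b by auto
qed

theorem ode_unique:
  fixes F :: "real \<Rightarrow> 'a::real_normed_vector \<Rightarrow> 'a"
  assumes T: "is_interval T" "t0 \<in> T" "t \<in> T"
    and L: "\<And>a b. a \<in> T \<Longrightarrow> b \<in> T \<Longrightarrow> \<exists>L. \<forall>t\<in>{a..b}. L-lipschitz_on UNIV (F t)"
    and x: "\<And>t. t \<in> T \<Longrightarrow> (x has_vector_derivative F t (x t)) (at t within T)"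
    and y: "\<And>t. t \<in> T \<Longrightarrow> (y has_vector_derivative F t (y t)) (at t within T)"
    and eq: "x t0 = y t0"
  shows "x t = y t"
proof -
  obtain a b where ab: "a \<in> T" "b \<in> T" "t0 \<in> {a..b}" "t \<in> {a..b}"
    by (rule interval_neighbourhood[OF T])
  obtain L where "\<forall>t\<in>{a..b}. L-lipschitz_on UNIV (F t)" using L[of a b] ab by blast
  moreover have "{a..b} \<subseteq> T" by (rule interval_Icc_subset[OF T(1) ab(1,2)])
  ultimately show ?thesis
    using ab eq has_vector_derivative_within_subset[OF x, of _ "{a..b}"]
      has_vector_derivative_within_subset[OF y, of _ "{a..b}"]
    by (intro ode_unique_compact[of t0 a b t L F x y]) blast+
qed

text \<open>Solutions on compact intervals agree on overlaps by uniqueness and are glued; the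
  Lipschitz constant may grow without bound towards the ends of \<open>T\<close>.\<close>

theorem ode_exists:
  fixes F :: "real \<Rightarrow> 'a::banach \<Rightarrow> 'a"
  assumes T: "is_interval T" "t0 \<in> T"
    and L: "\<And>a b. a \<in> T \<Longrightarrow> b \<in> T \<Longrightarrow> \<exists>L. \<forall>t\<in>{a..b}. L-lipschitz_on UNIV (F t)"
    and F: "continuous_on (T \<times> UNIV) (\<lambda>(t, x). F t x)"
  obtains x where "x t0 = x0" "\<And>t. t \<in> T \<Longrightarrow> (x has_vector_derivative F t (x t)) (at t within T)"
proof -
  let ?sol = "\<lambda>a b x. x t0 = x0 \<and> (\<forall>t\<in>{a..b}. (x has_vector_derivative F t (x t)) (at t within {a..b}))"
  have ex: "\<exists>x. ?sol a b x" if "a \<in> T" "b \<in> T" "t0 \<in> {a..b}" for a b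
  proof -
    obtain L where "\<forall>t\<in>{a..b}. L-lipschitz_on UNIV (F t)" using L[of a b] \<open>a \<in> T\<close> \<open>b \<in> T\<close> by blast
    moreover have "{a..b} \<subseteq> T" by (rule interval_Icc_subset[OF T(1) \<open>a \<in> T\<close> \<open>b \<in> T\<close>])
    ultimately show ?thesis
      using \<open>t0 \<in> {a..b}\<close> by (intro ode_exists_compact) (auto intro: continuous_on_subset[OF F])
  qed
  define X where "X a b = (SOME x. ?sol a b x)" for a b
  have X: "?sol a b (X a b)" if "a \<in> T" "b \<in> T" "t0 \<in> {a..b}" for a b
    unfolding X_def by (rule someI_ex[OF ex[OF that]])
  have agree: "X (min t t0) (max t t0) t = X a b t"
    if "a \<in> T" "b \<in> T" "t0 \<in> {a..b}" "t \<in> {a..b}" for a b t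
  proof -
    let ?c = "min t t0" and ?d = "max t t0"
    have sub: "{?c..?d} \<subseteq> {a..b}" "{a..b} \<subseteq> T"
      using that interval_Icc_subset[OF T(1)] by auto
    have mem: "t \<in> {?c..?d}" "t0 \<in> {?c..?d}" "?c \<in> T" "?d \<in> T" using that sub T by (auto simp: min_def max_def)
    obtain L where "\<forall>t\<in>{a..b}. L-lipschitz_on UNIV (F t)"
      using L[of a b] \<open>a \<in> T\<close> \<open>b \<in> T\<close> by blast
    then have lip: "L-lipschitz_on UNIV (F s)" if "s \<in> {?c..?d}" for s using sub that by blast
    have 1: "(X ?c ?d has_vector_derivative F s (X ?c ?d s)) (at s within {?c..?d})"
      if "s \<in> {?c..?d}" for s using X[OF mem(3,4,2)] that by blast
    have 2: "(X a b has_vector_derivative F s (X a b s)) (at s within {?c..?d})"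
      if "s \<in> {?c..?d}" for s
      using X[OF \<open>a \<in> T\<close> \<open>b \<in> T\<close> \<open>t0 \<in> {a..b}\<close>] that sub(1)
      by (meson has_vector_derivative_within_subset subsetD)
    show ?thesis
      using X[OF mem(3,4,2)] X[OF \<open>a \<in> T\<close> \<open>b \<in> T\<close> \<open>t0 \<in> {a..b}\<close>]
      by (intro ode_unique_compact[OF mem(2,1) lip 1 2]) auto
  qed
  \<comment> \<open>The value at \<open>t\<close> is read off the solution on the smallest compact
    interval containing \<open>t\<close> and \<open>t0\<close>; by \<open>agree\<close> every larger
    interval gives the same value.\<close>
  define x where "x t = X (min t t0) (max t t0) t" for t
  show ?thesis
  proof (rule that)
    show "x t0 = x0" using X[of t0 t0] T by (simp add: x_def)
    fix t assume t: "t \<in> T"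
    obtain a b where ab: "a \<in> T" "b \<in> T" "t0 \<in> {a..b}" "t \<in> {a..b}" and
      at: "at t within T = at t within {a..b}"
      by (rule interval_neighbourhood[OF T t])
    have eq: "x s = X a b s" if "s \<in> {a..b}" for s
      unfolding x_def by (rule agree[OF ab(1-3) that])
    have "(X a b has_vector_derivative F t (X a b t)) (at t within {a..b})"
      using X ab by blast
    then show "(x has_vector_derivative F t (x t)) (at t within T)"
        unfolding at using has_vector_derivative_transform[OF ab(4) eq] eq[OF ab(4)] by simp
  qed
qed

text \<open>A primitive solves an equation whose field ignores the state. This covers open and
  half-open intervals, with a prescribed value at \<open>t0\<close>.\<close>

corollary antiderivative_exists:
  fixes g :: "real \<Rightarrow> real"
  assumes "is_interval T" "t0 \<in> T" "continuous_on T g"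
  obtains h where "h t0 = h0" "\<And>t. t \<in> T \<Longrightarrow> (h has_real_derivative g t) (at t within T)"
proof -
  have 1: "\<exists>L. \<forall>t\<in>{a..b}. L-lipschitz_on UNIV (\<lambda>_::real. g t)" for a b
    by (intro exI[of _ 0]) (auto simp: lipschitz_on_def)
  have 2: "continuous_on (T \<times> UNIV) (\<lambda>(t, x::real). g t)"
    unfolding split_beta by (rule continuous_on_compose2[OF assms(3)]) (auto intro!: continuous_intros)
  show ?thesis
    by (rule ode_exists[OF assms(1,2) 1 2, of h0])
      (auto intro: that simp: has_real_derivative_iff_has_vector_derivative)
qed

section \<open>Barrier arguments, monotonicity and inverse functions on intervals\<close>

text \<open>At the last point where \<open>d\<close> is nonnegative it vanishes, and the positive
  derivative makes it positive just to the right. Trajectories are compared below by looking at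
  their slopes at contact points only.\<close>

lemma nonneg_if_increasing_at_zeros:
  fixes d :: "real \<Rightarrow> real"
  assumes "a \<le> b" "continuous_on {a..b} d" "0 \<le> d a"
    and up: "\<And>t. a \<le> t \<Longrightarrow> t < b \<Longrightarrow> d t = 0 \<Longrightarrow> \<exists>D>0. (d has_real_derivative D) (at t within {a..b})"
  shows "0 \<le> d b"
proof (rule ccontr)
  assume neg: "\<not> 0 \<le> d b"
  define Z where "Z = {t \<in> {a..b}. 0 \<le> d t}"
  have "closed Z"
    using continuous_closed_preimage[OF assms(2) closed_atLeastAtMost, of "{0..}"]
    unfolding Z_def vimage_def by (auto simp: Int_Collect elim!: back_subst[of closed])
  then have "compact Z"
    using compact_Int_closed[OF compact_Icc[of a b]] by (metis Z_def inf.absorb_iff2 mem_Collect_eq subsetI)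
  moreover have "a \<in> Z" using assms by (auto simp: Z_def)
  ultimately obtain t where t: "t \<in> Z" "\<And>s. s \<in> Z \<Longrightarrow> s \<le> t"
    using compact_attains_sup[of Z] by blast
  have tb: "a \<le> t" "t < b" "0 \<le> d t" using t neg by (auto simp: Z_def order_less_le)
  have neg': "d s < 0" if "t < s" "s \<le> b" for s
    using t(2)[of s] that tb by (force simp: Z_def)
  have "d t = 0"
  proof (rule ccontr)
    assume "d t \<noteq> 0"
    then have "0 < d t" using tb by simp
    moreover have "continuous_on {t..b} d" using assms(2) tb continuous_on_subset by fastforce
    ultimately obtain s where "t \<le> s" "s \<le> b" "d s = 0"
      using IVT2'[of d b 0 t] neg tb by auto
    then show False using neg'[of s] \<open>d t \<noteq> 0\<close> by (cases "s = t") auto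
  qed
  then obtain D where D: "D > 0" "(d has_real_derivative D) (at t within {a..b})" using up tb by blast
  obtain e where e: "e > 0" "\<And>h. 0 < h \<Longrightarrow> t + h \<in> {a..b} \<Longrightarrow> h < e \<Longrightarrow> d t < d (t + h)"
    using has_real_derivative_pos_inc_right[OF D(2,1)] by blast
  define h where "h = min (e / 2) (b - t)"
  have "0 < h" "t + h \<in> {a..b}" "h < e" using e tb by (auto simp: h_def min_def)
  then show False using e(2)[of h] neg'[of "t + h"] \<open>d t = 0\<close> by auto
qed

lemma interval_increasing:
  fixes f :: "real \<Rightarrow> real"
  assumes T: "is_interval T" "a \<in> T" "b \<in> T" and "a < b"
    and f: "\<And>x. x \<in> T \<Longrightarrow> (f has_real_derivative f' x) (at x within T)"
    and pos: "\<And>x. x \<in> T \<Longrightarrow> a < x \<Longrightarrow> x < b \<Longrightarrow> 0 < f' x"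
  shows "f a < f b"
proof (rule DERIV_pos_imp_increasing_open[OF \<open>a < b\<close>])
  have sub: "{a..b} \<subseteq> T" by (rule interval_Icc_subset[OF T])
  show "continuous_on {a..b} f"
    by (rule continuous_on_subset[OF DERIV_continuous_on[OF f] sub])
  fix x assume x: "a < x" "x < b"
  then have "x \<in> T" using sub by auto
  then show "\<exists>y. DERIV f x :> y \<and> 0 < y"
    using f[of x] pos[of x] x at_within_between[OF T x] by auto
qed

lemma interval_decreasing_weak:
  fixes f :: "real \<Rightarrow> real"
  assumes T: "is_interval T" "a \<in> T" "b \<in> T" and "a \<le> b"
    and f: "\<And>x. x \<in> T \<Longrightarrow> (f has_real_derivative f' x) (at x within T)"
    and neg: "\<And>x. x \<in> T \<Longrightarrow> a < x \<Longrightarrow> x < b \<Longrightarrow> f' x \<le> 0"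
  shows "f b \<le> f a"
proof (cases "a = b")
  case False
  then have "a < b" using \<open>a \<le> b\<close> by simp
  have sub: "{a..b} \<subseteq> T" by (rule interval_Icc_subset[OF T])
  have "continuous_on {a..b} f"
    by (rule continuous_on_subset[OF DERIV_continuous_on[OF f] sub])
  moreover have "DERIV f x :> f' x" if "a < x" "x < b" for x
    using f[of x] that sub at_within_between[OF T that] by (auto simp: subset_iff)
  ultimately obtain z where "a < z" "z < b" "f b - f a = (b - a) * f' z"
    using MVT[OF \<open>a < b\<close>, of f] by (metis DERIV_unique real_differentiable_def)
  moreover have "f' z \<le> 0" using neg[of z] \<open>a < z\<close> \<open>z < b\<close> sub by (simp add: subset_iff)
  ultimately show ?thesis using \<open>a < b\<close> by (smt (verit) mult_nonneg_nonpos)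
qed simp

lemma interval_increasing_weak:
  fixes f :: "real \<Rightarrow> real"
  assumes T: "is_interval T" "a \<in> T" "b \<in> T" and "a \<le> b"
    and f: "\<And>x. x \<in> T \<Longrightarrow> (f has_real_derivative f' x) (at x within T)"
    and pos: "\<And>x. x \<in> T \<Longrightarrow> a < x \<Longrightarrow> x < b \<Longrightarrow> 0 \<le> f' x"
  shows "f a \<le> f b"
  using interval_decreasing_weak[OF T \<open>a \<le> b\<close>, of "\<lambda>x. - f x" "\<lambda>x. - f' x"] f pos
  by (auto intro!: derivative_eq_intros)

text \<open>The condition is also imposed at \<open>t = b\<close>: a zero there would be preceded by
  negative values, which the weak version excludes.\<close>

lemma pos_if_increasing_at_zeros:
  fixes d :: "real \<Rightarrow> real"
  assumes "a \<le> b" "continuous_on {a..b} d" "0 < d a"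
    and up: "\<And>t. a \<le> t \<Longrightarrow> t \<le> b \<Longrightarrow> d t = 0 \<Longrightarrow> \<exists>D>0. (d has_real_derivative D) (at t within {a..b})"
  shows "0 < d b"
proof (rule ccontr)
  assume neg: "\<not> 0 < d b"
  have nn: "0 \<le> d t" if "a \<le> t" "t \<le> b" for t
  proof (rule nonneg_if_increasing_at_zeros[OF that(1), of d])
    show "continuous_on {a..t} d" using assms(2) that continuous_on_subset by fastforce
    fix s assume s: "a \<le> s" "s < t" "d s = 0"
    then have "s \<le> b" using that by linarith
    then obtain D where "D > 0" "(d has_real_derivative D) (at s within {a..b})"
      using up[of s] s by blast
    then show "\<exists>D>0. (d has_real_derivative D) (at s within {a..t})"
      using that by (intro exI[of _ D]) (auto elim: DERIV_subset)
  qed (use assms in auto)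
  then have "d b = 0" using neg assms(1) by force
  then obtain D where D: "D > 0" "(d has_real_derivative D) (at b within {a..b})"
    using up assms(1) by blast
  obtain e where e: "e > 0" "\<And>h. 0 < h \<Longrightarrow> b - h \<in> {a..b} \<Longrightarrow> h < e \<Longrightarrow> d (b - h) < d b"
    using has_real_derivative_pos_inc_left[OF D(2,1)] by blast
  have "a < b" using assms(1,3) \<open>d b = 0\<close> by (cases "a = b") auto
  define h where "h = min (e / 2) (b - a)"
  have "0 < h" "b - h \<in> {a..b}" "h < e" using e(1) \<open>a < b\<close> by (auto simp: h_def min_def)
  then show False using e(2)[of h] nn[of "b - h"] \<open>d b = 0\<close> by auto
qed

text \<open>The interval may contain an end point, where derivatives are one-sided. The inverse is
  continuous because it is monotone with an interval as its range; its difference quotients are then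
  reciprocals of those of \<open>f\<close>.\<close>

lemma inverse_of_increasing:
  fixes f :: "real \<Rightarrow> real"
  assumes A: "is_interval A" and fA: "f ` A = B"
    and f: "\<And>x. x \<in> A \<Longrightarrow> (f has_real_derivative f' x) (at x within A)"
    and pos: "\<And>x. x \<in> A \<Longrightarrow> 0 < f' x"
  obtains g where "\<And>y. y \<in> B \<Longrightarrow> g y \<in> A" "\<And>y. y \<in> B \<Longrightarrow> f (g y) = y"
    "\<And>x. x \<in> A \<Longrightarrow> g (f x) = x"
    "\<And>y. y \<in> B \<Longrightarrow> (g has_real_derivative 1 / f' (g y)) (at y within B)"
    "\<And>y z. y \<in> B \<Longrightarrow> z \<in> B \<Longrightarrow> y < z \<Longrightarrow> g y < g z"
proof -
  have mono: "f x < f y" if "x \<in> A" "y \<in> A" "x < y" for x y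
    by (rule interval_increasing[OF A that f]) (use pos in auto)
  have mono_iff: "f x < f y \<longleftrightarrow> x < y" if "x \<in> A" "y \<in> A" for x y
    using mono[OF that] mono[OF that(2,1)] by (cases x y rule: linorder_cases) auto
  have inj: "inj_on f A" by (rule inj_onI) (metis mono_iff linorder_less_linear less_irrefl)
  define g where "g = the_inv_into A f"
  have gA: "g y \<in> A" if "y \<in> B" for y
    using the_inv_into_into[OF inj] that fA by (auto simp: g_def)
  have fg: "f (g y) = y" if "y \<in> B" for y
    using f_the_inv_into_f[OF inj] that fA by (auto simp: g_def)
  have gf: "g (f x) = x" if "x \<in> A" for x
    using the_inv_into_f_f[OF inj that] by (simp add: g_def)
  have gmono: "g y < g z" if "y \<in> B" "z \<in> B" "y < z" for y z
    using mono_iff[OF gA gA] fg that by metis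
  have inB: "\<forall>\<^sub>F z in at y within B. z \<in> B" for y by (simp add: eventually_at_filter)
  have lim: "(g \<longlongrightarrow> g y) (at y within B)" if y: "y \<in> B" for y
  proof (rule order_tendstoI)
    fix l assume l: "l < g y"
    show "\<forall>\<^sub>F z in at y within B. l < g z"
    proof (cases "\<exists>x\<in>A. x < g y")
      case True
      then obtain x where x: "x \<in> A" "x < g y" by blast
      \<comment> \<open>A point of \<open>A\<close> in \<open>[l, g y)\<close>. If \<open>A\<close>
        has no point below \<open>g y\<close>, all values of \<open>g\<close> are at least
        \<open>g y\<close> and the bound is immediate.\<close>
      define k where "k = max l x"
      have k: "k \<in> A" "k < g y" "l \<le> k"
        using x l interval_Icc_subset[OF A x(1) gA[OF y]] by (auto simp: k_def)
      have "f k < y" using mono[OF k(1) gA[OF y] k(2)] fg[OF y] by simp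
      then have "\<forall>\<^sub>F z in at y within B. f k < z"
        by (rule order_tendstoD(1)[OF tendsto_ident_at])
      moreover have "\<forall>\<^sub>F z in at y within B. z \<in> B" by (rule inB)
      ultimately show ?thesis
      proof eventually_elim
        case (elim z)
        then show ?case using mono_iff[OF k(1) gA[OF elim(2)]] fg[OF elim(2)] k by simp
      qed
    next
      case False
      note inB
      then show ?thesis
        by eventually_elim (use False l gA in \<open>meson less_le_trans not_less\<close>)
    qed
  next
    fix l assume l: "g y < l"
    show "\<forall>\<^sub>F z in at y within B. g z < l"
    proof (cases "\<exists>x\<in>A. g y < x")
      case True
      then obtain x where x: "x \<in> A" "g y < x" by blast
      define k where "k = min l x"
      have k: "k \<in> A" "g y < k" "k \<le> l"
        using x l interval_Icc_subset[OF A gA[OF y] x(1)] by (auto simp: k_def)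
      have "y < f k" using mono[OF gA[OF y] k(1) k(2)] fg[OF y] by simp
      then have "\<forall>\<^sub>F z in at y within B. z < f k"
        by (rule order_tendstoD(2)[OF tendsto_ident_at])
      moreover have "\<forall>\<^sub>F z in at y within B. z \<in> B" by (rule inB)
      ultimately show ?thesis
      proof eventually_elim
        case (elim z)
        then show ?case using mono_iff[OF gA[OF elim(2)] k(1)] fg[OF elim(2)] k by simp
      qed
    next
      case False
      note inB
      then show ?thesis
        by eventually_elim (use False l gA in \<open>meson le_less_trans not_less\<close>)
    qed
  qed
  have "(g has_real_derivative 1 / f' (g y)) (at y within B)" if y: "y \<in> B" for y
  proof -
    have "filterlim g (at (g y) within A) (at y within B)"
      unfolding filterlim_at
    proof
      have "\<forall>\<^sub>F z in at y within B. z \<in> B \<and> z \<noteq> y" by (simp add: eventually_at_filter)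
      then show "\<forall>\<^sub>F z in at y within B. g z \<in> A \<and> g z \<noteq> g y"
        by eventually_elim (use fg y gA in metis)
    qed (rule lim[OF y])
    moreover have "((\<lambda>x. (f x - f (g y)) / (x - g y)) \<longlongrightarrow> f' (g y)) (at (g y) within A)"
      using f[OF gA[OF y]] by (simp add: has_field_derivative_iff)
    ultimately have "((\<lambda>z. (f (g z) - f (g y)) / (g z - g y)) \<longlongrightarrow> f' (g y)) (at y within B)"
      by (rule filterlim_compose[rotated])
    then have "((\<lambda>z. inverse ((f (g z) - f (g y)) / (g z - g y))) \<longlongrightarrow> inverse (f' (g y))) (at y within B)"
      using pos[OF gA[OF y]] by (intro tendsto_inverse) auto
    moreover have "\<forall>\<^sub>F z in at y within B. inverse ((f (g z) - f (g y)) / (g z - g y)) = (g z - g y) / (z - y)"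
    proof -
      note inB
      then show ?thesis by eventually_elim (simp add: fg y)
    qed
    ultimately show ?thesis
      unfolding has_field_derivative_iff by (simp only: Lim_transform_eventually inverse_eq_divide[of "f' (g y)"])
  qed
  then show ?thesis using that[of g] gA fg gf gmono by blast
qed

section \<open>Lipschitz bounds that are uniform in a parameter\<close>

text \<open>The parameter is \<open>y\<close>, and the range of the state may depend on it, as the
  clamped interval \<open>{y..N y}\<close> does below. Boundedness is included so that the property
  is stable under products.\<close>

definition bounded_lipschitz :: "'a set \<Rightarrow> ('a \<Rightarrow> real set) \<Rightarrow> ('a \<Rightarrow> real \<Rightarrow> real) \<Rightarrow> bool" where
  "bounded_lipschitz A X F \<longleftrightarrow>
     (\<exists>L M. 0 \<le> L \<and> 0 \<le> M \<and> (\<forall>y\<in>A. \<forall>u\<in>X y. \<bar>F y u\<bar> \<le> M \<and> (\<forall>v\<in>X y. \<bar>F y u - F y v\<bar> \<le> L * \<bar>u - v\<bar>)))"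

lemma bounded_lipschitz_mult:
  assumes "bounded_lipschitz A X F" "bounded_lipschitz A X G"
  shows "bounded_lipschitz A X (\<lambda>y u. F y u * G y u)"
proof -
  obtain L M where F: "0 \<le> L" "0 \<le> M" "\<And>y u. y \<in> A \<Longrightarrow> u \<in> X y \<Longrightarrow> \<bar>F y u\<bar> \<le> M"
    "\<And>y u v. y \<in> A \<Longrightarrow> u \<in> X y \<Longrightarrow> v \<in> X y \<Longrightarrow> \<bar>F y u - F y v\<bar> \<le> L * \<bar>u - v\<bar>"
    using assms(1) unfolding bounded_lipschitz_def by blast
  obtain L' M' where G: "0 \<le> L'" "0 \<le> M'" "\<And>y u. y \<in> A \<Longrightarrow> u \<in> X y \<Longrightarrow> \<bar>G y u\<bar> \<le> M'"
    "\<And>y u v. y \<in> A \<Longrightarrow> u \<in> X y \<Longrightarrow> v \<in> X y \<Longrightarrow> \<bar>G y u - G y v\<bar> \<le> L' * \<bar>u - v\<bar>"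
    using assms(2) unfolding bounded_lipschitz_def by blast
  have "\<bar>F y u * G y u - F y v * G y v\<bar> \<le> (M * L' + M' * L) * \<bar>u - v\<bar>"
    if "y \<in> A" "u \<in> X y" "v \<in> X y" for y u v
  proof -
    have "F y u * G y u - F y v * G y v = F y u * (G y u - G y v) + G y v * (F y u - F y v)"
      by (simp add: algebra_simps)
    also have "\<bar>\<dots>\<bar> \<le> \<bar>F y u\<bar> * \<bar>G y u - G y v\<bar> + \<bar>G y v\<bar> * \<bar>F y u - F y v\<bar>"
      by (metis abs_mult abs_triangle_ineq)
    also have "\<dots> \<le> M * (L' * \<bar>u - v\<bar>) + M' * (L * \<bar>u - v\<bar>)"
      using F G that by (intro add_mono mult_mono) auto
    finally show ?thesis by (simp add: algebra_simps)
  qed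
  moreover have "\<bar>F y u * G y u\<bar> \<le> M * M'" if "y \<in> A" "u \<in> X y" for y u
    using F G that by (auto simp: abs_mult intro!: mult_mono)
  ultimately show ?thesis
    using F(1,2) G(1,2) unfolding bounded_lipschitz_def
    by (intro exI[of _ "M * L' + M' * L"] exI[of _ "M * M'"]) auto
qed

lemma bounded_lipschitz_diff:
  assumes "bounded_lipschitz A X F" "bounded_lipschitz A X G"
  shows "bounded_lipschitz A X (\<lambda>y u. F y u - G y u)"
proof -
  obtain L M where F: "0 \<le> L" "0 \<le> M" "\<And>y u. y \<in> A \<Longrightarrow> u \<in> X y \<Longrightarrow> \<bar>F y u\<bar> \<le> M"
    "\<And>y u v. y \<in> A \<Longrightarrow> u \<in> X y \<Longrightarrow> v \<in> X y \<Longrightarrow> \<bar>F y u - F y v\<bar> \<le> L * \<bar>u - v\<bar>"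
    using assms(1) unfolding bounded_lipschitz_def by blast
  obtain L' M' where G: "0 \<le> L'" "0 \<le> M'" "\<And>y u. y \<in> A \<Longrightarrow> u \<in> X y \<Longrightarrow> \<bar>G y u\<bar> \<le> M'"
    "\<And>y u v. y \<in> A \<Longrightarrow> u \<in> X y \<Longrightarrow> v \<in> X y \<Longrightarrow> \<bar>G y u - G y v\<bar> \<le> L' * \<bar>u - v\<bar>"
    using assms(2) unfolding bounded_lipschitz_def by blast
  have "\<bar>(F y u - G y u) - (F y v - G y v)\<bar> \<le> (L + L') * \<bar>u - v\<bar>"
    if "y \<in> A" "u \<in> X y" "v \<in> X y" for y u v
    using F(4)[OF that] G(4)[OF that] by (simp add: distrib_right)
  moreover have "\<bar>F y u - G y u\<bar> \<le> M + M'" if "y \<in> A" "u \<in> X y" for y u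
    using F(3)[OF that] G(3)[OF that] by simp
  ultimately show ?thesis
    using F(1,2) G(1,2) unfolding bounded_lipschitz_def
    by (intro exI[of _ "L + L'"] exI[of _ "M + M'"]) auto
qed

lemma bounded_lipschitz_inverse:
  assumes "bounded_lipschitz A X F" "0 < d"
    and ge: "\<And>y u. y \<in> A \<Longrightarrow> u \<in> X y \<Longrightarrow> d \<le> F y u"
  shows "bounded_lipschitz A X (\<lambda>y u. inverse (F y u))"
proof -
  obtain L where F: "0 \<le> L"
    "\<And>y u v. y \<in> A \<Longrightarrow> u \<in> X y \<Longrightarrow> v \<in> X y \<Longrightarrow> \<bar>F y u - F y v\<bar> \<le> L * \<bar>u - v\<bar>"
    using assms(1) unfolding bounded_lipschitz_def by blast
  have "\<bar>inverse (F y u) - inverse (F y v)\<bar> \<le> L / (d * d) * \<bar>u - v\<bar>"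
    if "y \<in> A" "u \<in> X y" "v \<in> X y" for y u v
  proof -
    have p: "d \<le> F y u" "d \<le> F y v" using ge that by auto
    have "inverse (F y u) - inverse (F y v) = (F y v - F y u) / (F y u * F y v)"
      using p \<open>0 < d\<close> by (simp add: field_simps)
    also have "\<bar>\<dots>\<bar> = \<bar>F y u - F y v\<bar> / (F y u * F y v)"
      using p \<open>0 < d\<close> by (simp add: abs_divide abs_mult abs_minus_commute)
    also have "\<dots> \<le> (L * \<bar>u - v\<bar>) / (d * d)"
      using p \<open>0 < d\<close> F(2)[OF that] by (intro frac_le mult_mono) (auto intro: order_trans[OF _ F(2)[OF that]])
    finally show ?thesis by simp
  qed
  moreover have "\<bar>inverse (F y u)\<bar> \<le> inverse d" if "y \<in> A" "u \<in> X y" for y u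
    using ge[OF that] \<open>0 < d\<close> by (simp add: le_imp_inverse_le)
  ultimately show ?thesis
    using F(1) \<open>0 < d\<close> unfolding bounded_lipschitz_def
    by (intro exI[of _ "L / (d * d)"] exI[of _ "inverse d"]) auto
qed

lemma bounded_lipschitz_const:
  assumes "bounded (f ` A)"
  shows "bounded_lipschitz A X (\<lambda>y u. f y)"
proof -
  obtain M where M: "\<And>y. y \<in> A \<Longrightarrow> norm (f y) \<le> M" using assms unfolding bounded_iff by blast
  have "\<bar>f y\<bar> \<le> \<bar>M\<bar>" if "y \<in> A" for y using M[OF that] by simp
  then show ?thesis unfolding bounded_lipschitz_def
    by (intro exI[of _ 0] exI[of _ "\<bar>M\<bar>"]) simp
qed

lemma bounded_lipschitz_lipschitz_on:
  assumes "L-lipschitz_on {a..b} f" "\<And>y. y \<in> A \<Longrightarrow> X y \<subseteq> {a..b}"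
  shows "bounded_lipschitz A X (\<lambda>y. f)"
proof -
  have "bounded (f ` {a..b})"
    by (intro compact_imp_bounded compact_continuous_image lipschitz_on_continuous_on[OF assms(1)]) auto
  then obtain M where "\<And>u. u \<in> {a..b} \<Longrightarrow> \<bar>f u\<bar> \<le> M" unfolding bounded_iff real_norm_def by blast
  then have M: "\<bar>f u\<bar> \<le> \<bar>M\<bar>" if "u \<in> {a..b}" for u using that by (meson abs_ge_self order_trans)
  have "\<bar>f u - f v\<bar> \<le> L * \<bar>u - v\<bar>" if "u \<in> {a..b}" "v \<in> {a..b}" for u v
    using lipschitz_onD[OF assms(1) that] by (simp add: dist_real_def)
  then show ?thesis
    using M assms(2) lipschitz_on_nonneg[OF assms(1)] unfolding bounded_lipschitz_def
    by (intro exI[of _ L] exI[of _ "\<bar>M\<bar>"]) (meson abs_ge_zero subsetD)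
qed

lemma C1_lipschitz_on:
  fixes f :: "real \<Rightarrow> real"
  assumes "\<And>x. x \<in> {a..b} \<Longrightarrow> (f has_real_derivative f' x) (at x)" "continuous_on {a..b} f'"
  obtains L where "L-lipschitz_on {a..b} f"
proof -
  have "bounded (f' ` {a..b})" by (intro compact_imp_bounded compact_continuous_image assms) auto
  then obtain M where "\<And>x. x \<in> {a..b} \<Longrightarrow> norm (f' x) \<le> M" unfolding bounded_iff by blast
  then have M: "norm (f' x) \<le> \<bar>M\<bar>" if "x \<in> {a..b}" for x using that by (meson abs_ge_self order_trans)
  have "\<bar>M\<bar>-lipschitz_on {a..b} f"
  proof (rule lipschitz_onI)
    fix x y assume "x \<in> {a..b}" "y \<in> {a..b}"
    then show "dist (f x) (f y) \<le> \<bar>M\<bar> * dist x y"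
      unfolding dist_norm
      by (intro field_differentiable_bound[of "{a..b}" f f'])
        (use M in \<open>auto intro!: has_field_derivative_at_within[OF assms(1)]\<close>)
  qed simp
  then show ?thesis using that by blast
qed

section \<open>The differential equation of a free boundary\<close>

text \<open>\<open>\<theta>\<close> and \<open>\<delta>\<close> are the slopes of
  \<open>\<rho>\<close> and \<open>\<gamma>\<close> as functions of the coordinate
  \<open>\<zeta>\<close>. Concavity of \<open>\<gamma>\<close> is expressed by monotonicity of
  \<open>\<delta>\<close> because \<open>G\<close> is only piecewise twice differentiable. For
  \<open>\<rho>\<close>, the strict sign of \<open>\<theta>'\<close> makes
  \<open>inverse_slope\<close> nonzero off the diagonal.\<close>

locale tangent_geometry =
  fixes I :: "real set" and x0 :: real
    and \<zeta> \<zeta>' \<rho> \<theta> \<theta>' \<gamma> \<delta> :: "real \<Rightarrow> real"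
  assumes open_I: "open I" and interval_I: "is_interval I" and x0_I: "x0 \<in> I"
    and \<zeta>_deriv: "x \<in> I \<Longrightarrow> (\<zeta> has_real_derivative \<zeta>' x) (at x)"
    and \<zeta>'_pos: "x \<in> I \<Longrightarrow> 0 < \<zeta>' x"
    and \<zeta>'_cont: "continuous_on I \<zeta>'"
    and \<rho>_deriv: "x \<in> I \<Longrightarrow> (\<rho> has_real_derivative \<theta> x * \<zeta>' x) (at x)"
    and \<theta>_deriv: "x \<in> I \<Longrightarrow> (\<theta> has_real_derivative \<theta>' x) (at x)"
    and \<theta>'_cont: "continuous_on I \<theta>'"
    and \<theta>'_neg: "x \<in> I \<Longrightarrow> x0 \<le> x \<Longrightarrow> \<theta>' x < 0"
    and \<gamma>_deriv: "x \<in> I \<Longrightarrow> (\<gamma> has_real_derivative \<delta> x * \<zeta>' x) (at x)"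
    and \<delta>_cont: "continuous_on I \<delta>"
    and \<delta>_antimono: "x \<in> I \<Longrightarrow> y \<in> I \<Longrightarrow> x \<le> y \<Longrightarrow> \<delta> y \<le> \<delta> x"
    and \<rho>_less_\<gamma>: "x \<in> I \<Longrightarrow> x0 \<le> x \<Longrightarrow> \<rho> x < \<gamma> x"
begin

text \<open>The tangent at \<open>y\<close> to the graph of \<open>\<rho>\<close> over the \<open>\<zeta>\<close>-axis.\<close>

definition tangent :: "real \<Rightarrow> real \<Rightarrow> real" where
  "tangent x y = \<rho> y + \<theta> y * (\<zeta> x - \<zeta> y)"

text \<open>The reciprocal of the factor \<open>K\<close> of the overview. It results from equating
  the derivative of \<open>(1 - F m) * tangent x (b m)\<close> in \<open>m\<close>, taken at
  \<open>x = m\<close>, with \<open>- f m * \<gamma> m\<close>. It is 0 on the diagonal, where the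
  slope of \<open>b\<close> would be infinite; the formula has a pole where the tangent at
  \<open>y\<close> meets \<open>\<gamma>\<close>.\<close>

definition inverse_slope :: "real \<Rightarrow> real \<Rightarrow> real" where
  "inverse_slope m y = - \<theta>' y * (\<zeta> m - \<zeta> y) / (\<gamma> m - tangent m y)"

text \<open>The ordinary differential equation to which the conditions on the diagonal reduce, for the
  hazard rate \<open>h\<close> of the threshold. The last clause says that \<open>b\<close> tends to the right endpoint.\<close>

definition free_boundary :: "(real \<Rightarrow> real) \<Rightarrow> real \<Rightarrow> (real \<Rightarrow> real) \<Rightarrow> bool" where
  "free_boundary h m0 b \<longleftrightarrow> m0 \<in> I \<and> x0 < m0 \<and> b m0 = x0 \<and>
     (\<forall>m\<in>I. m0 \<le> m \<longrightarrow> x0 \<le> b m \<and> b m < m \<and>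
        (b has_real_derivative h m / inverse_slope m (b m)) (at m within {m \<in> I. m0 \<le> m})) \<and>
     (\<forall>y\<in>I. \<exists>n\<in>I. \<forall>m\<in>I. n \<le> m \<longrightarrow> y \<le> b m)"

lemma at_within_I: "x \<in> I \<Longrightarrow> at x within I = at x"
  using open_I by (rule at_within_open[rotated])

lemma I_between: "a \<in> I \<Longrightarrow> b \<in> I \<Longrightarrow> a \<le> x \<Longrightarrow> x \<le> b \<Longrightarrow> x \<in> I"
  by (rule subsetD[OF interval_Icc_subset[OF interval_I]]) auto

lemma interval_above: "is_interval {m \<in> I. a \<le> m}"
proof -
  have "{m \<in> I. a \<le> m} = I \<inter> {a..}" by auto
  then show ?thesis using is_interval_Int[OF interval_I is_interval_ci] by simp
qed

lemma free_boundaryD: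
  assumes b: "free_boundary h m0 b" and m: "m \<in> I" "m0 \<le> m"
  shows "x0 \<le> b m" "b m < m" "b m \<in> I"
    "(b has_real_derivative h m / inverse_slope m (b m)) (at m within {m \<in> I. m0 \<le> m})"
proof -
  show *: "x0 \<le> b m" "b m < m"
    "(b has_real_derivative h m / inverse_slope m (b m)) (at m within {m \<in> I. m0 \<le> m})"
    using assms unfolding free_boundary_def by blast+
  show "b m \<in> I" using * by (intro I_between[OF x0_I m(1)]) auto
qed

lemma \<zeta>_less: "x \<in> I \<Longrightarrow> y \<in> I \<Longrightarrow> x < y \<Longrightarrow> \<zeta> x < \<zeta> y"
  by (rule interval_increasing[OF interval_I]) (auto simp: \<zeta>'_pos intro: has_field_derivative_at_within \<zeta>_deriv)

lemma \<zeta>_le: "x \<in> I \<Longrightarrow> y \<in> I \<Longrightarrow> x \<le> y \<Longrightarrow> \<zeta> x \<le> \<zeta> y"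
  using \<zeta>_less[of x y] by (cases "x = y") auto

lemma \<zeta>_cont: "continuous_on I \<zeta>"
  by (rule DERIV_continuous_on) (rule has_field_derivative_at_within[OF \<zeta>_deriv])

lemma \<rho>_cont: "continuous_on I \<rho>"
  by (rule DERIV_continuous_on) (rule has_field_derivative_at_within[OF \<rho>_deriv])

lemma \<theta>_cont: "continuous_on I \<theta>"
  by (rule DERIV_continuous_on) (rule has_field_derivative_at_within[OF \<theta>_deriv])

lemma \<gamma>_cont: "continuous_on I \<gamma>"
  by (rule DERIV_continuous_on) (rule has_field_derivative_at_within[OF \<gamma>_deriv])

lemma \<gamma>_concave_right:
  assumes "x \<in> I" "y \<in> I" "x \<le> y"
  shows "\<delta> y * (\<zeta> y - \<zeta> x) \<le> \<gamma> y - \<gamma> x"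
proof -
  have "\<gamma> x - \<delta> y * \<zeta> x \<le> \<gamma> y - \<delta> y * \<zeta> y"
  proof (rule interval_increasing_weak[OF interval_I assms, of "\<lambda>t. \<gamma> t - \<delta> y * \<zeta> t" "\<lambda>t. (\<delta> t - \<delta> y) * \<zeta>' t"])
    show "((\<lambda>t. \<gamma> t - \<delta> y * \<zeta> t) has_real_derivative (\<delta> t - \<delta> y) * \<zeta>' t) (at t within I)" if "t \<in> I" for t
      using that by (auto intro!: derivative_eq_intros has_field_derivative_at_within[OF \<gamma>_deriv]
          has_field_derivative_at_within[OF \<zeta>_deriv] simp: algebra_simps)
    show "0 \<le> (\<delta> t - \<delta> y) * \<zeta>' t" if "t \<in> I" "x < t" "t < y" for t
      using \<delta>_antimono[of t y] \<zeta>'_pos[of t] that assms by (intro mult_nonneg_nonneg) auto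
  qed
  then show ?thesis by (simp add: algebra_simps)
qed

lemma \<gamma>_concave_left:
  assumes "x \<in> I" "y \<in> I" "x \<le> y"
  shows "\<gamma> y - \<gamma> x \<le> \<delta> x * (\<zeta> y - \<zeta> x)"
proof -
  have "\<gamma> y - \<delta> x * \<zeta> y \<le> \<gamma> x - \<delta> x * \<zeta> x"
  proof (rule interval_decreasing_weak[OF interval_I assms, of "\<lambda>t. \<gamma> t - \<delta> x * \<zeta> t" "\<lambda>t. (\<delta> t - \<delta> x) * \<zeta>' t"])
    show "((\<lambda>t. \<gamma> t - \<delta> x * \<zeta> t) has_real_derivative (\<delta> t - \<delta> x) * \<zeta>' t) (at t within I)" if "t \<in> I" for t
      using that by (auto intro!: derivative_eq_intros has_field_derivative_at_within[OF \<gamma>_deriv]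
          has_field_derivative_at_within[OF \<zeta>_deriv] simp: algebra_simps)
    show "(\<delta> t - \<delta> x) * \<zeta>' t \<le> 0" if "t \<in> I" "x < t" "t < y" for t
      using \<delta>_antimono[of x t] \<zeta>'_pos[of t] that assms by (intro mult_nonpos_nonneg) auto
  qed
  then show ?thesis by (simp add: algebra_simps)
qed

text \<open>In the coordinate \<open>\<zeta>\<close> the tangent is affine and
  \<open>\<gamma>\<close> is concave. Their gap is positive at \<open>y\<close>, where the tangent
  equals \<open>\<rho> y\<close>, and at \<open>N\<close>, hence also between. So
  \<open>inverse_slope\<close> has no pole between the diagonal and the inverse of a
  boundary.\<close>

lemma tangent_below_between:
  assumes "y \<in> I" "x0 \<le> y" "N \<in> I" "y \<le> n" "n \<le> N" and N: "tangent N y < \<gamma> N"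
  shows "tangent n y < \<gamma> n"
proof (rule ccontr)
  assume neg: "\<not> tangent n y < \<gamma> n"
  have n: "n \<in> I" using I_between assms by blast
  have "(\<theta> y) * (\<zeta> N - \<zeta> n) = tangent N y - tangent n y" by (simp add: tangent_def algebra_simps)
  also have "\<dots> < \<gamma> N - \<gamma> n" using N neg by simp
  also have "\<dots> \<le> \<delta> n * (\<zeta> N - \<zeta> n)" using \<gamma>_concave_left[of n N] n assms by simp
  finally have "0 < (\<delta> n - \<theta> y) * (\<zeta> N - \<zeta> n)" by (simp add: algebra_simps)
  moreover have "0 \<le> \<zeta> N - \<zeta> n" using \<zeta>_le[of n N] n assms by simp
  ultimately have "\<theta> y < \<delta> n" by (simp add: zero_less_mult_iff)
  then have "\<theta> y * (\<zeta> n - \<zeta> y) \<le> \<delta> n * (\<zeta> n - \<zeta> y)"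
    using \<zeta>_le[of y n] n assms by (intro mult_right_mono) auto
  also have "\<dots> \<le> \<gamma> n - \<gamma> y" using \<gamma>_concave_right[of y n] n assms by simp
  finally have "tangent n y \<le> \<gamma> n - (\<gamma> y - \<rho> y)" by (simp add: tangent_def)
  then show False using neg \<rho>_less_\<gamma>[of y] assms by simp
qed

lemma tangent_deriv_right:
  assumes "x \<in> I" shows "((\<lambda>x. tangent x y) has_real_derivative \<theta> y * \<zeta>' x) (at x)"
  unfolding tangent_def using \<zeta>_deriv[OF assms] by (auto intro!: derivative_eq_intros)

text \<open>The shift of the contact point cancels, since \<open>\<theta>\<close> is the slope of
  \<open>\<rho>\<close>; only the rotation of the line is left.\<close>

lemma tangent_deriv_left:
  assumes "y \<in> I" shows "((\<lambda>y. tangent x y) has_real_derivative \<theta>' y * (\<zeta> x - \<zeta> y)) (at y)"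
  unfolding tangent_def
  by (auto intro!: derivative_eq_intros \<zeta>_deriv \<theta>_deriv \<rho>_deriv assms simp: algebra_simps)

lemma inverse_slope_pos:
  assumes "y \<in> I" "x0 \<le> y" "y < m" "m \<in> I" "tangent m y < \<gamma> m"
  shows "0 < inverse_slope m y"
  unfolding inverse_slope_def
  using assms \<theta>'_neg[of y] \<zeta>_less[of y m] by (intro divide_pos_pos mult_pos_pos) auto

text \<open>If the tangent at \<open>b m\<close> reached \<open>\<gamma> m\<close>, then it would, by concavity of \<open>\<gamma>\<close>, stay above \<open>\<gamma>\<close>
  from then on, and \<open>b\<close> would decrease for ever.\<close>

lemma free_boundary_tangent_below:
  assumes b: "free_boundary h m0 b" and h: "\<And>m. m \<in> I \<Longrightarrow> 0 < h m" and m: "m \<in> I" "m0 \<le> m"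
  shows "tangent m (b m) < \<gamma> m"
proof (rule ccontr)
  assume neg: "\<not> tangent m (b m) < \<gamma> m"
  let ?A = "{m \<in> I. m0 \<le> m}"
  have m0: "m0 \<in> I" "x0 < m0" using b unfolding free_boundary_def by blast+
  have bm: "x0 \<le> b n" "b n < n" "b n \<in> I"
    "(b has_real_derivative h n / inverse_slope n (b n)) (at n within ?A)" if "n \<in> ?A" for n
    using free_boundaryD[OF b] that by auto
  define H where "H n = tangent n (b n) - \<gamma> n" for n
  \<comment> \<open>The motion of the contact point changes \<open>H\<close> at the rate
    \<open>h n * H n\<close>. At a zero of \<open>H\<close> both sides are 0:
    \<open>inverse_slope\<close> divides by zero there, and so does the quotient by it.\<close>
  have slope: "\<theta>' (b n) * (\<zeta> n - \<zeta> (b n)) * (h n / inverse_slope n (b n)) = h n * H n" if "n \<in> ?A" for n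
    using \<theta>'_neg[of "b n"] \<zeta>_less[of "b n" n] bm[OF that] that
    by (auto simp: inverse_slope_def H_def field_simps)
  have Hd: "(H has_real_derivative (\<theta> (b n) - \<delta> n) * \<zeta>' n + h n * H n) (at n within ?A)" if n: "n \<in> ?A" for n
  proof -
    let ?b' = "h n / inverse_slope n (b n)"
    have "(H has_real_derivative
      (\<theta> (b n) * \<zeta>' (b n)) * ?b'
      + ((\<theta>' (b n) * ?b') * (\<zeta> n - \<zeta> (b n))
      + (\<zeta>' n - \<zeta>' (b n) * ?b') * \<theta> (b n)) - \<delta> n * \<zeta>' n) (at n within ?A)"
      unfolding H_def tangent_def
      using n by (intro DERIV_diff DERIV_add DERIV_mult
          DERIV_chain2[OF \<rho>_deriv[OF bm(3)[OF n]] bm(4)[OF n]]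
          DERIV_chain2[OF \<theta>_deriv[OF bm(3)[OF n]] bm(4)[OF n]]
          DERIV_chain2[OF \<zeta>_deriv[OF bm(3)[OF n]] bm(4)[OF n]]
          has_field_derivative_at_within[OF \<gamma>_deriv] has_field_derivative_at_within[OF \<zeta>_deriv]) auto
    moreover have "(\<theta> (b n) * \<zeta>' (b n)) * ?b'
      + ((\<theta>' (b n) * ?b') * (\<zeta> n - \<zeta> (b n))
      + (\<zeta>' n - \<zeta>' (b n) * ?b') * \<theta> (b n)) - \<delta> n * \<zeta>' n
      = (\<theta> (b n) - \<delta> n) * \<zeta>' n + \<theta>' (b n) * (\<zeta> n - \<zeta> (b n)) * ?b'"
      by (simp only: algebra_simps)
    ultimately show ?thesis using slope[OF n] by simp
  qed
  have above: "0 \<le> H n" if n: "n \<in> I" "m \<le> n" for n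
  proof (rule nonneg_if_increasing_at_zeros[OF n(2)])
    have sub: "{m..n} \<subseteq> ?A" using I_between[OF m(1) n(1)] m by auto
    show "continuous_on {m..n} H"
      by (rule continuous_on_subset[OF DERIV_continuous_on[OF Hd] sub])
    show "0 \<le> H m" using neg by (simp add: H_def)
    fix t assume t: "m \<le> t" "t < n" "H t = 0"
    then have tA: "t \<in> ?A" by (intro subsetD[OF sub]) auto
    have bt: "b t < t" "b t \<in> I" "x0 \<le> b t" using bm[OF tA] by auto
    \<comment> \<open>At a zero of \<open>H\<close> the tangent leads from
      \<open>\<rho> (b t)\<close>, which is below \<open>\<gamma> (b t)\<close>, up to
      \<open>\<gamma> t\<close>. It is therefore steeper than the concave \<open>\<gamma>\<close> is
      at \<open>t\<close>, and \<open>H\<close> increases.\<close>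
    have "\<delta> t * (\<zeta> t - \<zeta> (b t)) \<le> \<gamma> t - \<gamma> (b t)"
      using \<gamma>_concave_right[of "b t" t] bt tA by simp
    also have "\<dots> < \<gamma> t - \<rho> (b t)" using \<rho>_less_\<gamma>[of "b t"] bt by simp
    also have "\<dots> = \<theta> (b t) * (\<zeta> t - \<zeta> (b t))" using t(3) by (simp add: H_def tangent_def)
    finally have "\<delta> t < \<theta> (b t)" using \<zeta>_less[of "b t" t] bt tA by (simp add: mult_less_cancel_right)
    then have "0 < (\<theta> (b t) - \<delta> t) * \<zeta>' t + h t * H t"
      using \<zeta>'_pos[of t] tA t(3) by simp
    then show "\<exists>D>0. (H has_real_derivative D) (at t within {m..n})"
      using DERIV_subset[OF Hd[OF tA] sub] by blast
  qed
  have desc: "b n \<le> b m" if n: "n \<in> I" "m \<le> n" for n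
  proof (rule interval_decreasing_weak[OF interval_above[of m0] _ _ n(2) bm(4)])
    show "m \<in> ?A" "n \<in> ?A" using m n by auto
    fix t assume t: "t \<in> ?A" "m < t" "t < n"
    have "0 \<le> - \<theta>' (b t) * (\<zeta> t - \<zeta> (b t))"
      using \<theta>'_neg[of "b t"] \<zeta>_le[of "b t" t] bm[OF t(1)] t(1) by (intro mult_nonneg_nonneg) auto
    moreover have "\<gamma> t - tangent t (b t) \<le> 0" using above[of t] t by (simp add: H_def)
    ultimately have "inverse_slope t (b t) \<le> 0" unfolding inverse_slope_def by (rule divide_nonneg_nonpos)
    then show "h t / inverse_slope t (b t) \<le> 0"
      using h[of t] t(1) by (intro divide_nonneg_nonpos) auto
  qed auto
  obtain n where n: "n \<in> I" "\<And>k. k \<in> I \<Longrightarrow> n \<le> k \<Longrightarrow> m \<le> b k"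
    using b m unfolding free_boundary_def by blast
  have "max n m \<in> I" using n m by (auto simp: max_def)
  then have "m \<le> b m" using n(2)[of "max n m"] desc[of "max n m"] by auto
  then show False using bm(2)[of m] m by auto
qed

text \<open>The equation for the inverse has \<open>inverse_slope\<close> in the numerator. The
  inverse is defined on all of \<open>{y \<in> I. x0 \<le> y}\<close> because \<open>b\<close>
  increases strictly from \<open>x0\<close> and tends to the right endpoint.\<close>

lemma free_boundary_inverse:
  assumes b: "free_boundary h m0 b" and h: "\<And>m. m \<in> I \<Longrightarrow> 0 < h m"
  obtains N where "\<And>y. y \<in> I \<Longrightarrow> x0 \<le> y \<Longrightarrow> N y \<in> I \<and> m0 \<le> N y \<and> y < N y \<and> b (N y) = y \<and> tangent (N y) y < \<gamma> (N y)"
    "\<And>m. m \<in> I \<Longrightarrow> m0 \<le> m \<Longrightarrow> N (b m) = m"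
    "\<And>y. y \<in> I \<Longrightarrow> x0 \<le> y \<Longrightarrow> (N has_real_derivative inverse_slope (N y) y / h (N y)) (at y within {y \<in> I. x0 \<le> y})"
    "\<And>y z. y \<in> I \<Longrightarrow> x0 \<le> y \<Longrightarrow> z \<in> I \<Longrightarrow> y < z \<Longrightarrow> N y < N z"
proof -
  let ?A = "{m \<in> I. m0 \<le> m}" and ?B = "{y \<in> I. x0 \<le> y}"
  have m0: "m0 \<in> I" "x0 < m0" "b m0 = x0" using b unfolding free_boundary_def by blast+
  have bm: "x0 \<le> b n" "b n < n" "b n \<in> I" "tangent n (b n) < \<gamma> n"
    "(b has_real_derivative h n / inverse_slope n (b n)) (at n within ?A)" if "n \<in> ?A" for n
    using free_boundaryD[OF b] free_boundary_tangent_below[OF b h] that by auto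
  have bcont: "continuous_on ?A b" by (rule DERIV_continuous_on[OF bm(5)])
  have img: "b ` ?A = ?B"
  proof (intro equalityI subsetI)
    fix y assume y: "y \<in> ?B"
    then obtain n where n: "n \<in> I" "\<And>k. k \<in> I \<Longrightarrow> n \<le> k \<Longrightarrow> y \<le> b k"
      using b unfolding free_boundary_def by blast
    define m where "m = max n m0"
    have m: "m \<in> I" "m0 \<le> m" "y \<le> b m" using n(1) n(2)[of m] m0 by (auto simp: m_def max_def)
    have sub: "{m0..m} \<subseteq> ?A" using I_between[OF m0(1) m(1)] by auto
    then obtain k where "m0 \<le> k" "k \<le> m" "b k = y"
      using IVT'[of b m0 y m] m y m0 continuous_on_subset[OF bcont sub] by auto
    then show "y \<in> b ` ?A" using sub by force
  qed (use bm in auto)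
  have pos: "0 < h n / inverse_slope n (b n)" if "n \<in> ?A" for n
    using bm[OF that] h that by (intro divide_pos_pos inverse_slope_pos) auto
  obtain N where N: "\<And>y. y \<in> ?B \<Longrightarrow> N y \<in> ?A" "\<And>y. y \<in> ?B \<Longrightarrow> b (N y) = y"
    "\<And>x. x \<in> ?A \<Longrightarrow> N (b x) = x"
    "\<And>y. y \<in> ?B \<Longrightarrow> (N has_real_derivative 1 / (h (N y) / inverse_slope (N y) (b (N y)))) (at y within ?B)"
    "\<And>y z. y \<in> ?B \<Longrightarrow> z \<in> ?B \<Longrightarrow> y < z \<Longrightarrow> N y < N z"
    using inverse_of_increasing[OF interval_above img bm(5) pos] by blast
  show ?thesis
  proof (rule that[of N])
    fix y assume y: "y \<in> I" "x0 \<le> y"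
    show "N y \<in> I \<and> m0 \<le> N y \<and> y < N y \<and> b (N y) = y \<and> tangent (N y) y < \<gamma> (N y)"
      using N(1,2)[of y] bm[of "N y"] y by auto
    show "(N has_real_derivative inverse_slope (N y) y / h (N y)) (at y within ?B)"
      using N(2,4)[of y] y by simp
  qed (use N in auto)
qed

end

section \<open>The clamped equation for the inverse of a boundary\<close>

context tangent_geometry
begin

lemma continuous_on_tangent:
  assumes "continuous_on S f" "continuous_on S g" "f ` S \<subseteq> I" "g ` S \<subseteq> I"
  shows "continuous_on S (\<lambda>p. tangent (f p) (g p))"
  unfolding tangent_def
  by (intro continuous_intros continuous_on_compose2[OF \<zeta>_cont] continuous_on_compose2[OF \<rho>_cont]
      continuous_on_compose2[OF \<theta>_cont] assms)

lemma continuous_on_inverse_slope: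
  assumes "continuous_on S f" "continuous_on S g" "f ` S \<subseteq> I" "g ` S \<subseteq> I"
    and "\<And>p. p \<in> S \<Longrightarrow> tangent (f p) (g p) < \<gamma> (f p)"
  shows "continuous_on S (\<lambda>p. inverse_slope (f p) (g p))"
  unfolding inverse_slope_def
proof (intro continuous_intros continuous_on_compose2[OF \<zeta>_cont] continuous_on_compose2[OF \<theta>'_cont]
      continuous_on_compose2[OF \<gamma>_cont] continuous_on_tangent assms)
  show "\<forall>p\<in>S. \<gamma> (f p) - tangent (f p) (g p) \<noteq> 0" using assms(5) by fastforce
qed

text \<open>The field of the inverse equation, with the state \<open>u\<close> projected onto
  \<open>[y, N y]\<close>. It makes sense for every real state, as the global existence theorem
  demands. \<open>N\<close> will be the inverse of the boundary that serves as a barrier.\<close>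

definition clamp_slope :: "(real \<Rightarrow> real) \<Rightarrow> (real \<Rightarrow> real) \<Rightarrow> real \<Rightarrow> real \<Rightarrow> real" where
  "clamp_slope h N y u = inverse_slope (max y (min u (N y))) y / h (max y (min u (N y)))"

text \<open>For \<open>y\<close> in a compact interval the clamped states fill a compact region on
  which \<open>h\<close> and the gap between \<open>\<gamma>\<close> and the tangent are bounded
  away from 0. All factors of the field are then bounded and Lipschitz in the state.\<close>

lemma clamp_slope_lipschitz:
  assumes N: "\<And>y. y \<in> I \<Longrightarrow> x0 \<le> y \<Longrightarrow> N y \<in> I \<and> y < N y \<and> tangent (N y) y < \<gamma> (N y)"
    and N_cont: "continuous_on {y \<in> I. x0 \<le> y} N"
    and N_mono: "\<And>y z. y \<in> I \<Longrightarrow> x0 \<le> y \<Longrightarrow> z \<in> I \<Longrightarrow> y < z \<Longrightarrow> N y < N z"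
    and h: "\<And>m. m \<in> I \<Longrightarrow> 0 < h m" and h_cont: "continuous_on I h"
    and h_lip: "\<And>a b. a \<in> I \<Longrightarrow> b \<in> I \<Longrightarrow> \<exists>L. L-lipschitz_on {a..b} h"
    and ab: "a \<in> I" "x0 \<le> a" "b \<in> I"
  shows "\<exists>L. \<forall>y\<in>{a..b}. L-lipschitz_on UNIV (clamp_slope h N y)"
proof (cases "a \<le> b")
  case True
  let ?X = "\<lambda>y. {y..N y}"
  have Nb: "N b \<in> I" "a \<le> N b" using N[of b] ab True by auto
  have sub: "{a..N b} \<subseteq> I" "{a..b} \<subseteq> I" "{a..b} \<subseteq> {y \<in> I. x0 \<le> y}"
    using interval_Icc_subset[OF interval_I ab(1) Nb(1)] interval_Icc_subset[OF interval_I ab(1,3)] ab(2) by auto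
  have Nle: "N y \<le> N b" if "y \<in> {a..b}" for y
  proof (cases "y = b")
    case False
    then show ?thesis using N_mono[of y b] that sub(2) ab by force
  qed simp
  have X: "?X y \<subseteq> {a..N b}" if "y \<in> {a..b}" for y
    using Nle[OF that] that by auto
  have Xb: "tangent u y < \<gamma> u" if "y \<in> {a..b}" "u \<in> ?X y" for y u
    using tangent_below_between[of y "N y" u] N[of y] that sub(2) ab by auto
  have bl_fun: "bounded_lipschitz {a..b} ?X (\<lambda>y. f)"
    if fd: "\<And>x. x \<in> I \<Longrightarrow> (f has_real_derivative f' x) (at x)" and fc: "continuous_on I f'" for f f'
  proof -
    have 1: "(f has_real_derivative f' x) (at x)" if "x \<in> {a..N b}" for x
      using that sub(1) by (intro fd) auto
    obtain L where "L-lipschitz_on {a..N b} f"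
      using C1_lipschitz_on[OF 1 continuous_on_subset[OF fc sub(1)]] by blast
    then show ?thesis by (rule bounded_lipschitz_lipschitz_on) (use X in blast)
  qed
  have bl_par: "bounded_lipschitz {a..b} ?X (\<lambda>y u. f y)" if "continuous_on I f" for f
    by (intro bounded_lipschitz_const compact_imp_bounded compact_continuous_image
        continuous_on_subset[OF that sub(2)]) auto
  have bl_tan: "bounded_lipschitz {a..b} ?X (\<lambda>y u. \<gamma> u - tangent u y)"
  proof -
    have "bounded_lipschitz {a..b} ?X (\<lambda>y u. (\<gamma> u - \<rho> y) - \<theta> y * (\<zeta> u - \<zeta> y))"
      by (intro bounded_lipschitz_diff bounded_lipschitz_mult bl_par \<rho>_cont \<theta>_cont \<zeta>_cont
          bl_fun[OF \<gamma>_deriv] bl_fun[OF \<zeta>_deriv] \<zeta>'_cont continuous_on_mult \<delta>_cont)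
    moreover have "(\<lambda>y u. (\<gamma> u - \<rho> y) - \<theta> y * (\<zeta> u - \<zeta> y)) = (\<lambda>y u. \<gamma> u - tangent u y)"
      by (simp add: tangent_def fun_eq_iff)
    ultimately show ?thesis by simp
  qed
  obtain d where d: "0 < d" "\<And>y u. y \<in> {a..b} \<Longrightarrow> u \<in> ?X y \<Longrightarrow> d \<le> \<gamma> u - tangent u y"
  proof -
    \<comment> \<open>Maps a rectangle onto the region \<open>y \<le> u \<le> N y\<close>, so that
      the gap, being continuous, attains its minimum there.\<close>
    let ?w = "\<lambda>p::real \<times> real. fst p + snd p * (N (fst p) - fst p)"
    let ?K = "{a..b} \<times> {0..1::real}"
    have w: "?w p \<in> ?X (fst p)" if "p \<in> ?K" for p
    proof -
      have "0 \<le> N (fst p) - fst p" using N[of "fst p"] that sub(3) by auto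
      then have "0 \<le> snd p * (N (fst p) - fst p)" "snd p * (N (fst p) - fst p) \<le> N (fst p) - fst p"
        using that by (auto intro!: mult_left_le_one_le mult_nonneg_nonneg)
      then show ?thesis by simp
    qed
    have "continuous_on ?K ?w"
      by (intro continuous_intros continuous_on_compose2[OF N_cont]) (use sub(3) in auto)
    moreover have "?w ` ?K \<subseteq> I"
    proof (rule image_subsetI)
      fix p :: "real \<times> real" assume p: "p \<in> ?K"
      then have "fst p \<in> {a..b}" by auto
      then show "?w p \<in> I" using w[OF p] X sub(1) by blast
    qed
    moreover have "fst ` ?K \<subseteq> I" using sub(2) by auto
    ultimately have "continuous_on ?K (\<lambda>p. \<gamma> (?w p) - tangent (?w p) (fst p))"
      by (intro continuous_on_diff continuous_on_compose2[OF \<gamma>_cont] continuous_on_tangent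
          continuous_on_fst continuous_on_id)
    then obtain p where p: "p \<in> ?K"
      "\<And>q. q \<in> ?K \<Longrightarrow> \<gamma> (?w p) - tangent (?w p) (fst p) \<le> \<gamma> (?w q) - tangent (?w q) (fst q)"
      using continuous_attains_inf[of ?K "\<lambda>p. \<gamma> (?w p) - tangent (?w p) (fst p)"] True
      by (auto simp: compact_Times)
    show ?thesis
    proof (rule that[of "\<gamma> (?w p) - tangent (?w p) (fst p)"])
      show "0 < \<gamma> (?w p) - tangent (?w p) (fst p)"
        using Xb[of "fst p" "?w p"] w[OF p(1)] p(1) by (simp add: mem_Times_iff)
      fix y u assume yu: "y \<in> {a..b}" "u \<in> ?X y"
      define t where "t = (u - y) / (N y - y)"
      have lt: "y < N y" using N[of y] yu(1) sub(3) by auto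
      then have "(y, t) \<in> ?K" "?w (y, t) = u" using yu by (auto simp: t_def)
      then show "\<gamma> (?w p) - tangent (?w p) (fst p) \<le> \<gamma> u - tangent u y"
        using p(2)[of "(y, t)"] by simp
    qed
  qed
  obtain e where e: "0 < e" "\<And>u. u \<in> {a..N b} \<Longrightarrow> e \<le> h u"
  proof -
    obtain u where "u \<in> {a..N b}" "\<And>v. v \<in> {a..N b} \<Longrightarrow> h u \<le> h v"
      using continuous_attains_inf[of "{a..N b}" h] continuous_on_subset[OF h_cont sub(1)] Nb by auto
    then show ?thesis using that[of "h u"] h sub(1) by blast
  qed
  obtain Lh where "Lh-lipschitz_on {a..N b} h" using h_lip ab(1) Nb(1) by blast
  then have bl_h: "bounded_lipschitz {a..b} ?X (\<lambda>y. h)"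
    by (rule bounded_lipschitz_lipschitz_on) (use X in blast)
  have "bounded_lipschitz {a..b} ?X
    (\<lambda>y u. (- \<theta>' y * (\<zeta> u - \<zeta> y)) * inverse (\<gamma> u - tangent u y) * inverse (h u))"
    by (intro bounded_lipschitz_mult bounded_lipschitz_diff bl_par bl_fun[OF \<zeta>_deriv] \<zeta>_cont \<zeta>'_cont
        continuous_on_minus \<theta>'_cont bounded_lipschitz_inverse[OF bl_tan d]
        bounded_lipschitz_inverse[OF bl_h e(1)] e(2)) (use X in blast)+
  then obtain L where L: "0 \<le> L" "\<And>y u v. y \<in> {a..b} \<Longrightarrow> u \<in> ?X y \<Longrightarrow> v \<in> ?X y \<Longrightarrow>
      \<bar>inverse_slope u y / h u - inverse_slope v y / h v\<bar> \<le> L * \<bar>u - v\<bar>"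
    unfolding bounded_lipschitz_def inverse_slope_def divide_inverse by blast
  have "L-lipschitz_on UNIV (clamp_slope h N y)" if y: "y \<in> {a..b}" for y
  proof (rule lipschitz_onI[OF _ L(1)])
    fix u v :: real
    let ?c = "\<lambda>u. max y (min u (N y))"
    have "y < N y" using N[of y] y sub(3) by auto
    \<comment> \<open>Clamping does not increase distances, so the Lipschitz constant carries over
      to all real states.\<close>
    then have c: "?c u \<in> ?X y" "?c v \<in> ?X y" "\<bar>?c u - ?c v\<bar> \<le> \<bar>u - v\<bar>" by (auto simp: max_def min_def)
    have "dist (clamp_slope h N y u) (clamp_slope h N y v) \<le> L * \<bar>?c u - ?c v\<bar>"
      unfolding clamp_slope_def dist_real_def using L(2)[OF y c(1,2)] .
    also have "\<dots> \<le> L * \<bar>u - v\<bar>" using c(3) L(1) by (rule mult_left_mono)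
    finally show "dist (clamp_slope h N y u) (clamp_slope h N y v) \<le> L * dist u v" by (simp add: dist_real_def)
  qed
  then show ?thesis by blast
qed simp

lemma clamp_slope_continuous:
  assumes N: "\<And>y. y \<in> I \<Longrightarrow> x0 \<le> y \<Longrightarrow> N y \<in> I \<and> y < N y \<and> tangent (N y) y < \<gamma> (N y)"
    and N_cont: "continuous_on {y \<in> I. x0 \<le> y} N"
    and h: "\<And>m. m \<in> I \<Longrightarrow> 0 < h m" and h_cont: "continuous_on I h"
  shows "continuous_on ({y \<in> I. x0 \<le> y} \<times> UNIV) (\<lambda>(y, u). clamp_slope h N y u)"
proof -
  let ?S = "{y \<in> I. x0 \<le> y} \<times> (UNIV :: real set)"
  let ?c = "\<lambda>p::real \<times> real. max (fst p) (min (snd p) (N (fst p)))"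
  have c: "?c p \<in> I \<and> fst p \<le> ?c p \<and> ?c p \<le> N (fst p)" if "p \<in> ?S" for p
  proof -
    have p: "fst p \<in> I" "x0 \<le> fst p" using that by auto
    then have *: "fst p \<le> ?c p" "?c p \<le> N (fst p)" using N[of "fst p"] by auto
    then show ?thesis using I_between[of "fst p" "N (fst p)" "?c p"] N[OF p] p by blast
  qed
  have cc: "continuous_on ?S ?c"
    by (intro continuous_on_max continuous_on_min continuous_intros continuous_on_compose2[OF N_cont]) auto
  have cI: "?c ` ?S \<subseteq> I" using c by blast
  have "continuous_on ?S (\<lambda>p. inverse_slope (?c p) (fst p) / h (?c p))"
  proof (intro continuous_on_divide continuous_on_inverse_slope continuous_on_compose2[OF h_cont] cc cI
      continuous_on_fst continuous_on_id)
    show "fst ` ?S \<subseteq> I" by auto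
    show "tangent (?c p) (fst p) < \<gamma> (?c p)" if "p \<in> ?S" for p
      using tangent_below_between[of "fst p" "N (fst p)" "?c p"] c[OF that] N[of "fst p"] that by auto
    show "\<forall>p\<in>?S. h (?c p) \<noteq> 0" using c h by (metis less_irrefl)
  qed
  then show ?thesis by (simp add: clamp_slope_def split_beta)
qed

end

section \<open>Comparison of two boundaries\<close>

context tangent_geometry
begin

text \<open>If \<open>b1\<close> exceeds \<open>b2\<close> at \<open>k\<close>, the solution of the second equation through \<open>(k, b1 k)\<close> is
  squeezed between \<open>b2\<close> and \<open>b1\<close> to the right of \<open>k\<close>, and stays above \<open>b2\<close> to the left of it. Its
  inverse is constructed, which meets no singularity.\<close>

lemma free_boundary_through:
  assumes fb1: "free_boundary h1 m1 b1" and fb2: "free_boundary h2 m2 b2"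
    and h2: "\<And>m. m \<in> I \<Longrightarrow> 0 < h2 m" and h12: "\<And>m. m \<in> I \<Longrightarrow> h2 m < h1 m"
    and h2_cont: "continuous_on I h2"
    and h2_lip: "\<And>a b. a \<in> I \<Longrightarrow> b \<in> I \<Longrightarrow> \<exists>L. L-lipschitz_on {a..b} h2"
    and k: "k \<in> I" "m1 \<le> k" "m2 \<le> k" "b2 k < b1 k"
  obtains n0 c where "free_boundary h2 n0 c" "n0 < m2"
proof -
  let ?Y = "{y \<in> I. x0 \<le> y}"
  have h1: "0 < h1 m" if "m \<in> I" for m using h2[OF that] h12[OF that] by simp
  obtain N1 where N1: "\<And>y. y \<in> I \<Longrightarrow> x0 \<le> y \<Longrightarrow> N1 y \<in> I \<and> m1 \<le> N1 y \<and> y < N1 y \<and> b1 (N1 y) = y \<and> tangent (N1 y) y < \<gamma> (N1 y)"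
    "\<And>m. m \<in> I \<Longrightarrow> m1 \<le> m \<Longrightarrow> N1 (b1 m) = m"
    "\<And>y. y \<in> I \<Longrightarrow> x0 \<le> y \<Longrightarrow> (N1 has_real_derivative inverse_slope (N1 y) y / h1 (N1 y)) (at y within ?Y)"
    by (rule free_boundary_inverse[OF fb1 h1]) (assumption | blast)+
  obtain N where N: "\<And>y. y \<in> I \<Longrightarrow> x0 \<le> y \<Longrightarrow> N y \<in> I \<and> m2 \<le> N y \<and> y < N y \<and> b2 (N y) = y \<and> tangent (N y) y < \<gamma> (N y)"
    "\<And>m. m \<in> I \<Longrightarrow> m2 \<le> m \<Longrightarrow> N (b2 m) = m"
    "\<And>y. y \<in> I \<Longrightarrow> x0 \<le> y \<Longrightarrow> (N has_real_derivative inverse_slope (N y) y / h2 (N y)) (at y within ?Y)"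
    "\<And>y z. y \<in> I \<Longrightarrow> x0 \<le> y \<Longrightarrow> z \<in> I \<Longrightarrow> y < z \<Longrightarrow> N y < N z"
    by (rule free_boundary_inverse[OF fb2 h2]) (assumption | blast)+
  define y0 where "y0 = b1 k"
  have y0: "y0 \<in> I" "x0 \<le> y0" "y0 < k" using free_boundaryD[OF fb1 k(1,2)] by (auto simp: y0_def)
  have b2k: "b2 k \<in> I" "x0 \<le> b2 k" using free_boundaryD[OF fb2 k(1,3)] by auto
  have N1y0: "N1 y0 = k" using N1(2)[OF k(1,2)] by (simp add: y0_def)
  \<comment> \<open>For the increasing inverse \<open>N\<close> of \<open>b2\<close>, the inequality
    \<open>b2 k < y0\<close> reads \<open>k < N y0\<close>: the new trajectory starts below
    \<open>N\<close>.\<close>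
  have Ny0: "k < N y0" using N(4)[OF b2k y0(1)] N(2)[OF k(1,3)] k(4) by (simp add: y0_def)
  have N': "\<And>y. y \<in> I \<Longrightarrow> x0 \<le> y \<Longrightarrow> N y \<in> I \<and> y < N y \<and> tangent (N y) y < \<gamma> (N y)" using N(1) by blast
  have Nd: "(N has_real_derivative inverse_slope (N y) y / h2 (N y)) (at y within ?Y)" if "y \<in> ?Y" for y
    using N(3) that by blast
  have N_cont: "continuous_on ?Y N" by (rule DERIV_continuous_on[OF Nd])
  have lip: "\<exists>L. \<forall>y\<in>{a..b}. L-lipschitz_on UNIV (clamp_slope h2 N y)" if "a \<in> ?Y" "b \<in> ?Y" for a b
    using that by (intro clamp_slope_lipschitz[OF N' N_cont N(4) h2 h2_cont h2_lip]) auto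
  have cont: "continuous_on (?Y \<times> UNIV) (\<lambda>(y, u). clamp_slope h2 N y u)"
    by (rule clamp_slope_continuous[OF N' N_cont h2 h2_cont])
  have y0Y: "y0 \<in> ?Y" using y0 by simp
  \<comment> \<open>The trajectory of the clamped second equation with value \<open>k\<close> at
    \<open>b1 k\<close>. The clamp will turn out to be inactive along it.\<close>
  obtain \<nu> where \<nu>y0: "\<nu> y0 = k"
    and \<nu>v: "\<And>y. y \<in> ?Y \<Longrightarrow> (\<nu> has_vector_derivative clamp_slope h2 N y (\<nu> y)) (at y within ?Y)"
    by (rule ode_exists[OF interval_above y0Y lip cont, of k]) blast+
  have \<nu>d: "(\<nu> has_real_derivative clamp_slope h2 N y (\<nu> y)) (at y within ?Y)" if "y \<in> ?Y" for y
    using \<nu>v[OF that] by (simp add: has_real_derivative_iff_has_vector_derivative)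
  have \<nu>_cont: "continuous_on ?Y \<nu>" by (rule DERIV_continuous_on[OF \<nu>d])
  have sub: "{a..b} \<subseteq> ?Y" if "a \<in> ?Y" "b \<in> ?Y" for a b
    by (rule interval_Icc_subset[OF interval_above that])
  \<comment> \<open>\<open>N\<close> solves the clamped equation too, so a common point would force
    \<open>\<nu> y0 = N y0\<close>.\<close>
  have ne: "\<nu> y \<noteq> N y" if y: "y \<in> ?Y" for y
  proof
    assume eq: "\<nu> y = N y"
    have Nv: "(N has_vector_derivative clamp_slope h2 N z (N z)) (at z within ?Y)" if z: "z \<in> ?Y" for z
      using Nd[OF z] N'[of z] z
      by (simp add: has_real_derivative_iff_has_vector_derivative clamp_slope_def max_absorb2)
    have "\<nu> y0 = N y0"
      by (rule ode_unique[where F = "clamp_slope h2 N" and x = \<nu> and y = N,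
            OF interval_above y y0Y lip \<nu>v Nv eq])
    then show False using Ny0 \<nu>y0 by simp
  qed
  have \<nu>N: "\<nu> y < N y" if y: "y \<in> ?Y" for y
  proof (rule ccontr)
    assume "\<not> \<nu> y < N y"
    then have gt: "N y < \<nu> y" using ne[OF y] by simp
    have d_cont: "continuous_on {a..b} (\<lambda>z. \<nu> z - N z)" if "a \<in> ?Y" "b \<in> ?Y" for a b
      by (intro continuous_on_diff continuous_on_subset[OF \<nu>_cont] continuous_on_subset[OF N_cont] sub that)
    have "\<exists>z\<in>?Y. \<nu> z - N z = 0"
    proof (cases "y \<le> y0")
      case True
      then show ?thesis
        using IVT2'[of "\<lambda>z. \<nu> z - N z" y0 0 y] d_cont[OF y y0Y] sub[OF y y0Y] gt Ny0 \<nu>y0 by fastforce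
    next
      case False
      then show ?thesis
        using IVT'[of "\<lambda>z. \<nu> z - N z" y0 0 y] d_cont[OF y0Y y] sub[OF y0Y y] gt Ny0 \<nu>y0 by fastforce
    qed
    then show False using ne by auto
  qed
  have \<nu>_gt: "y < \<nu> y" if y: "y \<in> ?Y" for y
  proof (cases "y \<le> y0")
    case True
    \<comment> \<open>To the left of \<open>y0\<close> time is reversed. The field vanishes on the
      diagonal, so at a contact the gap \<open>\<nu> y - y\<close> would grow at rate 1 as
      \<open>y\<close> decreases.\<close>
    let ?d = "\<lambda>t. \<nu> (- t) + t"
    have "0 < ?d (- y)"
    proof (rule pos_if_increasing_at_zeros[of "- y0" "- y" ?d])
      have dd: "(?d has_real_derivative (- clamp_slope h2 N (- t) (\<nu> (- t)) + 1)) (at t within {- y0..- y})"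
        if t: "t \<in> {- y0..- y}" for t
      proof -
        have "(\<nu> has_real_derivative clamp_slope h2 N (- t) (\<nu> (- t))) (at (- t) within {y..y0})"
          by (rule DERIV_subset[OF \<nu>d sub[OF y y0Y]], rule subsetD[OF sub[OF y y0Y]]) (use t in auto)
        then have "(\<nu> \<circ> uminus has_real_derivative clamp_slope h2 N (- t) (\<nu> (- t)) * (- 1)) (at t within {- y0..- y})"
          by (intro DERIV_image_chain) (auto intro!: derivative_eq_intros simp: image_uminus_atLeastAtMost)
        then show ?thesis
          by (auto intro!: derivative_eq_intros simp: o_def)
      qed
      show "continuous_on {- y0..- y} ?d" by (rule DERIV_continuous_on[OF dd])
      fix t assume t: "- y0 \<le> t" "t \<le> - y" "?d t = 0"
      then have mt: "- t \<in> ?Y" by (intro subsetD[OF sub[OF y y0Y]]) auto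
      have eq: "\<nu> (- t) = - t" using t(3) by linarith
      have "clamp_slope h2 N (- t) (\<nu> (- t)) = 0"
        using N'[of "- t"] mt by (simp add: clamp_slope_def inverse_slope_def eq min_absorb1)
      then show "\<exists>D>0. (?d has_real_derivative D) (at t within {- y0..- y})"
        using dd[of t] t by (intro exI[of _ 1]) simp
    qed (use True \<nu>y0 y0 in auto)
    then show ?thesis by simp
  next
    case False
    \<comment> \<open>To the right of \<open>y0\<close> the inverse \<open>N1\<close> of
      \<open>b1\<close> is the barrier. At a contact the smaller hazard rate \<open>h2\<close> makes
      \<open>\<nu>\<close> the steeper one, so \<open>\<nu>\<close> does not fall below
      \<open>N1\<close>, which lies off the diagonal.\<close>
    let ?d = "\<lambda>t. \<nu> t - N1 t"
    have sY: "{y0..y} \<subseteq> ?Y" by (rule sub[OF y0Y y])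
    have dd: "(?d has_real_derivative clamp_slope h2 N t (\<nu> t) - inverse_slope (N1 t) t / h1 (N1 t)) (at t within {y0..y})"
      if t: "t \<in> {y0..y}" for t
    proof -
      have "t \<in> ?Y" using t sY by blast
      then show ?thesis
        by (intro DERIV_diff DERIV_subset[OF \<nu>d sY] DERIV_subset[OF N1(3) sY]) auto
    qed
    have "0 \<le> ?d y"
    proof (rule nonneg_if_increasing_at_zeros[of y0 y ?d])
      show "continuous_on {y0..y} ?d" by (rule DERIV_continuous_on[OF dd])
      fix t assume t: "y0 \<le> t" "t < y" "?d t = 0"
      then have "t \<in> ?Y" by (intro subsetD[OF sY]) auto
      then have tY: "t \<in> I" "x0 \<le> t" by auto
      have eq: "\<nu> t = N1 t" using t by simp
      have "clamp_slope h2 N t (\<nu> t) = inverse_slope (N1 t) t / h2 (N1 t)"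
        using \<nu>N[of t] N1(1)[OF tY] tY by (simp add: clamp_slope_def eq max_def min_def)
      moreover have "inverse_slope (N1 t) t / h1 (N1 t) < inverse_slope (N1 t) t / h2 (N1 t)"
        using N1(1)[OF tY] inverse_slope_pos[OF tY, of "N1 t"] h12[of "N1 t"] h2[of "N1 t"]
        by (intro divide_strict_left_mono) (auto intro: less_trans)
      ultimately show "\<exists>D>0. (?d has_real_derivative D) (at t within {y0..y})"
        using dd[of t] t by (intro exI conjI[rotated]) auto
    qed (use False \<nu>y0 N1y0 in auto)
    then show ?thesis using N1(1)[of y] y by auto
  qed
  have \<nu>I: "\<nu> y \<in> I" if "y \<in> ?Y" for y
    using I_between[of y "N y" "\<nu> y"] \<nu>N[OF that] \<nu>_gt[OF that] N'[of y] that by auto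
  have \<nu>d': "(\<nu> has_real_derivative inverse_slope (\<nu> y) y / h2 (\<nu> y)) (at y within ?Y)" if "y \<in> ?Y" for y
    using \<nu>d[OF that] \<nu>N[OF that] \<nu>_gt[OF that] by (simp add: clamp_slope_def max_absorb2 min_absorb1)
  have tan: "tangent (\<nu> y) y < \<gamma> (\<nu> y)" if "y \<in> ?Y" for y
    using tangent_below_between[of y "N y" "\<nu> y"] \<nu>N[OF that] \<nu>_gt[OF that] N'[of y] that by auto
  have pos: "0 < inverse_slope (\<nu> y) y / h2 (\<nu> y)" if "y \<in> ?Y" for y
    using inverse_slope_pos[of y "\<nu> y"] \<nu>_gt[OF that] \<nu>I[OF that] tan[OF that] h2 that by auto
  define n0 where "n0 = \<nu> x0"
  have x0Y: "x0 \<in> ?Y" using x0_I by simp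
  have n0: "n0 \<in> I" "x0 < n0" using \<nu>I[OF x0Y] \<nu>_gt[OF x0Y] by (auto simp: n0_def)
  have mono: "\<nu> y \<le> \<nu> z" if "y \<in> ?Y" "z \<in> ?Y" "y \<le> z" for y z
    by (rule interval_increasing_weak[OF interval_above that \<nu>d']) (use pos in \<open>auto intro: less_imp_le\<close>)
  have img: "\<nu> ` ?Y = {m \<in> I. n0 \<le> m}"
  proof (intro equalityI subsetI)
    fix m assume m: "m \<in> \<nu> ` ?Y"
    then show "m \<in> {m \<in> I. n0 \<le> m}" using \<nu>I mono[OF x0Y] by (auto simp: n0_def)
  next
    fix m assume m: "m \<in> {m \<in> I. n0 \<le> m}"
    then have mY: "m \<in> ?Y" using n0 by auto
    \<comment> \<open>As \<open>m < \<nu> m\<close>, the value \<open>m\<close> is attained between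
      \<open>x0\<close> and \<open>m\<close>.\<close>
    have "continuous_on {x0..m} \<nu>" by (rule continuous_on_subset[OF \<nu>_cont sub[OF x0Y mY]])
    then obtain y where "x0 \<le> y" "y \<le> m" "\<nu> y = m"
      using IVT'[of \<nu> x0 m m] \<nu>_gt[OF mY] m mY by (auto simp: n0_def)
    then show "m \<in> \<nu> ` ?Y" using sub[OF x0Y mY] by force
  qed
  obtain c where c: "\<And>m. m \<in> {m \<in> I. n0 \<le> m} \<Longrightarrow> c m \<in> ?Y"
    "\<And>m. m \<in> {m \<in> I. n0 \<le> m} \<Longrightarrow> \<nu> (c m) = m"
    "\<And>y. y \<in> ?Y \<Longrightarrow> c (\<nu> y) = y"
    "\<And>m. m \<in> {m \<in> I. n0 \<le> m} \<Longrightarrow> (c has_real_derivative 1 / (inverse_slope (\<nu> (c m)) (c m) / h2 (\<nu> (c m)))) (at m within {m \<in> I. n0 \<le> m})"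
    "\<And>m n. m \<in> {m \<in> I. n0 \<le> m} \<Longrightarrow> n \<in> {m \<in> I. n0 \<le> m} \<Longrightarrow> m < n \<Longrightarrow> c m < c n"
    by (rule inverse_of_increasing[OF interval_above img \<nu>d' pos]) (assumption | blast)+
  have "free_boundary h2 n0 c"
    unfolding free_boundary_def
  proof (intro conjI ballI impI)
    show "c n0 = x0" using c(3)[OF x0Y] by (simp add: n0_def)
    fix m assume m: "m \<in> I" "n0 \<le> m"
    then have mem: "m \<in> {m \<in> I. n0 \<le> m}" by simp
    show "x0 \<le> c m" using c(1)[OF mem] by simp
    show "c m < m" using \<nu>_gt[OF c(1)[OF mem]] c(2)[OF mem] by simp
    show "(c has_real_derivative h2 m / inverse_slope m (c m)) (at m within {m \<in> I. n0 \<le> m})"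
      using c(4)[OF mem] c(2)[OF mem] by simp
  next
    fix y assume y: "y \<in> I"
    define z where "z = max x0 y"
    have z: "z \<in> ?Y" using y x0_I by (auto simp: z_def max_def)
    have "y \<le> c m" if m: "m \<in> I" "\<nu> z \<le> m" for m
    proof -
      have nz: "n0 \<le> \<nu> z" using mono[OF x0Y z] z by (simp add: n0_def)
      have "z \<le> c m"
        using c(5)[of "\<nu> z" m] c(3)[OF z] \<nu>I[OF z] nz m by (cases "m = \<nu> z") auto
      then show ?thesis by (simp add: z_def)
    qed
    then show "\<exists>n\<in>I. \<forall>m\<in>I. n \<le> m \<longrightarrow> y \<le> c m" using \<nu>I[OF z] by blast
  qed (use n0 in auto)
  \<comment> \<open>\<open>N x0 = m2\<close>, and \<open>\<nu>\<close> is below \<open>N\<close> at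
    \<open>x0\<close> as well: the two boundaries already differ in their left endpoints.\<close>
  moreover have "n0 < m2"
  proof -
    have "m2 \<in> I" "b2 m2 = x0" using fb2 unfolding free_boundary_def by blast+
    then have "N x0 = m2" using N(2)[of m2] by simp
    then show ?thesis using \<nu>N[OF x0Y] by (simp add: n0_def)
  qed
  ultimately show ?thesis by (rule that)
qed

text \<open>The assumption \<open>unique\<close> speaks of left endpoints only, since the boundary
  from \<open>free_boundary_through\<close> starts strictly to the left of
  \<open>m2\<close>.\<close>

theorem free_boundary_comparison:
  assumes fb1: "free_boundary h1 m1 b1" and fb2: "free_boundary h2 m2 b2"
    and h2: "\<And>m. m \<in> I \<Longrightarrow> 0 < h2 m" and h12: "\<And>m. m \<in> I \<Longrightarrow> h2 m < h1 m"
    and h2_cont: "continuous_on I h2"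
    and h2_lip: "\<And>a b. a \<in> I \<Longrightarrow> b \<in> I \<Longrightarrow> \<exists>L. L-lipschitz_on {a..b} h2"
    and unique: "\<And>n0 c. free_boundary h2 n0 c \<Longrightarrow> n0 = m2"
  shows "m2 < m1" "\<And>m. m \<in> I \<Longrightarrow> m1 \<le> m \<Longrightarrow> b1 m < b2 m"
proof -
  have le: "b1 m \<le> b2 m" if m: "m \<in> I" "m1 \<le> m" "m2 \<le> m" for m
  proof (rule ccontr)
    assume "\<not> b1 m \<le> b2 m"
    then have gt: "b2 m < b1 m" by simp
    show False
    proof (rule free_boundary_through[OF fb1 fb2 h2 h12 h2_cont h2_lip m gt])
      fix n0 c assume "free_boundary h2 n0 c" "n0 < m2"
      then show False using unique by force
    qed
  qed
  \<comment> \<open>At a meeting point the steeper \<open>b1\<close> would exceed \<open>b2\<close>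
    just to the right, against \<open>le\<close>.\<close>
  have less: "b1 m < b2 m" if m: "m \<in> I" "m1 \<le> m" "m2 \<le> m" for m
  proof (rule ccontr)
    assume "\<not> b1 m < b2 m"
    then have eq: "b1 m = b2 m" using le[OF m] by simp
    let ?A = "{n \<in> I. m \<le> n}"
    have "(b1 has_real_derivative h1 m / inverse_slope m (b1 m)) (at m within ?A)"
      by (rule DERIV_subset[OF free_boundaryD(4)[OF fb1 m(1,2)]]) (use m in auto)
    moreover have "(b2 has_real_derivative h2 m / inverse_slope m (b1 m)) (at m within ?A)"
      unfolding eq by (rule DERIV_subset[OF free_boundaryD(4)[OF fb2 m(1,3)]]) (use m in auto)
    ultimately have "((\<lambda>n. b1 n - b2 n) has_real_derivative
        h1 m / inverse_slope m (b1 m) - h2 m / inverse_slope m (b1 m)) (at m within ?A)"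
      by (rule DERIV_diff)
    moreover have "0 < h1 m / inverse_slope m (b1 m) - h2 m / inverse_slope m (b1 m)"
    proof -
      have h1: "0 < h1 m" if "m \<in> I" for m using h2[OF that] h12[OF that] by simp
      have "0 < inverse_slope m (b1 m)"
        using free_boundaryD[OF fb1 m(1,2)] free_boundary_tangent_below[OF fb1 h1 m(1,2)] m(1)
        by (intro inverse_slope_pos) auto
      then show ?thesis using h12[OF m(1)] by (simp add: divide_strict_right_mono)
    qed
    ultimately obtain e where e: "e > 0" "\<And>d. 0 < d \<Longrightarrow> m + d \<in> ?A \<Longrightarrow> d < e \<Longrightarrow>
        b1 m - b2 m < b1 (m + d) - b2 (m + d)"
      using has_real_derivative_pos_inc_right by blast
    obtain e' where e': "e' > 0" "ball m e' \<subseteq> I" using open_I m(1) open_contains_ball by blast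
    define d where "d = min e e' / 2"
    have d: "0 < d" "d < e" "d < e'" using e(1) e'(1) by (auto simp: d_def min_def)
    have "m + d \<in> I" using e'(2) d by (auto simp: dist_real_def subset_iff)
    then show False using e(2)[of d] d le[of "m + d"] eq m by auto
  qed
  have m: "m1 \<in> I" "m2 \<in> I" "b2 m2 = x0" using fb1 fb2 unfolding free_boundary_def by blast+
  \<comment> \<open>Otherwise \<open>m2\<close> belongs to both domains and
    \<open>b1 m2 < b2 m2 = x0\<close>, although \<open>b1\<close> never falls below
    \<open>x0\<close>.\<close>
  show *: "m2 < m1"
  proof (rule ccontr)
    assume "\<not> m2 < m1"
    then show False using less[of m2] free_boundaryD(1)[OF fb1, of m2] m by simp
  qed
  show "b1 m < b2 m" if "m \<in> I" "m1 \<le> m" for m using less that * by simp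
qed

end

section \<open>Harmonic functions of a diffusion\<close>

text \<open>Extends the differential equation, which is known inside the continuation region only,
  by continuity to the end points of a slice.\<close>

lemma zero_except_finite:
  fixes g :: "real \<Rightarrow> real"
  assumes J: "is_interval J" "p \<in> J" "q \<in> J" "p \<noteq> q" and g: "continuous_on J g"
    and E: "finite E" "\<And>x. x \<in> J \<Longrightarrow> x \<notin> E \<Longrightarrow> g x = 0" and x: "x \<in> J"
  shows "g x = 0"
proof -
  have "x islimpt J"
    using connected_imp_perfect[of J x] J x by (metis is_interval_connected_1 singletonD)
  moreover have "J \<subseteq> E \<union> (J - E)" by blast
  ultimately have "x islimpt (J - E)" using islimpt_Un_finite[OF E(1)] islimpt_subset by blast
  then have nt: "at x within (J - E) \<noteq> bot" by (simp add: trivial_limit_within)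
  have "(g \<longlongrightarrow> g x) (at x within J)" using g x by (simp add: continuous_on_def)
  then have "(g \<longlongrightarrow> g x) (at x within (J - E))" by (rule tendsto_within_subset) auto
  moreover have "\<forall>\<^sub>F y in at x within (J - E). g y = 0"
    unfolding eventually_at_filter using E(2) by (auto intro: always_eventually)
  then have "(g \<longlongrightarrow> 0) (at x within (J - E))" by (rule tendsto_eventually)
  ultimately show ?thesis by (rule tendsto_unique[OF nt])
qed

lemma generator_eq:
  assumes "open U" "x \<in> U" "\<And>y. y \<in> U \<Longrightarrow> (u has_real_derivative v y) (at y)"
    and "(v has_real_derivative w) (at x)"
  shows "generator \<mu> \<sigma> u x = \<mu> x * v x + (\<sigma> x)\<^sup>2 / 2 * w"
proof -
  have d: "deriv u y = v y" if "y \<in> U" for y using assms(3)[OF that] by (rule DERIV_imp_deriv)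
  have "(deriv u has_real_derivative w) (at x)"
    by (rule has_field_derivative_transform_within_open[OF assms(4,1,2)]) (simp add: d)
  then show ?thesis using d[OF assms(2)] by (simp add: generator_def DERIV_imp_deriv)
qed

text \<open>Rephrases the limit by real points of the interval, which treats finite and infinite
  \<open>\<alpha>\<close> alike.\<close>

lemma tendsto_at_right_ereal_iff:
  assumes "\<alpha> < \<beta>"
  shows "((\<lambda>x. u (real_of_ereal x)) \<longlongrightarrow> (0::real)) (at_right \<alpha>) \<longleftrightarrow>
    (\<forall>e>0. \<exists>n\<in>einterval \<alpha> \<beta>. \<forall>x\<in>einterval \<alpha> \<beta>. x < n \<longrightarrow> \<bar>u x\<bar> < e)"
proof
  assume L: "((\<lambda>x. u (real_of_ereal x)) \<longlongrightarrow> 0) (at_right \<alpha>)"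
  show "\<forall>e>0. \<exists>n\<in>einterval \<alpha> \<beta>. \<forall>x\<in>einterval \<alpha> \<beta>. x < n \<longrightarrow> \<bar>u x\<bar> < e"
  proof (intro allI impI)
    fix e :: real assume "e > 0"
    then have "\<forall>\<^sub>F x in at_right \<alpha>. dist (u (real_of_ereal x)) 0 < e" using L tendstoD by blast
    then obtain b where b: "\<alpha> < b" "\<And>y. \<alpha> < y \<Longrightarrow> y < b \<Longrightarrow> \<bar>u (real_of_ereal y)\<bar> < e"
      unfolding eventually_at_right[OF assms] by (auto simp: dist_real_def)
    obtain n where n: "\<alpha> < ereal n" "ereal n < min b \<beta>"
      using ereal_dense2[of \<alpha> "min b \<beta>"] b(1) assms by auto
    have "\<bar>u x\<bar> < e" if "x \<in> einterval \<alpha> \<beta>" "x < n" for x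
    proof -
      have "ereal x < b" using that(2) n(2) by (simp add: less_trans[of "ereal x" "ereal n"])
      then show ?thesis using b(2)[of "ereal x"] that(1) by (simp add: einterval_iff)
    qed
    then show "\<exists>n\<in>einterval \<alpha> \<beta>. \<forall>x\<in>einterval \<alpha> \<beta>. x < n \<longrightarrow> \<bar>u x\<bar> < e"
      using n by (intro bexI[of _ n]) (auto simp: einterval_iff)
  qed
next
  assume R: "\<forall>e>0. \<exists>n\<in>einterval \<alpha> \<beta>. \<forall>x\<in>einterval \<alpha> \<beta>. x < n \<longrightarrow> \<bar>u x\<bar> < e"
  show "((\<lambda>x. u (real_of_ereal x)) \<longlongrightarrow> 0) (at_right \<alpha>)"
  proof (rule tendstoI)
    fix e :: real assume "e > 0"
    then obtain n where n: "n \<in> einterval \<alpha> \<beta>" "\<And>x. x \<in> einterval \<alpha> \<beta> \<Longrightarrow> x < n \<Longrightarrow> \<bar>u x\<bar> < e"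
      using R by blast
    have "\<bar>u (real_of_ereal y)\<bar> < e" if y: "\<alpha> < y" "y < ereal n" for y
    proof -
      obtain x where x: "y = ereal x" using y by (cases y) auto
      have "ereal n < \<beta>" using n(1) by (simp add: einterval_iff)
      then have "x \<in> einterval \<alpha> \<beta>" "x < n" using y by (auto simp: x einterval_iff intro: less_trans[of _ "ereal n"])
      then show ?thesis using n(2) x by simp
    qed
    then show "\<forall>\<^sub>F x in at_right \<alpha>. dist (u (real_of_ereal x)) 0 < e"
      unfolding eventually_at_right[OF assms] using n(1)
      by (intro exI[of _ "ereal n"]) (auto simp: dist_real_def einterval_iff)
  qed
qed

text \<open>As \<open>b\<close> stays inside the interval, only lower bounds matter in the limit;
  the right-hand side is the last clause of \<open>free_boundary\<close>.\<close>

lemma tendsto_at_left_ereal_iff: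
  assumes "\<alpha> < \<beta>" "m0 \<in> einterval \<alpha> \<beta>"
    and b: "\<And>m. m \<in> einterval \<alpha> \<beta> \<Longrightarrow> m0 \<le> m \<Longrightarrow> b m \<in> einterval \<alpha> \<beta>"
  shows "((\<lambda>m. ereal (b (real_of_ereal m))) \<longlongrightarrow> \<beta>) (at_left \<beta>) \<longleftrightarrow>
    (\<forall>y\<in>einterval \<alpha> \<beta>. \<exists>n\<in>einterval \<alpha> \<beta>. \<forall>m\<in>einterval \<alpha> \<beta>. n \<le> m \<longrightarrow> y \<le> b m)"
proof
  assume L: "((\<lambda>m. ereal (b (real_of_ereal m))) \<longlongrightarrow> \<beta>) (at_left \<beta>)"
  show "\<forall>y\<in>einterval \<alpha> \<beta>. \<exists>n\<in>einterval \<alpha> \<beta>. \<forall>m\<in>einterval \<alpha> \<beta>. n \<le> m \<longrightarrow> y \<le> b m"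
  proof
    fix y assume "y \<in> einterval \<alpha> \<beta>"
    then have "\<forall>\<^sub>F m in at_left \<beta>. ereal y < ereal (b (real_of_ereal m))"
      by (intro order_tendstoD(1)[OF L]) (simp add: einterval_iff)
    then obtain c where c: "c < \<beta>" "\<And>m. c < m \<Longrightarrow> m < \<beta> \<Longrightarrow> y < b (real_of_ereal m)"
      unfolding eventually_at_left[OF assms(1)] by auto
    obtain n where n: "max c \<alpha> < ereal n" "ereal n < \<beta>"
      using ereal_dense2[of "max c \<alpha>" \<beta>] c(1) assms by auto
    have "y \<le> b m" if "m \<in> einterval \<alpha> \<beta>" "n \<le> m" for m
    proof -
      have "c < ereal m" using that(2) n(1) by (auto intro: less_le_trans[of c "ereal n"])
      then show ?thesis using c(2)[of "ereal m"] that(1) by (simp add: einterval_iff)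
    qed
    then show "\<exists>n\<in>einterval \<alpha> \<beta>. \<forall>m\<in>einterval \<alpha> \<beta>. n \<le> m \<longrightarrow> y \<le> b m"
      using n by (intro bexI[of _ n]) (auto simp: einterval_iff)
  qed
next
  assume R: "\<forall>y\<in>einterval \<alpha> \<beta>. \<exists>n\<in>einterval \<alpha> \<beta>. \<forall>m\<in>einterval \<alpha> \<beta>. n \<le> m \<longrightarrow> y \<le> b m"
  have ev: "\<forall>\<^sub>F m in at_left \<beta>. real_of_ereal m \<in> einterval \<alpha> \<beta> \<and> n \<le> real_of_ereal m"
    if n: "n \<in> einterval \<alpha> \<beta>" for n
  proof -
    have "real_of_ereal m \<in> einterval \<alpha> \<beta> \<and> n \<le> real_of_ereal m" if m: "ereal n < m" "m < \<beta>" for m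
    proof -
      obtain x where x: "m = ereal x" using m by (cases m) auto
      have "\<alpha> < ereal n" using n by (simp add: einterval_iff)
      then show ?thesis using m by (auto simp: x einterval_iff intro: less_trans[of _ "ereal n"])
    qed
    then show ?thesis
      unfolding eventually_at_left[OF assms(1)] using n
      by (intro exI[of _ "ereal n"]) (auto simp: einterval_iff)
  qed
  show "((\<lambda>m. ereal (b (real_of_ereal m))) \<longlongrightarrow> \<beta>) (at_left \<beta>)"
  proof (rule order_tendstoI)
    fix a assume "a < \<beta>"
    then obtain y where y: "max a \<alpha> < ereal y" "ereal y < \<beta>"
      using ereal_dense2[of "max a \<alpha>" \<beta>] assms(1) by auto
    then have "y \<in> einterval \<alpha> \<beta>" by (simp add: einterval_iff)
    then obtain n where n: "n \<in> einterval \<alpha> \<beta>" "\<And>m. m \<in> einterval \<alpha> \<beta> \<Longrightarrow> n \<le> m \<Longrightarrow> y \<le> b m"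
      using R by blast
    show "\<forall>\<^sub>F m in at_left \<beta>. a < ereal (b (real_of_ereal m))"
      using ev[OF n(1)]
    proof eventually_elim
      case (elim m)
      then have "ereal y \<le> ereal (b (real_of_ereal m))" using n(2) by simp
      then show ?case using y(1) by (simp add: less_le_trans[of a "ereal y"])
    qed
  next
    fix a assume "\<beta> < a"
    show "\<forall>\<^sub>F m in at_left \<beta>. ereal (b (real_of_ereal m)) < a"
      using ev[OF assms(2)]
    proof eventually_elim
      case (elim m)
      then have "ereal (b (real_of_ereal m)) < \<beta>" using b by (simp add: einterval_iff)
      then show ?case using \<open>\<beta> < a\<close> by (rule less_trans)
    qed
  qed
qed

section \<open>The equation \<L> u = r u: initial value problems and positivity\<close>

locale diffusion_operator =
  fixes r :: real and \<alpha> \<beta> :: ereal and \<mu> \<sigma> :: "real \<Rightarrow> real"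
  assumes r_pos: "0 < r" and \<alpha>\<beta>: "\<alpha> < \<beta>"
    and \<mu>_cont: "continuous_on (einterval \<alpha> \<beta>) \<mu>" and \<sigma>_cont: "continuous_on (einterval \<alpha> \<beta>) \<sigma>"
    and \<sigma>_pos: "x \<in> einterval \<alpha> \<beta> \<Longrightarrow> 0 < \<sigma> x"
begin

abbreviation "I \<equiv> einterval \<alpha> \<beta>"

lemma I_interval: "is_interval I"
proof -
  have "x \<in> I" if "a \<in> I" "b \<in> I" "a \<le> x" "x \<le> b" for a b x
    using that less_le_trans[of \<alpha> "ereal a" "ereal x"] le_less_trans[of "ereal x" "ereal b" \<beta>]
    by (simp add: einterval_iff)
  then show ?thesis unfolding is_interval_1 by blast
qed

lemma \<sigma>_nz: "x \<in> I \<Longrightarrow> \<sigma> x \<noteq> 0"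
  using \<sigma>_pos by fastforce

text \<open>\<open>u\<close> with derivative \<open>v\<close> solves \<open>\<mu> u' + \<sigma>\<^sup>2 u'' / 2 = r u\<close> on \<open>J\<close>.\<close>

definition harmonic_on :: "real set \<Rightarrow> (real \<Rightarrow> real) \<Rightarrow> (real \<Rightarrow> real) \<Rightarrow> bool" where
  "harmonic_on J u v \<longleftrightarrow> (\<forall>x\<in>J. (u has_real_derivative v x) (at x within J) \<and>
     (v has_real_derivative 2 / (\<sigma> x)\<^sup>2 * (r * u x - \<mu> x * v x)) (at x within J))"

lemma harmonic_onD:
  assumes "harmonic_on J u v" "x \<in> J"
  shows "(u has_real_derivative v x) (at x within J)"
    "(v has_real_derivative 2 / (\<sigma> x)\<^sup>2 * (r * u x - \<mu> x * v x)) (at x within J)"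
  using assms by (auto simp: harmonic_on_def)

lemma harmonic_on_subset:
  assumes "harmonic_on J u v" "K \<subseteq> J"
  shows "harmonic_on K u v"
  unfolding harmonic_on_def
  using DERIV_subset[OF harmonic_onD(1)[OF assms(1)] assms(2)]
    DERIV_subset[OF harmonic_onD(2)[OF assms(1)] assms(2)] assms(2) by blast

lemma harmonic_on_scale:
  assumes "harmonic_on J u v"
  shows "harmonic_on J (\<lambda>x. c * u x) (\<lambda>x. c * v x)"
  unfolding harmonic_on_def
proof (intro ballI conjI)
  fix x assume x: "x \<in> J"
  show "((\<lambda>x. c * u x) has_real_derivative c * v x) (at x within J)"
    by (rule DERIV_cmult[OF harmonic_onD(1)[OF assms x]])
  show "((\<lambda>x. c * v x) has_real_derivative 2 / (\<sigma> x)\<^sup>2 * (r * (c * u x) - \<mu> x * (c * v x))) (at x within J)"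
    by (rule DERIV_cong[OF DERIV_cmult[OF harmonic_onD(2)[OF assms x]]]) (simp add: right_diff_distrib mult.left_commute)
qed

definition phase_field :: "real \<Rightarrow> real \<times> real \<Rightarrow> real \<times> real" where
  "phase_field x p = (snd p, 2 / (\<sigma> x)\<^sup>2 * (r * fst p - \<mu> x * snd p))"

lemma harmonic_on_iff:
  "harmonic_on J u v \<longleftrightarrow>
    (\<forall>x\<in>J. ((\<lambda>x. (u x, v x)) has_vector_derivative phase_field x (u x, v x)) (at x within J))"
proof -
  have "(p has_vector_derivative q) (at x within J) \<longleftrightarrow>
      ((\<lambda>x. fst (p x)) has_vector_derivative fst q) (at x within J) \<and>
      ((\<lambda>x. snd (p x)) has_vector_derivative snd q) (at x within J)" for p :: "real \<Rightarrow> real \<times> real" and q x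
    using has_vector_derivative_Pair[of "\<lambda>x. fst (p x)" "fst q" x J "\<lambda>x. snd (p x)" "snd q"]
      bounded_linear.has_vector_derivative[OF bounded_linear_fst, of p q "at x within J"]
      bounded_linear.has_vector_derivative[OF bounded_linear_snd, of p q "at x within J"]
    by auto
  then show ?thesis
    by (simp add: harmonic_on_def phase_field_def has_real_derivative_iff_has_vector_derivative)
qed

lemma coefficients_cont: "continuous_on I (\<lambda>x. 2 / (\<sigma> x)\<^sup>2)" "continuous_on I (\<lambda>x. 2 * \<mu> x / (\<sigma> x)\<^sup>2)"
  using \<sigma>_nz by (auto intro!: continuous_intros \<sigma>_cont \<mu>_cont)

lemma phase_field_lipschitz:
  assumes "{a..b} \<subseteq> I"
  shows "\<exists>L. \<forall>x\<in>{a..b}. L-lipschitz_on UNIV (phase_field x)"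
proof -
  have "bounded ((\<lambda>x. 2 / (\<sigma> x)\<^sup>2) ` {a..b})" "bounded ((\<lambda>x. 2 * \<mu> x / (\<sigma> x)\<^sup>2) ` {a..b})"
    by (intro compact_imp_bounded compact_continuous_image continuous_on_subset[OF coefficients_cont(1) assms]
        continuous_on_subset[OF coefficients_cont(2) assms] compact_Icc)+
  then obtain A B where A: "\<And>x. x \<in> {a..b} \<Longrightarrow> norm (2 / (\<sigma> x)\<^sup>2) \<le> A"
    and B: "\<And>x. x \<in> {a..b} \<Longrightarrow> norm (2 * \<mu> x / (\<sigma> x)\<^sup>2) \<le> B"
    unfolding bounded_iff by blast
  have "(1 + \<bar>A\<bar> * r + \<bar>B\<bar>)-lipschitz_on UNIV (phase_field x)" if x: "x \<in> {a..b}" for x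
  proof (rule lipschitz_onI)
    fix p q :: "real \<times> real"
    define d where "d = p - q"
    have bd: "\<bar>fst d\<bar> \<le> norm d" "\<bar>snd d\<bar> \<le> norm d"
      using norm_fst_le[of "fst d" "snd d"] norm_snd_le[of "snd d" "fst d"] by auto
    have "phase_field x p - phase_field x q = (snd d, 2 / (\<sigma> x)\<^sup>2 * r * fst d - 2 * \<mu> x / (\<sigma> x)\<^sup>2 * snd d)"
      by (simp add: phase_field_def d_def right_diff_distrib left_diff_distrib diff_divide_distrib mult_ac)
    then have "norm (phase_field x p - phase_field x q)
        \<le> \<bar>snd d\<bar> + \<bar>2 / (\<sigma> x)\<^sup>2 * r * fst d - 2 * \<mu> x / (\<sigma> x)\<^sup>2 * snd d\<bar>"
      using norm_Pair_le by (metis real_norm_def)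
    also have "\<bar>2 / (\<sigma> x)\<^sup>2 * r * fst d - 2 * \<mu> x / (\<sigma> x)\<^sup>2 * snd d\<bar>
        \<le> \<bar>2 / (\<sigma> x)\<^sup>2\<bar> * r * \<bar>fst d\<bar> + \<bar>2 * \<mu> x / (\<sigma> x)\<^sup>2\<bar> * \<bar>snd d\<bar>"
      using r_pos by (intro order_trans[OF abs_triangle_ineq4]) (simp add: abs_mult)
    also have "\<dots> \<le> \<bar>A\<bar> * r * norm d + \<bar>B\<bar> * norm d"
      using A[OF x] B[OF x] r_pos bd by (intro add_mono mult_mono) auto
    finally have "norm (phase_field x p - phase_field x q) \<le> norm d + (\<bar>A\<bar> * r * norm d + \<bar>B\<bar> * norm d)"
      using bd by linarith
    then show "dist (phase_field x p) (phase_field x q) \<le> (1 + \<bar>A\<bar> * r + \<bar>B\<bar>) * dist p q"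
      by (simp add: dist_norm d_def algebra_simps)
  qed (use r_pos in simp)
  then show ?thesis by blast
qed

lemma harmonic_exists:
  assumes "x0 \<in> I"
  obtains u v where "harmonic_on I u v" "u x0 = c" "v x0 = d"
proof -
  have lip: "\<exists>L. \<forall>x\<in>{a..b}. L-lipschitz_on UNIV (phase_field x)" if "a \<in> I" "b \<in> I" for a b
    by (rule phase_field_lipschitz[OF interval_Icc_subset[OF I_interval that]])
  have cont: "continuous_on (I \<times> UNIV) (\<lambda>(x, p). phase_field x p)"
    unfolding phase_field_def split_beta
    using \<sigma>_nz by (intro continuous_intros continuous_on_compose2[OF \<sigma>_cont] continuous_on_compose2[OF \<mu>_cont]) auto
  obtain p where p: "p x0 = (c, d)" "\<And>x. x \<in> I \<Longrightarrow> (p has_vector_derivative phase_field x (p x)) (at x within I)"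
    by (rule ode_exists[OF I_interval assms lip cont, of "(c, d)"]) blast+
  have "harmonic_on I (fst \<circ> p) (snd \<circ> p)" unfolding harmonic_on_iff using p(2) by simp
  then show ?thesis by (rule that) (simp_all add: p(1))
qed

lemma harmonic_unique:
  assumes J: "is_interval J" "J \<subseteq> I" "a \<in> J" "x \<in> J"
    and h: "harmonic_on J u v" "harmonic_on J u' v'" "u a = u' a" "v a = v' a"
  shows "u x = u' x" "v x = v' x"
proof -
  have lip: "\<exists>L. \<forall>x\<in>{a..b}. L-lipschitz_on UNIV (phase_field x)" if "a \<in> J" "b \<in> J" for a b
    using phase_field_lipschitz interval_Icc_subset[OF J(1) that] J(2) by blast
  have "(\<lambda>x. (u x, v x)) x = (\<lambda>x. (u' x, v' x)) x"
    by (rule ode_unique[where F = phase_field, OF J(1,3,4) lip])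
      (use h in \<open>simp_all add: harmonic_on_iff\<close>)
  then show "u x = u' x" "v x = v' x" by auto
qed

text \<open>\<open>s\<close> is a scale density, the exponential of minus a primitive of
  \<open>2 \<mu> / \<sigma>\<^sup>2\<close>. Wronskians of two solutions are constant multiples of
  it.\<close>

lemma scale_exists:
  obtains s where "\<And>x. x \<in> I \<Longrightarrow> 0 < s x"
    "\<And>x. x \<in> I \<Longrightarrow> (s has_real_derivative - (2 * \<mu> x / (\<sigma> x)\<^sup>2 * s x)) (at x)"
proof -
  obtain a where a: "a \<in> I" using einterval_nonempty[OF \<alpha>\<beta>] by blast
  obtain h where h: "\<And>x. x \<in> I \<Longrightarrow> (h has_real_derivative 2 * \<mu> x / (\<sigma> x)\<^sup>2) (at x within I)"
    using antiderivative_exists[OF I_interval a coefficients_cont(2)] by metis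
  show ?thesis
  proof (rule that[of "\<lambda>x. exp (- h x)"])
    fix x assume x: "x \<in> I"
    then have "(h has_real_derivative 2 * \<mu> x / (\<sigma> x)\<^sup>2) (at x)"
      using h[OF x] by (simp add: at_within_open[OF x])
    then show "((\<lambda>x. exp (- h x)) has_real_derivative - (2 * \<mu> x / (\<sigma> x)\<^sup>2 * exp (- h x))) (at x)"
      by (auto intro!: derivative_eq_intros)
  qed simp
qed

text \<open>With the scale density \<open>s\<close>, the function \<open>E = u v / s\<close> is nondecreasing and \<open>(u\<^sup>2)' = 2 s E\<close>. So if
  \<open>u v \<le> 0\<close> somewhere, then \<open>u\<^sup>2\<close> decreases to the left of that point, and hence vanishes there.\<close>

lemma harmonic_pos:
  assumes h: "harmonic_on I u v"
    and lim: "\<And>e. 0 < e \<Longrightarrow> \<exists>n\<in>I. \<forall>x\<in>I. x < n \<longrightarrow> \<bar>u x\<bar> < e"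
    and a: "a \<in> I" "u a \<noteq> 0 \<or> v a \<noteq> 0" and p: "p \<in> I"
  shows "0 < u p * v p"
proof (rule ccontr)
  assume neg: "\<not> 0 < u p * v p"
  obtain s where s: "\<And>x. x \<in> I \<Longrightarrow> 0 < s x"
    "\<And>x. x \<in> I \<Longrightarrow> (s has_real_derivative - (2 * \<mu> x / (\<sigma> x)\<^sup>2 * s x)) (at x)"
    using scale_exists by blast
  have d: "(u has_real_derivative v x) (at x)"
    "(v has_real_derivative 2 / (\<sigma> x)\<^sup>2 * (r * u x - \<mu> x * v x)) (at x)" if "x \<in> I" for x
    using harmonic_onD[OF h that] by (simp_all add: at_within_open[OF that])
  define E where "E x = u x * v x / s x" for x
  \<comment> \<open>The drift term of the derivative of \<open>v\<close> cancels against the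
    derivative of \<open>1 / s\<close>; two squares with nonnegative coefficients remain.\<close>
  have Ed: "(E has_real_derivative ((v x)\<^sup>2 + 2 * r * (u x)\<^sup>2 / (\<sigma> x)\<^sup>2) / s x) (at x)" if x: "x \<in> I" for x
    unfolding E_def
    by (rule DERIV_cong[OF DERIV_divide[OF DERIV_mult[OF d(1)[OF x] d(2)[OF x]] s(2)[OF x]]])
      (use s(1)[OF x] \<sigma>_pos[OF x] in \<open>auto simp: field_simps power2_eq_square\<close>)
  have E'_nonneg: "0 \<le> ((v x)\<^sup>2 + 2 * r * (u x)\<^sup>2 / (\<sigma> x)\<^sup>2) / s x" if "x \<in> I" for x
    using s(1)[OF that] r_pos \<sigma>_pos[OF that] by (intro divide_nonneg_pos add_nonneg_nonneg) auto
  have "E x \<le> E p" if x: "x \<in> I" "x \<le> p" for x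
    by (rule interval_increasing_weak[OF I_interval x(1) p x(2) has_field_derivative_at_within[OF Ed] E'_nonneg])
  moreover have "E p \<le> 0" using neg s(1)[OF p] by (simp add: E_def divide_nonpos_pos)
  ultimately have "u x * v x \<le> 0" if "x \<in> I" "x \<le> p" for x
    using that s(1)[of x] order_trans[of "E x" "E p" 0] by (auto simp: E_def divide_le_0_iff)
  then have anti: "(u y)\<^sup>2 \<le> (u x)\<^sup>2" if x: "x \<in> I" "x \<le> y" and y: "y \<in> I" "y \<le> p" for x y
    by (intro interval_decreasing_weak[OF I_interval x(1) y(1) x(2), of "\<lambda>x. (u x)\<^sup>2" "\<lambda>x. 2 * (u x * v x)"])
      (use y in \<open>auto intro!: derivative_eq_intros has_field_derivative_at_within[OF d(1)]\<close>)
  have zero: "u y = 0" if y: "y \<in> I" "y \<le> p" for y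
  proof (rule ccontr)
    assume "u y \<noteq> 0"
    then obtain n where n: "n \<in> I" "\<And>x. x \<in> I \<Longrightarrow> x < n \<Longrightarrow> \<bar>u x\<bar> < \<bar>u y\<bar>"
      using lim[of "\<bar>u y\<bar>"] by auto
    have "\<alpha> < ereal (min n y)" using n(1) y(1) by (auto simp: einterval_iff min_def)
    then obtain x where "\<alpha> < ereal x" "ereal x < ereal (min n y)" using ereal_dense2 by blast
    then have "x < n" "x < y" "x \<in> I" using y(1) by (auto simp: einterval_iff intro: less_trans[of _ "ereal y"])
    then show False using n(2)[of x] anti[of x y] y abs_le_square_iff[of "u y" "u x"] by auto
  qed
  \<comment> \<open>A point strictly to the left of \<open>p\<close> lies inside the interval on
    which \<open>u\<close> vanishes. There \<open>v\<close> vanishes too, so \<open>u\<close> is the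
    zero solution.\<close>
  have "\<alpha> < ereal p" using p by (simp add: einterval_iff)
  then obtain q where "\<alpha> < ereal q" "ereal q < ereal p" using ereal_dense2 by blast
  then have q: "q \<in> I" "q < p" using p by (auto simp: einterval_iff intro: less_trans[of _ "ereal p"])
  have "(u has_real_derivative 0) (at q)"
    by (rule has_field_derivative_transform_within_open[of "\<lambda>_. 0" _ _ "I \<inter> {..<p}"])
      (use q zero in auto)
  then have "v q = 0" using d(1)[OF q(1)] DERIV_unique by blast
  moreover have "harmonic_on I (\<lambda>_. 0) (\<lambda>_. 0)" by (simp add: harmonic_on_def)
  ultimately have "u a = 0" "v a = 0"
    using harmonic_unique[OF I_interval order_refl q(1) a(1) h] zero[OF q(1)] q(2) by auto
  then show False using a(2) by simp
qed

end

section \<open>Reduction of the stopping problem to the geometry of tangents\<close>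

text \<open>The prescribed derivative of \<open>\<zeta>\<close> is the one of reduction of order,
  which makes \<open>\<psi> * \<zeta>\<close> a second solution. \<open>G_concave\<close> bounds the
  Wronskian of \<open>\<psi>\<close> and \<open>G\<close> relative to the scale density, which is
  the slope of \<open>G / \<psi>\<close> with respect to \<open>\<zeta>\<close>.\<close>

locale stopping_problem = diffusion_operator +
  fixes R R' R'' G G' \<psi> \<psi>' s \<zeta> :: "real \<Rightarrow> real" and x0 :: real
  assumes x0_in: "x0 \<in> I"
    and R_deriv: "x \<in> I \<Longrightarrow> (R has_real_derivative R' x) (at x)"
    and R'_deriv: "x \<in> I \<Longrightarrow> (R' has_real_derivative R'' x) (at x)"
    and R''_cont: "continuous_on I R''"
    and R_neg: "x \<in> I \<Longrightarrow> x0 \<le> x \<Longrightarrow> \<mu> x * R' x + (\<sigma> x)\<^sup>2 / 2 * R'' x - r * R x < 0"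
    and G_deriv: "x \<in> I \<Longrightarrow> (G has_real_derivative G' x) (at x)"
    and G'_cont: "continuous_on I G'"
    and R_less_G: "x \<in> I \<Longrightarrow> x0 \<le> x \<Longrightarrow> R x < G x"
    and \<psi>_harmonic: "harmonic_on I \<psi> \<psi>'"
    and \<psi>_pos: "x \<in> I \<Longrightarrow> 0 < \<psi> x"
    and \<psi>_x0: "\<psi> x0 = R x0" and \<psi>'_x0: "\<psi>' x0 = R' x0"
    and \<psi>_vanishes: "0 < e \<Longrightarrow> \<exists>n\<in>I. \<forall>x\<in>I. x < n \<longrightarrow> \<bar>\<psi> x\<bar> < e"
    and s_pos: "x \<in> I \<Longrightarrow> 0 < s x"
    and s_deriv: "x \<in> I \<Longrightarrow> (s has_real_derivative - (2 * \<mu> x / (\<sigma> x)\<^sup>2 * s x)) (at x)"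
    and \<zeta>_derivative: "x \<in> I \<Longrightarrow> (\<zeta> has_real_derivative s x / (\<psi> x)\<^sup>2) (at x)"
    and G_concave: "x \<in> I \<Longrightarrow> y \<in> I \<Longrightarrow> x \<le> y \<Longrightarrow> (\<psi> y * G' y - \<psi>' y * G y) / s y \<le> (\<psi> x * G' x - \<psi>' x * G x) / s x"
begin

lemma \<psi>_deriv:
  assumes "x \<in> I"
  shows "(\<psi> has_real_derivative \<psi>' x) (at x)"
    "(\<psi>' has_real_derivative 2 / (\<sigma> x)\<^sup>2 * (r * \<psi> x - \<mu> x * \<psi>' x)) (at x)"
  using harmonic_onD[OF \<psi>_harmonic assms] by (simp_all add: at_within_open[OF assms])

lemma \<psi>_nz: "x \<in> I \<Longrightarrow> \<psi> x \<noteq> 0" and s_nz: "x \<in> I \<Longrightarrow> s x \<noteq> 0"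
  using \<psi>_pos s_pos by fastforce+

lemma cont_on_I:
  "continuous_on I \<psi>" "continuous_on I \<psi>'" "continuous_on I s" "continuous_on I R" "continuous_on I R'"
  "continuous_on I G"
  by (rule DERIV_continuous_on, rule has_field_derivative_at_within, rule \<psi>_deriv s_deriv R_deriv R'_deriv G_deriv, assumption)+

definition "\<rho> x = R x / \<psi> x"
definition "\<gamma> x = G x / \<psi> x"
text \<open>A Wronskian relative to the scale density: the quotient rule for
  \<open>R / \<psi>\<close>, divided by the derivative of \<open>\<zeta>\<close>, leaves exactly
  this.\<close>

definition "\<theta> x = (\<psi> x * R' x - \<psi>' x * R x) / s x"
definition "\<delta> x = (\<psi> x * G' x - \<psi>' x * G x) / s x"
text \<open>In the derivative of \<open>\<theta>\<close> the terms from \<open>\<psi>''\<close> and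
  from the scale density combine to a positive multiple of \<L> R - r R, whose sign thus decides on
  concavity.\<close>

definition "\<theta>' x = 2 * \<psi> x / ((\<sigma> x)\<^sup>2 * s x) * (\<mu> x * R' x + (\<sigma> x)\<^sup>2 / 2 * R'' x - r * R x)"

sublocale tangent_geometry I x0 \<zeta> "\<lambda>x. s x / (\<psi> x)\<^sup>2" \<rho> \<theta> \<theta>' \<gamma> \<delta>
proof
  fix x assume x: "x \<in> I"
  show "0 < s x / (\<psi> x)\<^sup>2" using s_pos[OF x] \<psi>_nz[OF x] by simp
  show "(\<rho> has_real_derivative \<theta> x * (s x / (\<psi> x)\<^sup>2)) (at x)"
    unfolding \<rho>_def \<theta>_def
    by (rule DERIV_cong[OF DERIV_divide[OF R_deriv[OF x] \<psi>_deriv(1)[OF x] \<psi>_nz[OF x]]])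
      (use \<psi>_nz[OF x] s_nz[OF x] in \<open>simp add: field_simps power2_eq_square\<close>)
  show "(\<gamma> has_real_derivative \<delta> x * (s x / (\<psi> x)\<^sup>2)) (at x)"
    unfolding \<gamma>_def \<delta>_def
    by (rule DERIV_cong[OF DERIV_divide[OF G_deriv[OF x] \<psi>_deriv(1)[OF x] \<psi>_nz[OF x]]])
      (use \<psi>_nz[OF x] s_nz[OF x] in \<open>simp add: field_simps power2_eq_square\<close>)
  show "(\<theta> has_real_derivative \<theta>' x) (at x)"
    unfolding \<theta>_def[abs_def] \<theta>'_def
    by (rule DERIV_cong[OF DERIV_divide[OF DERIV_diff[OF DERIV_mult[OF \<psi>_deriv(1)[OF x] R'_deriv[OF x]]
          DERIV_mult[OF \<psi>_deriv(2)[OF x] R_deriv[OF x]]] s_deriv[OF x] s_nz[OF x]]])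
      (use \<sigma>_nz[OF x] s_nz[OF x] in \<open>simp add: field_simps power2_eq_square\<close>)
  {
    assume "x0 \<le> x"
    then show "\<theta>' x < 0"
      unfolding \<theta>'_def using R_neg[OF x] \<psi>_pos[OF x] s_pos[OF x] \<sigma>_nz[OF x]
      by (intro mult_pos_neg divide_pos_pos mult_pos_pos) auto
    show "\<rho> x < \<gamma> x"
      using R_less_G[OF x \<open>x0 \<le> x\<close>] \<psi>_pos[OF x] by (simp add: \<rho>_def \<gamma>_def divide_strict_right_mono)
  }
  fix y assume y: "y \<in> I" "x \<le> y"
  then show "\<delta> y \<le> \<delta> x" unfolding \<delta>_def using G_concave[OF x] by simp
next
  show "continuous_on I (\<lambda>x. s x / (\<psi> x)\<^sup>2)" "continuous_on I \<delta>"
    unfolding \<delta>_def using \<psi>_nz s_nz by (auto intro!: continuous_intros cont_on_I G'_cont)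
  show "continuous_on I \<theta>'"
    unfolding \<theta>'_def using s_nz \<sigma>_nz
    by (auto intro!: continuous_intros cont_on_I R''_cont \<mu>_cont \<sigma>_cont)
qed (use I_interval x0_in \<zeta>_derivative in auto)

text \<open>\<open>\<psi>\<close> and \<open>R\<close> have first-order contact at
  \<open>x0\<close>. Hence the tangent at \<open>x0\<close> is the constant 1, and
  \<open>\<psi>\<close> itself is the solution attached to that point.\<close>

lemma \<rho>_x0: "\<rho> x0 = 1" and \<theta>_x0: "\<theta> x0 = 0"
  using \<psi>_nz[OF x0_in] by (simp_all add: \<rho>_def \<theta>_def \<psi>_x0 \<psi>'_x0)

lemma \<rho>_\<psi>: "x \<in> I \<Longrightarrow> \<psi> x * \<rho> x = R x" and \<gamma>_\<psi>: "x \<in> I \<Longrightarrow> \<psi> x * \<gamma> x = G x"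
  using \<psi>_nz by (simp_all add: \<rho>_def \<gamma>_def)

text \<open>Dividing by \<open>\<psi>\<close> removes the term of order zero, and the scale
  \<open>\<zeta>\<close> removes the remaining first-order term; what is left of the equation says
  that a second derivative is 0.\<close>

lemma affine_harmonic:
  "harmonic_on I (\<lambda>x. \<psi> x * (A + B * \<zeta> x)) (\<lambda>x. \<psi>' x * (A + B * \<zeta> x) + B * s x / \<psi> x)"
  unfolding harmonic_on_def
proof (intro ballI conjI)
  fix x assume x: "x \<in> I"
  have z: "((\<lambda>x. A + B * \<zeta> x) has_real_derivative B * (s x / (\<psi> x)\<^sup>2)) (at x)"
    using \<zeta>_derivative[OF x] by (auto intro!: derivative_eq_intros)
  show "((\<lambda>x. \<psi> x * (A + B * \<zeta> x)) has_real_derivative \<psi>' x * (A + B * \<zeta> x) + B * s x / \<psi> x) (at x within I)"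
    unfolding at_within_open[OF x open_I]
    by (rule DERIV_cong[OF DERIV_mult[OF \<psi>_deriv(1)[OF x] z]])
      (use \<psi>_nz[OF x] in \<open>simp add: power2_eq_square\<close>)
  show "((\<lambda>x. \<psi>' x * (A + B * \<zeta> x) + B * s x / \<psi> x) has_real_derivative
      2 / (\<sigma> x)\<^sup>2 * (r * (\<psi> x * (A + B * \<zeta> x)) - \<mu> x * (\<psi>' x * (A + B * \<zeta> x) + B * s x / \<psi> x))) (at x within I)"
    unfolding at_within_open[OF x open_I]
    by (rule DERIV_cong[OF DERIV_add[OF DERIV_mult[OF \<psi>_deriv(2)[OF x] z]
            DERIV_divide[OF DERIV_cmult[OF s_deriv[OF x]] \<psi>_deriv(1)[OF x] \<psi>_nz[OF x]]]])
      (use \<psi>_nz[OF x] \<sigma>_nz[OF x] in \<open>simp add: field_simps power2_eq_square\<close>)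
qed

lemma tangent_harmonic:
  "harmonic_on I (\<lambda>x. \<psi> x * tangent x y) (\<lambda>x. \<psi>' x * tangent x y + \<theta> y * s x / \<psi> x)"
proof -
  have "tangent x y = (\<rho> y - \<theta> y * \<zeta> y) + \<theta> y * \<zeta> x" for x by (simp add: tangent_def algebra_simps)
  then show ?thesis using affine_harmonic[of "\<rho> y - \<theta> y * \<zeta> y" "\<theta> y"] by simp
qed

lemma tangent_self: "tangent y y = \<rho> y"
  by (simp add: tangent_def)

text \<open>Smooth fit: tangency of the quotients by \<open>\<psi>\<close> amounts to first-order
  contact with \<open>R\<close>.\<close>

lemma tangent_data:
  assumes "y \<in> I"
  shows "\<psi> y * tangent y y = R y" "\<psi>' y * tangent y y + \<theta> y * s y / \<psi> y = R' y"
  using \<psi>_nz[OF assms] s_nz[OF assms] by (auto simp: tangent_self \<rho>_def \<theta>_def field_simps)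

end

section \<open>From the variational system to the differential equation\<close>

lemma C21_on2_slice:
  assumes "C21_on2 A W"
  obtains v w where
    "\<And>x. (x, m) \<in> A \<Longrightarrow> ((\<lambda>y. W y m) has_real_derivative v x) (at x within {y. (y, m) \<in> A})"
    "\<And>x. (x, m) \<in> A \<Longrightarrow> (v has_real_derivative w x) (at x within {y. (y, m) \<in> A})"
    "continuous_on {y. (y, m) \<in> A} w"
proof -
  obtain Wx Wxx where W: "\<And>x m. (x, m) \<in> A \<Longrightarrow>
      ((\<lambda>y. W y m) has_real_derivative Wx x m) (at x within {y. (y, m) \<in> A}) \<and>
      ((\<lambda>y. Wx y m) has_real_derivative Wxx x m) (at x within {y. (y, m) \<in> A})"
    and c: "continuous_on A (\<lambda>(x, m). Wxx x m)"
    using assms unfolding C21_on2_def by blast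
  have "continuous_on {y. (y, m) \<in> A} (\<lambda>x. (\<lambda>(x, m). Wxx x m) (x, m))"
    by (rule continuous_on_compose2[OF c]) (auto intro!: continuous_intros)
  then show ?thesis using W by (intro that[of "\<lambda>x. Wx x m" "\<lambda>x. Wxx x m"]) auto
qed

lemma DERIV_within_unique:
  fixes f :: "real \<Rightarrow> real"
  assumes "(f has_real_derivative D) (at x within S)" "(f has_real_derivative D') (at x within S)"
    and S: "is_interval S" "x \<in> S" "y \<in> S" "x \<noteq> y"
  shows "D = D'"
proof -
  have "x islimpt S"
    using connected_imp_perfect[of S x] S by (metis is_interval_connected_1 singletonD)
  then have "at x within S \<noteq> bot" by (simp add: trivial_limit_within)
  then show ?thesis
    using assms(1,2) unfolding has_field_derivative_iff by (rule tendsto_unique)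
qed

context diffusion_operator
begin

text \<open>\<open>E\<close> collects the end points of a slice, where \<open>generator\<close> says
  nothing about one-sided derivatives. The second derivative is continuous up to them, so the
  equation persists.\<close>

lemma slice_harmonic:
  assumes J: "is_interval J" "J \<subseteq> I" "p \<in> J" "q \<in> J" "p \<noteq> q" and E: "finite E"
    and u: "\<And>x. x \<in> J \<Longrightarrow> (u has_real_derivative v x) (at x within J)"
    and v: "\<And>x. x \<in> J \<Longrightarrow> (v has_real_derivative w x) (at x within J)"
    and w: "continuous_on J w"
    and gen: "\<And>x. x \<in> J \<Longrightarrow> x \<notin> E \<Longrightarrow> x \<in> interior J \<and> generator \<mu> \<sigma> u x - r * u x = 0"
  shows "harmonic_on J u v"
proof -
  let ?g = "\<lambda>x. w x - 2 / (\<sigma> x)\<^sup>2 * (r * u x - \<mu> x * v x)"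
  have "?g x = 0" if "x \<in> J" "x \<notin> E" for x
  proof -
    have x: "x \<in> interior J" "x \<in> I" using gen[OF that] that J(2) by auto
    have "generator \<mu> \<sigma> u x = \<mu> x * v x + (\<sigma> x)\<^sup>2 / 2 * w x"
    proof (rule generator_eq[OF open_interior x(1)])
      show "(u has_real_derivative v y) (at y)" if "y \<in> interior J" for y
        using u[OF subsetD[OF interior_subset that]] unfolding at_within_interior[OF that] .
      show "(v has_real_derivative w x) (at x)"
        using v[OF \<open>x \<in> J\<close>] unfolding at_within_interior[OF x(1)] .
    qed
    then show ?thesis using gen[OF that] \<sigma>_nz[OF x(2)] by (simp add: field_simps)
  qed
  moreover have "continuous_on J ?g"
    using J(2) \<sigma>_nz
    by (intro continuous_intros w DERIV_continuous_on[OF u] DERIV_continuous_on[OF v]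
        continuous_on_subset[OF \<sigma>_cont] continuous_on_subset[OF \<mu>_cont]) auto
  ultimately have "?g x = 0" if "x \<in> J" for x
    using zero_except_finite[OF J(1,3,4,5) _ E, of ?g x] that by blast
  then show ?thesis unfolding harmonic_on_def using u v by simp
qed

text \<open>The decay of \<open>\<psi>\<close> at \<open>\<alpha>\<close> is inherited from
  \<open>W\<close>. The slice \<open>m = m0\<close> serves because \<open>b m0 = x0\<close>: there
  smooth fit prescribes value and slope of \<open>W\<close> at \<open>x0\<close>, so to the left of
  \<open>x0\<close> the slice is \<open>(1 - F m0) * \<psi>\<close>.\<close>

lemma left_solution:
  assumes vs: "variational_system r \<alpha> \<beta> \<mu> \<sigma> R x0 G F f m0 b W"
    and vr: "variational_regularity \<alpha> \<beta> x0 m0 b W"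
    and x0: "x0 \<in> I" and F: "F m0 < 1"
  obtains \<psi> \<psi>' where "harmonic_on I \<psi> \<psi>'" "\<psi> x0 = R x0" "\<psi>' x0 = deriv R x0"
    "\<And>e. 0 < e \<Longrightarrow> \<exists>n\<in>I. \<forall>x\<in>I. x < n \<longrightarrow> \<bar>\<psi> x\<bar> < e"
proof -
  have m0: "x0 < m0" "ereal m0 < \<beta>" "b m0 = x0" using vs by (auto simp: variational_system_def)
  have m0I: "m0 \<in> I" using m0 x0 less_trans[of \<alpha> "ereal x0" "ereal m0"] by (simp add: einterval_iff)
  let ?A = "{(x, m) \<in> state_set \<alpha> \<beta>. m0 \<le> m \<and> x \<le> x0}"
  let ?J = "{x \<in> I. x \<le> x0}"
  let ?S = "1 - F m0"
  have J: "{y. (y, m0) \<in> ?A} = ?J" using m0 m0I by (auto simp: state_set_def)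
  have Ji: "is_interval ?J"
    using is_interval_Int[OF I_interval is_interval_ic[of x0]] by (simp add: Int_def)
  have intJ: "x \<in> interior ?J" if "x \<in> I" "x < x0" for x
    by (rule interiorI[of "I \<inter> {..<x0}"]) (use that in auto)
  obtain y where y: "y \<in> I" "y < x0"
  proof -
    have "\<alpha> < ereal x0" using x0 by (simp add: einterval_iff)
    then obtain y where "\<alpha> < ereal y" "ereal y < ereal x0" using ereal_dense2 by blast
    then show ?thesis using that[of y] x0 less_trans[of "ereal y" "ereal x0" \<beta>] by (auto simp: einterval_iff)
  qed
  have "C21_on2 ?A W" using vr by (simp add: variational_regularity_def)
  then obtain v w where d:
    "\<And>x. (x, m0) \<in> ?A \<Longrightarrow> ((\<lambda>y. W y m0) has_real_derivative v x) (at x within {y. (y, m0) \<in> ?A})"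
    "\<And>x. (x, m0) \<in> ?A \<Longrightarrow> (v has_real_derivative w x) (at x within {y. (y, m0) \<in> ?A})"
    "continuous_on {y. (y, m0) \<in> ?A} w"
    using C21_on2_slice by blast
  have mem: "(x, m0) \<in> ?A \<longleftrightarrow> x \<in> ?J" for x using J by blast
  note d' = d[unfolded J, unfolded mem]
  have "harmonic_on ?J (\<lambda>x. W x m0) v"
  proof (rule slice_harmonic[OF Ji, of y x0 "{x0}" _ v w])
    fix x assume x: "x \<in> ?J" "x \<notin> {x0}"
    then have xx: "x \<in> I" "x < x0" by auto
    \<comment> \<open>A rectangle to the left of \<open>x0\<close> in the first coordinate and to
      the right of it in the second: it lies in the state set and misses the stopping set.\<close>
    let ?O = "((I \<inter> {..<x0}) \<times> (I \<inter> {x0<..}))"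
    have "(x, m0) \<in> interior (state_set \<alpha> \<beta> - stopping_set \<alpha> \<beta> x0 m0 b)"
      by (rule interiorI[of ?O]) (use xx m0 m0I in \<open>auto intro!: open_Times simp: state_set_def stopping_set_def\<close>)
    then have "generator \<mu> \<sigma> (\<lambda>y. W y m0) x - r * W x m0 = 0"
      using vs unfolding variational_system_def by blast
    then show "x \<in> interior ?J \<and> generator \<mu> \<sigma> (\<lambda>y. W y m0) x - r * W x m0 = 0"
      using intJ xx by blast
  qed (use d' x0 y in auto)
  moreover obtain \<psi> \<psi>' where \<psi>: "harmonic_on I \<psi> \<psi>'" "\<psi> x0 = R x0" "\<psi>' x0 = deriv R x0"
    using harmonic_exists[OF x0] by blast
  moreover have "harmonic_on ?J (\<lambda>x. ?S * \<psi> x) (\<lambda>x. ?S * \<psi>' x)"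
    by (intro harmonic_on_scale harmonic_on_subset[OF \<psi>(1)]) auto
  moreover have "W x0 m0 = ?S * \<psi> x0"
  proof -
    have "(x0, m0) \<in> stopping_set \<alpha> \<beta> x0 m0 b" using m0 x0 m0I by (auto simp: stopping_set_def state_set_def)
    then show ?thesis using vs \<psi>(2) unfolding variational_system_def by force
  qed
  moreover have "v x0 = ?S * \<psi>' x0"
  proof (rule DERIV_within_unique[where y = y, OF d'(1) _ Ji])
    show "((\<lambda>y. W y m0) has_real_derivative ?S * \<psi>' x0) (at x0 within ?J)"
      using vs m0 \<psi>(3) unfolding variational_system_def by (auto intro: has_field_derivative_at_within)
  qed (use x0 y in auto)
  ultimately have W: "W x m0 = ?S * \<psi> x" if "x \<in> I" "x \<le> x0" for x
    using harmonic_unique(1)[OF Ji _ _ _ _ _, of x0 x "\<lambda>x. W x m0" v "\<lambda>x. ?S * \<psi> x" "\<lambda>x. ?S * \<psi>' x"] that x0 by auto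
  have "((\<lambda>x. W (real_of_ereal x) m0) \<longlongrightarrow> 0) (at_right \<alpha>)"
    using vs m0I unfolding variational_system_def by blast
  then have lim: "\<exists>n\<in>I. \<forall>x\<in>I. x < n \<longrightarrow> \<bar>W x m0\<bar> < e" if "0 < e" for e
    using tendsto_at_right_ereal_iff[OF \<alpha>\<beta>, of "\<lambda>x. W x m0"] that by blast
  have "\<exists>n\<in>I. \<forall>x\<in>I. x < n \<longrightarrow> \<bar>\<psi> x\<bar> < e" if e: "0 < e" for e
  proof -
    obtain n where n: "n \<in> I" "\<And>x. x \<in> I \<Longrightarrow> x < n \<Longrightarrow> \<bar>W x m0\<bar> < ?S * e"
      using lim[of "?S * e"] e F by auto
    have "\<bar>\<psi> x\<bar> < e" if "x \<in> I" "x < min n x0" for x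
    proof -
      have "?S * \<bar>\<psi> x\<bar> < ?S * e" using n(2)[of x] W[of x] that F by (simp add: abs_mult)
      then show ?thesis using F by simp
    qed
    moreover have "min n x0 \<in> I" using n x0 by (simp add: min_def)
    ultimately show ?thesis by blast
  qed
  then show ?thesis using that \<psi> by blast
qed

end

context stopping_problem
begin

text \<open>On the slice above the boundary, \<open>W\<close> is determined by its value and its derivative at the boundary.\<close>

lemma slice_above_boundary:
  assumes vs: "variational_system r \<alpha> \<beta> \<mu> \<sigma> R x0 G F f m0 b W"
    and vr: "variational_regularity \<alpha> \<beta> x0 m0 b W"
    and m: "m \<in> I" "m0 \<le> m" and x: "b m \<le> x" "x \<le> m"
  shows "W x m = (1 - F m) * (\<psi> x * tangent x (b m))"
proof -
  have sys: "x0 < m0" "ereal m0 < \<beta>" "b m0 = x0" using vs by (auto simp: variational_system_def)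
  have m0I: "m0 \<in> I" using I_between[OF x0_in m(1)] sys m by auto
  have b: "x0 \<le> b n" "b n < n" "b n \<in> I" if "n \<in> I" "m0 \<le> n" for n
  proof -
    show "x0 \<le> b n" "b n < n" using vs that unfolding variational_system_def einterval_iff by blast+
    then show "b n \<in> I" using I_between[OF x0_in that(1), of "b n"] by simp
  qed
  obtain b' where b': "\<And>n. n \<in> I \<Longrightarrow> m0 \<le> n \<Longrightarrow> (b has_real_derivative b' n) (at n within {m. m0 \<le> m \<and> ereal m < \<beta>})"
    using vr unfolding variational_regularity_def C1_on_def by (auto simp: einterval_iff)
  let ?A = "{(x, m) \<in> state_set \<alpha> \<beta>. m0 \<le> m \<and> b m \<le> x}"
  let ?J = "{b m..m}"
  let ?S = "1 - F m"
  have Jsub: "?J \<subseteq> I" by (rule interval_Icc_subset[OF I_interval b(3)[OF m] m(1)])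
  have J: "{y. (y, m) \<in> ?A} = ?J" using m Jsub by (auto simp: state_set_def)
  have "C21_on2 ?A W" using vr by (simp add: variational_regularity_def)
  then obtain v w where d:
    "\<And>x. (x, m) \<in> ?A \<Longrightarrow> ((\<lambda>y. W y m) has_real_derivative v x) (at x within {y. (y, m) \<in> ?A})"
    "\<And>x. (x, m) \<in> ?A \<Longrightarrow> (v has_real_derivative w x) (at x within {y. (y, m) \<in> ?A})"
    "continuous_on {y. (y, m) \<in> ?A} w"
    using C21_on2_slice by blast
  have mem: "(x, m) \<in> ?A \<longleftrightarrow> x \<in> ?J" for x using J by blast
  note d' = d[unfolded J, unfolded mem]
  have bc: "continuous_on {m. m0 \<le> m \<and> ereal m < \<beta>} b"
    using vr unfolding variational_regularity_def C1_on_def using DERIV_continuous_on by blast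
  have 1: "harmonic_on ?J (\<lambda>x. W x m) v"
  proof (rule slice_harmonic[OF is_interval_cc Jsub, of "b m" m "{b m, m}" _ v w])
    fix x assume x: "x \<in> ?J" "x \<notin> {b m, m}"
    then have xx: "b m < x" "x < m" by auto
    \<comment> \<open>\<open>max m0\<close> continues \<open>b\<close> by a constant below
      \<open>m0\<close>, so that the points above the boundary form an open set also around the
      slice \<open>m = m0\<close>.\<close>
    let ?B = "\<lambda>p::real \<times> real. fst p - b (max m0 (snd p))"
    let ?O = "(I \<times> I) \<inter> ?B -` {0<..} \<inter> {p. fst p < snd p}"
    have "continuous_on (I \<times> I) ?B"
      by (intro continuous_intros continuous_on_compose2[OF bc])
        (use m0I in \<open>auto simp: einterval_iff max_def\<close>)
    then have "open ((I \<times> I) \<inter> ?B -` {0<..})"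
      by (rule continuous_open_preimage) (auto intro!: open_Times)
    moreover have "open {p::real \<times> real. fst p < snd p}"
      by (intro open_Collect_less continuous_intros)
    ultimately have "open ?O" by (rule open_Int)
    moreover have "(x, m) \<in> ?O" using xx x Jsub m by (auto simp: max_absorb2)
    moreover have "?O \<subseteq> state_set \<alpha> \<beta> - stopping_set \<alpha> \<beta> x0 m0 b"
      by (auto simp: state_set_def stopping_set_def max_absorb2)
    ultimately have "(x, m) \<in> interior (state_set \<alpha> \<beta> - stopping_set \<alpha> \<beta> x0 m0 b)" by (rule interiorI)
    then have "generator \<mu> \<sigma> (\<lambda>y. W y m) x - r * W x m = 0"
      using vs unfolding variational_system_def by blast
    then show "x \<in> interior ?J \<and> generator \<mu> \<sigma> (\<lambda>y. W y m) x - r * W x m = 0"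
      using xx by simp
  qed (use d' b(2)[OF m] in auto)
  have 2: "harmonic_on ?J (\<lambda>x. ?S * (\<psi> x * tangent x (b m))) (\<lambda>x. ?S * (\<psi>' x * tangent x (b m) + \<theta> (b m) * s x / \<psi> x))"
    by (intro harmonic_on_scale harmonic_on_subset[OF tangent_harmonic Jsub])
  have 3: "W (b m) m = ?S * (\<psi> (b m) * tangent (b m) (b m))"
  proof -
    have "(b m, m) \<in> stopping_set \<alpha> \<beta> x0 m0 b"
      using b[OF m] m by (auto simp: stopping_set_def state_set_def)
    then show ?thesis using vs tangent_data(1)[OF b(3)[OF m]] unfolding variational_system_def by force
  qed
  have 4: "v (b m) = ?S * (\<psi>' (b m) * tangent (b m) (b m) + \<theta> (b m) * s (b m) / \<psi> (b m))"
  proof (rule DERIV_within_unique[OF d'(1) _ is_interval_cc, of _ _ m])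
    have "((\<lambda>y. W y m) has_real_derivative ?S * deriv R (b m)) (at (b m))"
      using vs m unfolding variational_system_def by (auto simp: einterval_iff)
    then show "((\<lambda>y. W y m) has_real_derivative ?S * (\<psi>' (b m) * tangent (b m) (b m) + \<theta> (b m) * s (b m) / \<psi> (b m)))
        (at (b m) within ?J)"
      unfolding tangent_data(2)[OF b(3)[OF m]] DERIV_imp_deriv[OF R_deriv[OF b(3)[OF m]]]
      by (rule has_field_derivative_at_within)
  qed (use b[OF m] in auto)
  show ?thesis
    using harmonic_unique(1)[where u = "\<lambda>x. W x m" and v = v
        and u' = "\<lambda>x. ?S * (\<psi> x * tangent x (b m))"
        and v' = "\<lambda>x. ?S * (\<psi>' x * tangent x (b m) + \<theta> (b m) * s x / \<psi> x)"
        and a = "b m" and x = x, OF is_interval_cc Jsub _ _ 1 2 3 4] b(2)[OF m] x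
    by simp
qed

text \<open>For \<open>n\<close> slightly above \<open>m\<close>, the value \<open>W m n\<close> is
  \<open>(1 - F n) * (\<psi> m * tangent m (b n))\<close>. Its right derivative at
  \<open>n = m\<close> is also prescribed by the condition on the diagonal; solving for the slope of
  \<open>b\<close> gives the equation.\<close>

theorem system_imp_free_boundary:
  assumes vs: "variational_system r \<alpha> \<beta> \<mu> \<sigma> R x0 G F f m0 b W"
    and vr: "variational_regularity \<alpha> \<beta> x0 m0 b W"
    and F_deriv: "\<And>m. m \<in> I \<Longrightarrow> (F has_real_derivative f m) (at m)"
    and F_less: "\<And>m. m \<in> I \<Longrightarrow> F m < 1"
  shows "free_boundary (\<lambda>m. f m / (1 - F m)) m0 b"
proof -
  have sys: "x0 < m0" "ereal m0 < \<beta>" "b m0 = x0"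
    "((\<lambda>m. ereal (b (real_of_ereal m))) \<longlongrightarrow> \<beta>) (at_left \<beta>)"
    using vs by (auto simp: variational_system_def)
  have m0I: "m0 \<in> I" using sys x0_in less_trans[of \<alpha> "ereal x0" "ereal m0"] by (simp add: einterval_iff)
  have b: "x0 \<le> b n" "b n < n" "b n \<in> I" if "n \<in> I" "m0 \<le> n" for n
  proof -
    show "x0 \<le> b n" "b n < n" using vs that unfolding variational_system_def einterval_iff by blast+
    then show "b n \<in> I" using I_between[OF x0_in that(1), of "b n"] by simp
  qed
  have dom: "{m. m0 \<le> m \<and> ereal m < \<beta>} = {m \<in> I. m0 \<le> m}"
    using m0I by (auto simp: einterval_iff intro: less_le_trans[of \<alpha> "ereal m0"])
  obtain b' where b': "\<And>n. n \<in> I \<Longrightarrow> m0 \<le> n \<Longrightarrow> (b has_real_derivative b' n) (at n within {m \<in> I. m0 \<le> m})"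
    using vr unfolding variational_regularity_def C1_on_def dom by blast
  have slope: "b' m = f m / (1 - F m) / inverse_slope m (b m)" if m: "m \<in> I" "m0 \<le> m" for m
  proof -
    let ?A = "{n \<in> I. m \<le> n}"
    define k where "k = - \<theta>' (b m) * (\<zeta> m - \<zeta> (b m))"
    have k: "0 < k" unfolding k_def using b[OF m] \<theta>'_neg[of "b m"] \<zeta>_less[of "b m" m] m by (intro mult_pos_pos) auto
    have bd: "(b has_real_derivative b' m) (at m within ?A)"
      by (rule DERIV_subset[OF b'[OF m]]) (use m in auto)
    have "(b \<longlongrightarrow> b m) (at m within ?A)"
      using DERIV_continuous[OF bd] by (simp add: continuous_within)
    \<comment> \<open>The formula for \<open>W m n\<close> is valid only as long as \<open>m\<close>
      is not below \<open>b n\<close>; by continuity this holds near \<open>m\<close>, since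
      \<open>b m < m\<close>.\<close>
    then have "\<forall>\<^sub>F n in at m within ?A. b n < m" using b(2)[OF m] by (rule order_tendstoD)
    then obtain e where e: "e > 0" "\<And>n. n \<in> ?A \<Longrightarrow> dist n m < e \<Longrightarrow> b n \<le> m"
      unfolding eventually_at using b(2)[OF m] by (metis less_imp_le)
    have eq: "(1 - F n) * (\<psi> m * tangent m (b n)) = W m n" if "n \<in> ?A" "dist n m < e" for n
      using slice_above_boundary[OF vs vr, of n m] e(2)[OF that] that m by auto
    have Td: "((\<lambda>n. tangent m (b n)) has_real_derivative - k * b' m) (at m within ?A)"
      by (rule DERIV_cong[OF DERIV_chain2[OF tangent_deriv_left[OF b(3)[OF m]] bd]]) (simp add: k_def)
    have "((\<lambda>n. (1 - F n) * (\<psi> m * tangent m (b n))) has_real_derivative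
        (- f m) * (\<psi> m * tangent m (b m)) + (\<psi> m * (- k * b' m)) * (1 - F m)) (at m within ?A)"
      by (rule DERIV_mult[OF _ DERIV_cmult[OF Td]])
        (use has_field_derivative_at_within[OF F_deriv[OF m(1)]] in \<open>auto intro!: derivative_eq_intros\<close>)
    then have "((\<lambda>n. W m n) has_real_derivative
        (- f m) * (\<psi> m * tangent m (b m)) + (\<psi> m * (- k * b' m)) * (1 - F m)) (at m within ?A)"
      by (rule has_field_derivative_transform_within[OF _ e(1)]) (use eq m in auto)
    moreover have "((\<lambda>n. W m n) has_real_derivative - f m * G m) (at m within ?A)"
    proof -
      have "\<forall>m\<in>I. ((\<lambda>n. W m n) has_real_derivative - f m * G m) (at m within {m..})"
        using vs unfolding variational_system_def by (elim conjE)
      then have "((\<lambda>n. W m n) has_real_derivative - f m * G m) (at m within {m..})"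
        using m(1) by (rule bspec)
      then show ?thesis by (rule DERIV_subset) auto
    qed
    moreover obtain n where "n \<in> ?A" "m \<noteq> n"
    proof -
      obtain d where d: "d > 0" "ball m d \<subseteq> I" using open_I m(1) open_contains_ball by blast
      then have "m + d / 2 \<in> I" by (auto simp: dist_real_def subset_iff)
      then show ?thesis using that[of "m + d / 2"] d(1) by auto
    qed
    ultimately have "(- f m) * (\<psi> m * tangent m (b m)) + (\<psi> m * (- k * b' m)) * (1 - F m) = - f m * G m"
      using DERIV_within_unique[OF _ _ interval_above[of m]] m(1) by auto
    then have "\<psi> m * ((1 - F m) * (k * b' m)) = \<psi> m * (f m * (\<gamma> m - tangent m (b m)))"
      unfolding \<gamma>_\<psi>[OF m(1), symmetric] by (simp add: algebra_simps)
    then have "(1 - F m) * (k * b' m) = f m * (\<gamma> m - tangent m (b m))"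
      using \<psi>_nz[OF m(1)] by simp
    then have "b' m * ((1 - F m) * k) = f m * (\<gamma> m - tangent m (b m))"
      by (simp only: mult.commute mult.left_commute)
    moreover have "(1 - F m) * k \<noteq> 0" using k F_less[OF m(1)] by simp
    ultimately have "b' m = f m * (\<gamma> m - tangent m (b m)) / ((1 - F m) * k)"
      by (intro eq_divide_imp)
    then show ?thesis by (simp add: inverse_slope_def k_def)
  qed
  have lim: "\<forall>y\<in>I. \<exists>n\<in>I. \<forall>m\<in>I. n \<le> m \<longrightarrow> y \<le> b m"
    using tendsto_at_left_ereal_iff[OF \<alpha>\<beta> m0I, of b] b(3) sys(4) by blast
  show ?thesis
    unfolding free_boundary_def using m0I sys b b' slope lim by simp
qed

end

section \<open>From the differential equation to the variational system\<close>

lemma has_real_derivative_split: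
  fixes f :: "real \<Rightarrow> real"
  assumes "(f has_real_derivative D) (at x within {..x})" "(f has_real_derivative D) (at x within {x..})"
  shows "(f has_real_derivative D) (at x)"
proof -
  have "(f has_real_derivative D) (at_left x)" "(f has_real_derivative D) (at_right x)"
    by (rule DERIV_subset[OF assms(1)], force) (rule DERIV_subset[OF assms(2)], force)
  then show ?thesis unfolding has_field_derivative_iff by (simp add: filterlim_at_split)
qed

text \<open>In direction \<open>x\<close> each piece of the candidate extends smoothly across the
  boundary of \<open>A\<close>, so ordinary derivatives of \<open>\<Phi>\<close> yield the one-sided
  ones. In direction \<open>m\<close> this fails at \<open>m0\<close>, where \<open>b\<close>
  starts; hence the derivative within the slice.\<close>

lemma C21_on2I:
  assumes eq: "\<And>x m. (x, m) \<in> A \<Longrightarrow> V x m = \<Phi> x m"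
    and x: "\<And>x m. (x, m) \<in> A \<Longrightarrow> ((\<lambda>y. \<Phi> y m) has_real_derivative \<Phi>x x m) (at x)"
    and xx: "\<And>x m. (x, m) \<in> A \<Longrightarrow> ((\<lambda>y. \<Phi>x y m) has_real_derivative \<Phi>xx x m) (at x)"
    and m: "\<And>x m. (x, m) \<in> A \<Longrightarrow> ((\<lambda>n. \<Phi> x n) has_real_derivative \<Phi>m x m) (at m within {n. (x, n) \<in> A})"
    and c: "continuous_on A (\<lambda>p. \<Phi>x (fst p) (snd p))" "continuous_on A (\<lambda>p. \<Phi>xx (fst p) (snd p))"
      "continuous_on A (\<lambda>p. \<Phi>m (fst p) (snd p))"
  shows "C21_on2 A V"
proof -
  have "((\<lambda>y. V y m) has_real_derivative \<Phi>x x m) (at x within {y. (y, m) \<in> A})"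
    "((\<lambda>y. \<Phi>x y m) has_real_derivative \<Phi>xx x m) (at x within {y. (y, m) \<in> A})"
    "((\<lambda>n. V x n) has_real_derivative \<Phi>m x m) (at m within {n. (x, n) \<in> A})" if "(x, m) \<in> A" for x m
    by (rule has_field_derivative_transform_within[OF has_field_derivative_at_within[OF x[OF that]] zero_less_one],
        use that eq in simp_all)
      (rule has_field_derivative_at_within[OF xx[OF that]],
       rule has_field_derivative_transform_within[OF m[OF that] zero_less_one], use that eq in simp_all)
  then show ?thesis
    unfolding C21_on2_def using c
    by (intro exI[of _ \<Phi>x] exI[of _ \<Phi>xx] exI[of _ \<Phi>m]) (auto simp: split_beta)
qed

section \<open>Tangents with a clipped point of contact\<close>

context stopping_problem
begin

text \<open>One formula for the three parts of a slice with boundary \<open>k\<close>: the point of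
  contact is \<open>x\<close>, clipped to \<open>[x0, k]\<close>. Times \<open>\<psi>\<close> it
  equals \<open>\<psi>\<close> to the left of \<open>x0\<close>, the payoff \<open>R\<close> up to
  \<open>k\<close>, and the solution in smooth fit with \<open>R\<close> at \<open>k\<close>
  beyond.\<close>

definition capped_tangent :: "real \<Rightarrow> real \<Rightarrow> real" where
  "capped_tangent x k = tangent x (min k (max x x0))"

lemma tangent_x0: "tangent x x0 = 1"
  by (simp add: tangent_def \<rho>_x0 \<theta>_x0)

lemma capped_tangent_left: "x \<le> x0 \<Longrightarrow> x0 \<le> k \<Longrightarrow> capped_tangent x k = 1"
  by (simp add: capped_tangent_def max_absorb2 min_absorb2 tangent_x0)

lemma capped_tangent_middle: "x0 \<le> x \<Longrightarrow> x \<le> k \<Longrightarrow> capped_tangent x k = \<rho> x"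
  by (simp add: capped_tangent_def max_absorb1 min_absorb2 tangent_self)

lemma capped_tangent_right: "x0 \<le> k \<Longrightarrow> k \<le> x \<Longrightarrow> capped_tangent x k = tangent x k"
  by (simp add: capped_tangent_def max_absorb1 min_absorb1)

text \<open>A moving contact point does not contribute to first order, so the derivative is the
  slope at the clipped point. At \<open>x0\<close> and \<open>k\<close>, where two formulas meet,
  the one-sided derivatives are computed separately.\<close>

lemma capped_tangent_deriv:
  assumes x: "x \<in> I" and k: "x0 \<le> k"
  shows "((\<lambda>x. capped_tangent x k) has_real_derivative \<theta> (min k (max x x0)) * (s x / (\<psi> x)\<^sup>2)) (at x)"
proof (rule has_real_derivative_split)
  have r: "(\<rho> has_real_derivative \<theta> x * (s x / (\<psi> x)\<^sup>2)) (at x within S)" for S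
    by (rule has_field_derivative_at_within[OF \<rho>_deriv[OF x]])
  have t: "((\<lambda>x. tangent x y) has_real_derivative \<theta> y * (s x / (\<psi> x)\<^sup>2)) (at x within S)" for y S
    by (rule has_field_derivative_at_within[OF tangent_deriv_right[OF x]])
  show "((\<lambda>x. capped_tangent x k) has_real_derivative \<theta> (min k (max x x0)) * (s x / (\<psi> x)\<^sup>2)) (at x within {..x})"
  proof -
    consider "x \<le> x0" | "x0 < x" "x \<le> k" | "k < x" by linarith
    then show ?thesis
    proof cases
      case 1
      show ?thesis
        by (rule has_field_derivative_transform_within[OF _ zero_less_one, of "\<lambda>y. tangent y x0"])
          (use 1 k t[of x0] in \<open>auto simp: tangent_x0 capped_tangent_left max_absorb2 min_absorb2\<close>)
    next
      case 2
      show ?thesis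
        by (rule has_field_derivative_transform_within[of \<rho> _ _ _ "x - x0"])
          (use 2 r in \<open>auto simp: capped_tangent_middle max_absorb1 min_absorb2 dist_real_def\<close>)
    next
      case 3
      show ?thesis
        by (rule has_field_derivative_transform_within[of "\<lambda>y. tangent y k" _ _ _ "x - k"])
          (use 3 k t[of k] in \<open>auto simp: capped_tangent_right max_absorb1 min_absorb1 dist_real_def\<close>)
    qed
  qed
  show "((\<lambda>x. capped_tangent x k) has_real_derivative \<theta> (min k (max x x0)) * (s x / (\<psi> x)\<^sup>2)) (at x within {x..})"
  proof -
    consider "x < x0" | "x0 \<le> x" "x < k" | "k \<le> x" by linarith
    then show ?thesis
    proof cases
      case 1
      show ?thesis
        by (rule has_field_derivative_transform_within[of "\<lambda>y. tangent y x0" _ _ _ "x0 - x"])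
          (use 1 k t[of x0] in \<open>auto simp: tangent_x0 capped_tangent_left max_absorb2 min_absorb2 dist_real_def\<close>)
    next
      case 2
      show ?thesis
        by (rule has_field_derivative_transform_within[of \<rho> _ _ _ "k - x"])
          (use 2 r in \<open>auto simp: capped_tangent_middle max_absorb1 min_absorb2 dist_real_def\<close>)
    next
      case 3
      show ?thesis
        by (rule has_field_derivative_transform_within[OF _ zero_less_one, of "\<lambda>y. tangent y k"])
          (use 3 k t[of k] in \<open>auto simp: capped_tangent_right max_absorb1 min_absorb1\<close>)
    qed
  qed
qed

text \<open>Points with \<open>x \<le> k\<close> do not feel the boundary; the maximum makes the
  derivative 0 for them and joins the cases continuously at \<open>k = x\<close>.\<close>

lemma capped_tangent_deriv_boundary:
  assumes k: "k \<in> I" "x0 \<le> k"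
  shows "((\<lambda>k. capped_tangent x k) has_real_derivative \<theta>' k * (\<zeta> (max x k) - \<zeta> k)) (at k within {x0..})"
proof (cases "x \<le> x0")
  case True
  show ?thesis
    by (rule has_field_derivative_transform_within[OF _ zero_less_one, of "\<lambda>_. 1"])
      (use k True in \<open>auto simp: capped_tangent_left max_absorb2\<close>)
next
  case False
  have t: "((\<lambda>y. tangent x y) has_real_derivative \<theta>' k * (\<zeta> x - \<zeta> k)) (at k within S)" for S
    by (rule has_field_derivative_at_within[OF tangent_deriv_left[OF k(1)]])
  have "((\<lambda>k. tangent x (min k x)) has_real_derivative \<theta>' k * (\<zeta> (max x k) - \<zeta> k)) (at k)"
  proof (rule has_real_derivative_split)
    show "((\<lambda>k. tangent x (min k x)) has_real_derivative \<theta>' k * (\<zeta> (max x k) - \<zeta> k)) (at k within {..k})"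
    proof (cases "k \<le> x")
      case True
      show ?thesis
        by (rule has_field_derivative_transform_within[OF _ zero_less_one, of "\<lambda>y. tangent x y"])
          (use t True in \<open>auto simp: max_absorb1 min_absorb1\<close>)
    next
      case False
      show ?thesis
        by (rule has_field_derivative_transform_within[of "\<lambda>_. tangent x x" _ _ _ "k - x"])
          (use False in \<open>auto simp: max_absorb2 min_absorb2 dist_real_def\<close>)
    qed
    show "((\<lambda>k. tangent x (min k x)) has_real_derivative \<theta>' k * (\<zeta> (max x k) - \<zeta> k)) (at k within {k..})"
    proof (cases "k < x")
      case True
      show ?thesis
        by (rule has_field_derivative_transform_within[of "\<lambda>y. tangent x y" _ _ _ "x - k"])
          (use t True in \<open>auto simp: max_absorb1 min_absorb1 dist_real_def\<close>)
    next
      case False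
      show ?thesis
        by (rule has_field_derivative_transform_within[OF _ zero_less_one, of "\<lambda>_. tangent x x"])
          (use False in \<open>auto simp: max_absorb2 min_absorb2\<close>)
    qed
  qed
  then show ?thesis
    using False by (simp add: capped_tangent_def max_absorb1 has_field_derivative_at_within)
qed

lemma generator_zero:
  assumes "harmonic_on I u v" "open U" "x \<in> U" "U \<subseteq> I" "\<And>y. y \<in> U \<Longrightarrow> w y = u y"
  shows "generator \<mu> \<sigma> w x - r * w x = 0"
proof -
  have d: "(u has_real_derivative v y) (at y)"
    "(v has_real_derivative 2 / (\<sigma> y)\<^sup>2 * (r * u y - \<mu> y * v y)) (at y)" if "y \<in> U" for y
    using harmonic_onD[OF assms(1), of y] that assms(4) at_within_I by auto
  have "generator \<mu> \<sigma> w x = \<mu> x * v x + (\<sigma> x)\<^sup>2 / 2 * (2 / (\<sigma> x)\<^sup>2 * (r * u x - \<mu> x * v x))"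
  proof (rule generator_eq[OF assms(2,3) _ d(2)[OF assms(3)]])
    show "(w has_real_derivative v y) (at y)" if "y \<in> U" for y
      by (rule has_field_derivative_transform_within_open[OF d(1)[OF that] assms(2) that]) (simp add: assms(5))
  qed
  moreover have "\<sigma> x \<noteq> 0" using \<sigma>_nz[of x] assms by auto
  ultimately show ?thesis using assms(5)[OF assms(3)] by (simp add: field_simps)
qed

end

section \<open>The candidate value function and its derivatives\<close>

locale boundary_solution = stopping_problem +
  fixes F f b H :: "real \<Rightarrow> real" and m0 :: real
  assumes F_deriv: "m \<in> I \<Longrightarrow> (F has_real_derivative f m) (at m)"
    and F_less: "m \<in> I \<Longrightarrow> F m < 1"
    and f_pos: "m \<in> I \<Longrightarrow> 0 < f m" and f_cont: "continuous_on I f"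
    and fb: "free_boundary (\<lambda>m. f m / (1 - F m)) m0 b"
    and H_deriv: "m \<in> I \<Longrightarrow> (H has_real_derivative f m * \<gamma> m) (at m)" and H_m0: "H m0 = 0"
begin

text \<open>For \<open>m \<ge> m0\<close> this is \<open>1 - F m\<close>. Below \<open>m0\<close>
  nothing is stopped, the candidate is a multiple \<open>c m\<close> of \<open>\<psi>\<close>, and
  the condition on the diagonal demands that \<open>c\<close> have the derivative
  \<open>- f m * \<gamma> m\<close>; with \<open>H m0 = 0\<close> the two parts match at
  \<open>m0\<close>.\<close>

definition "weight m = 1 - F (max m m0) - H (min m m0)"
text \<open>For \<open>m \<le> m0\<close> the boundary is frozen at \<open>b m0 = x0\<close>, where
  the capped tangent is constantly 1.\<close>

definition "V x m = weight m * (\<psi> x * capped_tangent x (b (max m m0)))"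
definition "b' m = f m / (1 - F m) / inverse_slope m (b m)"

lemma m0: "m0 \<in> I" "x0 < m0" "b m0 = x0"
  using fb by (auto simp: free_boundary_def)

lemma bD:
  assumes "m \<in> I" "m0 \<le> m"
  shows "x0 \<le> b m" "b m < m" "b m \<in> I" "(b has_real_derivative b' m) (at m within {m \<in> I. m0 \<le> m})"
    "tangent m (b m) < \<gamma> m"
proof -
  show "x0 \<le> b m" "b m < m" "b m \<in> I" "(b has_real_derivative b' m) (at m within {m \<in> I. m0 \<le> m})"
    unfolding b'_def using free_boundaryD[OF fb assms] by auto
  show "tangent m (b m) < \<gamma> m"
    using free_boundary_tangent_below[OF fb _ assms] f_pos F_less by simp
qed

lemma b_cont: "continuous_on {m \<in> I. m0 \<le> m} b"
  by (rule DERIV_continuous_on[OF bD(4)]) auto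

lemma b'_cont: "continuous_on {m \<in> I. m0 \<le> m} b'"
proof -
  let ?A = "{m \<in> I. m0 \<le> m}"
  have F_cont: "continuous_on I F"
    by (rule DERIV_continuous_on) (rule has_field_derivative_at_within[OF F_deriv])
  have "continuous_on ?A (\<lambda>m. inverse_slope m (b m))"
    by (rule continuous_on_inverse_slope[OF continuous_on_id b_cont]) (use bD in auto)
  moreover have "inverse_slope m (b m) \<noteq> 0" if "m \<in> ?A" for m
    using inverse_slope_pos[of "b m" m] bD[of m] that by fastforce
  moreover have "1 - F m \<noteq> 0" if "m \<in> ?A" for m using F_less[of m] that by auto
  ultimately show ?thesis
    unfolding b'_def
    by (intro continuous_on_divide continuous_on_diff continuous_on_const
        continuous_on_subset[OF f_cont] continuous_on_subset[OF F_cont]) auto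
qed

lemma V_late: "m0 \<le> m \<Longrightarrow> V x m = (1 - F m) * (\<psi> x * capped_tangent x (b m))"
  by (simp add: V_def weight_def max_absorb1 min_absorb2 H_m0)

lemma V_early: "m \<le> m0 \<Longrightarrow> V x m = (1 - F m0 - H m) * \<psi> x"
  by (cases "x \<le> x0") (simp_all add: V_def weight_def max_absorb2 min_absorb1 m0 capped_tangent_left
      capped_tangent_right tangent_x0)

lemma V_deriv_late:
  assumes m: "m \<in> I" "m0 \<le> m"
  shows "((\<lambda>n. V x n) has_real_derivative
    - f m * (\<psi> x * capped_tangent x (b m)) + (1 - F m) * (\<psi> x * (\<theta>' (b m) * (\<zeta> (max x (b m)) - \<zeta> (b m)) * b' m)))
    (at m within {m \<in> I. m0 \<le> m})"
proof -
  let ?A = "{m \<in> I. m0 \<le> m}"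
  have "b ` ?A \<subseteq> {x0..}" using bD by auto
  then have "((capped_tangent x \<circ> b) has_real_derivative \<theta>' (b m) * (\<zeta> (max x (b m)) - \<zeta> (b m)) * b' m) (at m within ?A)"
    by (intro DERIV_image_chain bD(4)[OF m] DERIV_subset[OF capped_tangent_deriv_boundary[OF bD(3,1)[OF m]]])
  then have c: "((\<lambda>n. capped_tangent x (b n)) has_real_derivative \<theta>' (b m) * (\<zeta> (max x (b m)) - \<zeta> (b m)) * b' m) (at m within ?A)"
    by (simp add: o_def)
  have "((\<lambda>n. 1 - F n) has_real_derivative - f m) (at m within ?A)"
    using has_field_derivative_at_within[OF F_deriv[OF m(1)]] by (auto intro!: derivative_eq_intros)
  then have "((\<lambda>n. (1 - F n) * (\<psi> x * capped_tangent x (b n))) has_real_derivative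
    - f m * (\<psi> x * capped_tangent x (b m)) + \<psi> x * (\<theta>' (b m) * (\<zeta> (max x (b m)) - \<zeta> (b m)) * b' m) * (1 - F m))
    (at m within ?A)"
    by (rule DERIV_mult[OF _ DERIV_cmult[OF c]])
  then have "((\<lambda>n. V x n) has_real_derivative
    - f m * (\<psi> x * capped_tangent x (b m)) + \<psi> x * (\<theta>' (b m) * (\<zeta> (max x (b m)) - \<zeta> (b m)) * b' m) * (1 - F m))
    (at m within ?A)"
    by (rule has_field_derivative_transform_within[OF _ zero_less_one]) (use m V_late in auto)
  then show ?thesis by (simp only: mult.commute[of _ "1 - F m"])
qed

lemma early_deriv:
  assumes m: "m \<in> I"
  shows "((\<lambda>n. (1 - F m0 - H n) * \<psi> x) has_real_derivative - (f m * \<gamma> m) * \<psi> x) (at m)"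
  using H_deriv[OF m] by (auto intro!: derivative_eq_intros)

lemma V_deriv_early:
  assumes m: "m \<in> I" "m < m0"
  shows "((\<lambda>n. V x n) has_real_derivative - (f m * \<gamma> m) * \<psi> x) (at m)"
  by (rule has_field_derivative_transform_within_open[OF early_deriv[OF m(1)], of "{..<m0}"])
    (use m V_early in auto)

lemma V_deriv_left:
  assumes x: "x \<in> I" and m: "m \<in> I"
  shows "((\<lambda>y. V y m) has_real_derivative weight m * (\<psi>' x * capped_tangent x (b (max m m0))
    + \<theta> (min (b (max m m0)) (max x x0)) * s x / \<psi> x)) (at x)"
proof -
  have k: "x0 \<le> b (max m m0)" using bD(1)[of "max m m0"] m m0 by (auto simp: max_def)
  show ?thesis
    unfolding V_def
    by (rule DERIV_cmult, rule DERIV_cong[OF DERIV_mult[OF \<psi>_deriv(1)[OF x] capped_tangent_deriv[OF x k]]])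
      (use \<psi>_nz[OF x] in \<open>simp add: power2_eq_square\<close>)
qed

end

section \<open>Regularity of the candidate, and the variational system\<close>

context boundary_solution
begin

lemma F_cont: "continuous_on I F" and H_cont: "continuous_on I H"
  by (rule DERIV_continuous_on, rule has_field_derivative_at_within, rule F_deriv H_deriv, assumption)+

lemma max_m0_I: "m \<in> I \<Longrightarrow> max m m0 \<in> I" and min_m0_I: "m \<in> I \<Longrightarrow> min m m0 \<in> I"
  and max_x0_I: "x \<in> I \<Longrightarrow> max x x0 \<in> I"
  using m0 x0_I by (auto simp: max_def min_def)

lemma continuous_on_b:
  assumes "continuous_on S g" "g ` S \<subseteq> I"
  shows "continuous_on S (\<lambda>p. b (max (g p) m0))"
proof (rule continuous_on_compose2[OF b_cont])
  show "continuous_on S (\<lambda>p. max (g p) m0)" by (intro continuous_intros assms)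
qed (use assms(2) max_m0_I in fastforce)

lemma continuous_on_weight:
  assumes "continuous_on S g" "g ` S \<subseteq> I"
  shows "continuous_on S (\<lambda>p. weight (g p))"
  unfolding weight_def
proof (intro continuous_on_diff continuous_on_const continuous_on_compose2[OF F_cont] continuous_on_compose2[OF H_cont])
  show "continuous_on S (\<lambda>p. max (g p) m0)" "continuous_on S (\<lambda>p. min (g p) m0)"
    by (intro continuous_intros assms)+
  show "(\<lambda>p. max (g p) m0) ` S \<subseteq> I" "(\<lambda>p. min (g p) m0) ` S \<subseteq> I"
    using assms(2) max_m0_I min_m0_I by fastforce+
qed

lemma b_max_I: "m \<in> I \<Longrightarrow> b (max m m0) \<in> I" and b_max_ge: "m \<in> I \<Longrightarrow> x0 \<le> b (max m m0)"
  using bD[OF max_m0_I] by auto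

lemma cap_I: "x \<in> I \<Longrightarrow> m \<in> I \<Longrightarrow> min (b (max m m0)) (max x x0) \<in> I"
  using b_max_I[of m] max_x0_I[of x] by (simp add: min_def)

lemma continuous_on_cap:
  assumes "continuous_on S k" "k ` S \<subseteq> I" "continuous_on S g" "g ` S \<subseteq> I"
  shows "continuous_on S (\<lambda>p. min (b (max (g p) m0)) (max (k p) x0))"
  by (intro continuous_on_min continuous_on_max continuous_on_const continuous_on_b assms)

lemma continuous_on_capped_tangent:
  assumes "continuous_on S k" "k ` S \<subseteq> I" "continuous_on S g" "g ` S \<subseteq> I"
  shows "continuous_on S (\<lambda>p. capped_tangent (k p) (b (max (g p) m0)))"
  unfolding capped_tangent_def
proof (intro continuous_on_tangent continuous_on_cap assms)
  show "(\<lambda>p. min (b (max (g p) m0)) (max (k p) x0)) ` S \<subseteq> I"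
  proof (rule image_subsetI)
    fix p assume "p \<in> S"
    then show "min (b (max (g p) m0)) (max (k p) x0) \<in> I"
      using assms(2,4) by (intro cap_I) blast+
  qed
qed

lemma state_I: "fst ` state_set \<alpha> \<beta> \<subseteq> I" "snd ` state_set \<alpha> \<beta> \<subseteq> I"
  by (auto simp: state_set_def)

lemma continuous_on_state:
  assumes "A \<subseteq> state_set \<alpha> \<beta>"
  shows "continuous_on A (\<lambda>p. \<psi> (fst p))" "continuous_on A (\<lambda>p. \<psi>' (fst p))" "continuous_on A (\<lambda>p. s (fst p))"
    "continuous_on A (\<lambda>p. R (fst p))" "continuous_on A (\<lambda>p. R' (fst p))" "continuous_on A (\<lambda>p. R'' (fst p))"
    "continuous_on A (\<lambda>p. \<zeta> (fst p))" "continuous_on A (\<lambda>p. \<mu> (fst p))" "continuous_on A (\<lambda>p. \<sigma> (fst p))"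
    "continuous_on A (\<lambda>p. f (snd p))" "continuous_on A (\<lambda>p. F (snd p))" "continuous_on A (\<lambda>p. H (snd p))"
    "continuous_on A (\<lambda>p. \<gamma> (snd p))"
proof -
  have I: "fst ` A \<subseteq> I" "snd ` A \<subseteq> I" using assms state_I by auto
  have f: "continuous_on A (\<lambda>p. g (fst p))" if "continuous_on I g" for g
    by (rule continuous_on_compose2[OF that continuous_on_fst[OF continuous_on_id]]) (use I in auto)
  have s: "continuous_on A (\<lambda>p. g (snd p))" if "continuous_on I g" for g
    by (rule continuous_on_compose2[OF that continuous_on_snd[OF continuous_on_id]]) (use I in auto)
  show "continuous_on A (\<lambda>p. \<psi> (fst p))" "continuous_on A (\<lambda>p. \<psi>' (fst p))" "continuous_on A (\<lambda>p. s (fst p))"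
    "continuous_on A (\<lambda>p. R (fst p))" "continuous_on A (\<lambda>p. R' (fst p))" "continuous_on A (\<lambda>p. R'' (fst p))"
    "continuous_on A (\<lambda>p. \<zeta> (fst p))" "continuous_on A (\<lambda>p. \<mu> (fst p))" "continuous_on A (\<lambda>p. \<sigma> (fst p))"
    "continuous_on A (\<lambda>p. f (snd p))" "continuous_on A (\<lambda>p. F (snd p))" "continuous_on A (\<lambda>p. H (snd p))"
    "continuous_on A (\<lambda>p. \<gamma> (snd p))"
    by (rule f s; rule cont_on_I R''_cont \<zeta>_cont \<mu>_cont \<sigma>_cont f_cont F_cont H_cont \<gamma>_cont)+
qed

lemma V_continuous: "continuous_on (state_set \<alpha> \<beta>) (\<lambda>(x, m). V x m)"
  unfolding V_def split_beta
  by (intro continuous_on_mult continuous_on_weight continuous_on_state(1)[OF order_refl] continuous_on_capped_tangent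
      continuous_on_fst continuous_on_snd continuous_on_id state_I)

lemma V_C21_early: "C21_on2 {(x, m) \<in> state_set \<alpha> \<beta>. m \<le> m0} V"
proof (rule C21_on2I[where \<Phi> = "\<lambda>x m. (1 - F m0 - H m) * \<psi> x"
      and \<Phi>x = "\<lambda>x m. (1 - F m0 - H m) * \<psi>' x"
      and \<Phi>xx = "\<lambda>x m. (1 - F m0 - H m) * (2 / (\<sigma> x)\<^sup>2 * (r * \<psi> x - \<mu> x * \<psi>' x))"
      and \<Phi>m = "\<lambda>x m. - (f m * \<gamma> m) * \<psi> x"])
  fix x m assume "(x, m) \<in> {(x, m) \<in> state_set \<alpha> \<beta>. m \<le> m0}"
  then have xm: "x \<in> I" "m \<in> I" "m \<le> m0" by (auto simp: state_set_def)
  show "V x m = (1 - F m0 - H m) * \<psi> x" using V_early[OF xm(3)] .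
  show "((\<lambda>y. (1 - F m0 - H m) * \<psi> y) has_real_derivative (1 - F m0 - H m) * \<psi>' x) (at x)"
    "((\<lambda>y. (1 - F m0 - H m) * \<psi>' y) has_real_derivative (1 - F m0 - H m) * (2 / (\<sigma> x)\<^sup>2 * (r * \<psi> x - \<mu> x * \<psi>' x))) (at x)"
    by (rule DERIV_cmult, rule \<psi>_deriv[OF xm(1)])+
  show "((\<lambda>n. (1 - F m0 - H n) * \<psi> x) has_real_derivative - (f m * \<gamma> m) * \<psi> x)
      (at m within {n. (x, n) \<in> {(x, m) \<in> state_set \<alpha> \<beta>. m \<le> m0}})"
    by (rule has_field_derivative_at_within[OF early_deriv[OF xm(2)]])
next
  have sub: "{(x, m) \<in> state_set \<alpha> \<beta>. m \<le> m0} \<subseteq> state_set \<alpha> \<beta>" by auto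
  have nz: "\<forall>p\<in>{(x, m) \<in> state_set \<alpha> \<beta>. m \<le> m0}. (\<sigma> (fst p))\<^sup>2 \<noteq> 0" using \<sigma>_nz by (auto simp: state_set_def)
  note c = continuous_on_state[OF sub]
  show "continuous_on {(x, m) \<in> state_set \<alpha> \<beta>. m \<le> m0} (\<lambda>p. (1 - F m0 - H (snd p)) * \<psi>' (fst p))"
    "continuous_on {(x, m) \<in> state_set \<alpha> \<beta>. m \<le> m0} (\<lambda>p. (1 - F m0 - H (snd p)) *
       (2 / (\<sigma> (fst p))\<^sup>2 * (r * \<psi> (fst p) - \<mu> (fst p) * \<psi>' (fst p))))"
    "continuous_on {(x, m) \<in> state_set \<alpha> \<beta>. m \<le> m0} (\<lambda>p. - (f (snd p) * \<gamma> (snd p)) * \<psi> (fst p))"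
    by (intro continuous_on_mult continuous_on_diff continuous_on_minus continuous_on_divide continuous_on_power
        continuous_on_const c nz)+
qed

text \<open>For \<open>m \<ge> m0\<close>, all three pieces of \<open>V\<close> have the form \<open>(1 - F m) \<Psi> x m\<close>.\<close>

lemma V_C21_late:
  assumes A: "A \<subseteq> {(x, m) \<in> state_set \<alpha> \<beta>. m0 \<le> m}"
    and eq: "\<And>x m. (x, m) \<in> A \<Longrightarrow> V x m = (1 - F m) * \<Psi> x m"
    and x: "\<And>x m. (x, m) \<in> A \<Longrightarrow> ((\<lambda>y. \<Psi> y m) has_real_derivative \<Psi>x x m) (at x)"
    and xx: "\<And>x m. (x, m) \<in> A \<Longrightarrow> ((\<lambda>y. \<Psi>x y m) has_real_derivative \<Psi>xx x m) (at x)"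
    and m: "\<And>x m. (x, m) \<in> A \<Longrightarrow> ((\<lambda>n. \<Psi> x n) has_real_derivative \<Psi>m x m) (at m within {n \<in> I. m0 \<le> n})"
    and c: "continuous_on A (\<lambda>p. \<Psi> (fst p) (snd p))" "continuous_on A (\<lambda>p. \<Psi>x (fst p) (snd p))"
      "continuous_on A (\<lambda>p. \<Psi>xx (fst p) (snd p))" "continuous_on A (\<lambda>p. \<Psi>m (fst p) (snd p))"
  shows "C21_on2 A V"
proof (rule C21_on2I[where \<Phi> = "\<lambda>x m. (1 - F m) * \<Psi> x m" and \<Phi>x = "\<lambda>x m. (1 - F m) * \<Psi>x x m"
      and \<Phi>xx = "\<lambda>x m. (1 - F m) * \<Psi>xx x m" and \<Phi>m = "\<lambda>x m. - f m * \<Psi> x m + \<Psi>m x m * (1 - F m)"])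
  fix x m assume xm: "(x, m) \<in> A"
  then have mI: "m \<in> I" using A by (auto simp: state_set_def)
  show "V x m = (1 - F m) * \<Psi> x m" by (rule eq[OF xm])
  show "((\<lambda>y. (1 - F m) * \<Psi> y m) has_real_derivative (1 - F m) * \<Psi>x x m) (at x)"
    by (rule DERIV_cmult[OF x[OF xm]])
  show "((\<lambda>y. (1 - F m) * \<Psi>x y m) has_real_derivative (1 - F m) * \<Psi>xx x m) (at x)"
    by (rule DERIV_cmult[OF xx[OF xm]])
  have sub: "{n. (x, n) \<in> A} \<subseteq> {n \<in> I. m0 \<le> n}" using A by (auto simp: state_set_def)
  have "((\<lambda>n. 1 - F n) has_real_derivative - f m) (at m within {n. (x, n) \<in> A})"
    using has_field_derivative_at_within[OF F_deriv[OF mI]] by (auto intro!: derivative_eq_intros)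
  then show "((\<lambda>n. (1 - F n) * \<Psi> x n) has_real_derivative - f m * \<Psi> x m + \<Psi>m x m * (1 - F m))
      (at m within {n. (x, n) \<in> A})"
    by (rule DERIV_mult[OF _ DERIV_subset[OF m[OF xm] sub]])
next
  have sub: "A \<subseteq> state_set \<alpha> \<beta>" using A by auto
  show "continuous_on A (\<lambda>p. (1 - F (snd p)) * \<Psi>x (fst p) (snd p))"
    "continuous_on A (\<lambda>p. (1 - F (snd p)) * \<Psi>xx (fst p) (snd p))"
    "continuous_on A (\<lambda>p. - f (snd p) * \<Psi> (fst p) (snd p) + \<Psi>m (fst p) (snd p) * (1 - F (snd p)))"
    by (intro continuous_on_add continuous_on_mult continuous_on_diff continuous_on_minus
        continuous_on_const continuous_on_state(10,11)[OF sub] c)+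
qed

lemma V_C21_left: "C21_on2 {(x, m) \<in> state_set \<alpha> \<beta>. m0 \<le> m \<and> x \<le> x0} V"
proof (rule V_C21_late[where \<Psi> = "\<lambda>x m. \<psi> x" and \<Psi>x = "\<lambda>x m. \<psi>' x"
      and \<Psi>xx = "\<lambda>x m. 2 / (\<sigma> x)\<^sup>2 * (r * \<psi> x - \<mu> x * \<psi>' x)" and \<Psi>m = "\<lambda>x m. 0"])
  let ?A = "{(x, m) \<in> state_set \<alpha> \<beta>. m0 \<le> m \<and> x \<le> x0}"
  have sub: "?A \<subseteq> state_set \<alpha> \<beta>" by auto
  have nz: "\<forall>p\<in>?A. (\<sigma> (fst p))\<^sup>2 \<noteq> 0" using \<sigma>_nz by (auto simp: state_set_def)
  note c = continuous_on_state[OF sub]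
  show "continuous_on ?A (\<lambda>p. \<psi> (fst p))" "continuous_on ?A (\<lambda>p. \<psi>' (fst p))"
    "continuous_on ?A (\<lambda>p. 2 / (\<sigma> (fst p))\<^sup>2 * (r * \<psi> (fst p) - \<mu> (fst p) * \<psi>' (fst p)))"
    "continuous_on ?A (\<lambda>p. 0)"
    by (intro continuous_on_mult continuous_on_diff continuous_on_divide continuous_on_power continuous_on_const c nz)+
  fix x m assume "(x, m) \<in> ?A"
  then have xm: "x \<in> I" "m \<in> I" "m0 \<le> m" "x \<le> x0" by (auto simp: state_set_def)
  show "V x m = (1 - F m) * \<psi> x"
    using V_late[OF xm(3)] capped_tangent_left[OF xm(4) bD(1)[OF xm(2,3)]] by simp
  show "(\<psi> has_real_derivative \<psi>' x) (at x)"
    "(\<psi>' has_real_derivative 2 / (\<sigma> x)\<^sup>2 * (r * \<psi> x - \<mu> x * \<psi>' x)) (at x)"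
    by (rule \<psi>_deriv[OF xm(1)])+
qed auto

lemma V_C21_stopping: "C21_on2 (stopping_set \<alpha> \<beta> x0 m0 b) V"
proof (rule V_C21_late[where \<Psi> = "\<lambda>x m. R x" and \<Psi>x = "\<lambda>x m. R' x"
      and \<Psi>xx = "\<lambda>x m. R'' x" and \<Psi>m = "\<lambda>x m. 0"])
  let ?A = "stopping_set \<alpha> \<beta> x0 m0 b"
  have sub: "?A \<subseteq> state_set \<alpha> \<beta>" by (auto simp: stopping_set_def)
  note c = continuous_on_state[OF sub]
  show "continuous_on ?A (\<lambda>p. R (fst p))" "continuous_on ?A (\<lambda>p. R' (fst p))" "continuous_on ?A (\<lambda>p. R'' (fst p))"
    "continuous_on ?A (\<lambda>p. 0)"
    by (intro continuous_on_const c)+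
  fix x m assume "(x, m) \<in> ?A"
  then have xm: "x \<in> I" "m \<in> I" "m0 \<le> m" "x0 \<le> x" "x \<le> b m" by (auto simp: stopping_set_def state_set_def)
  show "V x m = (1 - F m) * R x"
    using V_late[OF xm(3)] capped_tangent_middle[OF xm(4,5)] \<rho>_\<psi>[OF xm(1)] by simp
  show "(R has_real_derivative R' x) (at x)" by (rule R_deriv[OF xm(1)])
  show "(R' has_real_derivative R'' x) (at x)" by (rule R'_deriv[OF xm(1)])
qed (auto simp: stopping_set_def)

lemma V_C21_right: "C21_on2 {(x, m) \<in> state_set \<alpha> \<beta>. m0 \<le> m \<and> b m \<le> x} V"
proof (rule V_C21_late[where \<Psi> = "\<lambda>x m. \<psi> x * tangent x (b m)"
      and \<Psi>x = "\<lambda>x m. \<psi>' x * tangent x (b m) + \<theta> (b m) * s x / \<psi> x"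
      and \<Psi>xx = "\<lambda>x m. 2 / (\<sigma> x)\<^sup>2 * (r * (\<psi> x * tangent x (b m)) - \<mu> x * (\<psi>' x * tangent x (b m) + \<theta> (b m) * s x / \<psi> x))"
      and \<Psi>m = "\<lambda>x m. \<psi> x * (\<theta>' (b m) * (\<zeta> x - \<zeta> (b m)) * b' m)"])
  let ?A = "{(x, m) \<in> state_set \<alpha> \<beta>. m0 \<le> m \<and> b m \<le> x}"
  have sub: "?A \<subseteq> state_set \<alpha> \<beta>" by auto
  have nz: "\<forall>p\<in>?A. (\<sigma> (fst p))\<^sup>2 \<noteq> 0" "\<forall>p\<in>?A. \<psi> (fst p) \<noteq> 0"
    using \<sigma>_nz \<psi>_nz by (auto simp: state_set_def)
  have snd: "snd ` ?A \<subseteq> {m \<in> I. m0 \<le> m}" by (auto simp: state_set_def)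
  have bc: "continuous_on ?A (\<lambda>p. b (snd p))" "continuous_on ?A (\<lambda>p. b' (snd p))"
    by (rule continuous_on_compose2[OF b_cont continuous_on_snd[OF continuous_on_id] snd],
        rule continuous_on_compose2[OF b'_cont continuous_on_snd[OF continuous_on_id] snd])
  have bI: "(\<lambda>p. b (snd p)) ` ?A \<subseteq> I" using snd bD(3) by auto
  have tc: "continuous_on ?A (\<lambda>p. tangent (fst p) (b (snd p)))"
    by (intro continuous_on_tangent continuous_on_fst continuous_on_id bc bI) (auto simp: state_set_def)
  note c = continuous_on_state[OF sub]
  show "continuous_on ?A (\<lambda>p. \<psi> (fst p) * tangent (fst p) (b (snd p)))"
    "continuous_on ?A (\<lambda>p. \<psi>' (fst p) * tangent (fst p) (b (snd p)) + \<theta> (b (snd p)) * s (fst p) / \<psi> (fst p))"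
    "continuous_on ?A (\<lambda>p. 2 / (\<sigma> (fst p))\<^sup>2 * (r * (\<psi> (fst p) * tangent (fst p) (b (snd p))) - \<mu> (fst p) *
       (\<psi>' (fst p) * tangent (fst p) (b (snd p)) + \<theta> (b (snd p)) * s (fst p) / \<psi> (fst p))))"
    "continuous_on ?A (\<lambda>p. \<psi> (fst p) * (\<theta>' (b (snd p)) * (\<zeta> (fst p) - \<zeta> (b (snd p))) * b' (snd p)))"
    by (intro continuous_on_add continuous_on_mult continuous_on_diff continuous_on_divide continuous_on_power
        continuous_on_const c nz tc bc continuous_on_compose2[OF \<theta>_cont bc(1) bI]
        continuous_on_compose2[OF \<theta>'_cont bc(1) bI] continuous_on_compose2[OF \<zeta>_cont bc(1) bI])+
  fix x m assume "(x, m) \<in> ?A"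
  then have xm: "x \<in> I" "m \<in> I" "m0 \<le> m" "b m \<le> x" by (auto simp: state_set_def)
  show "V x m = (1 - F m) * (\<psi> x * tangent x (b m))"
    using V_late[OF xm(3)] capped_tangent_right[OF bD(1)[OF xm(2,3)] xm(4)] by simp
  show "((\<lambda>y. \<psi> y * tangent y (b m)) has_real_derivative \<psi>' x * tangent x (b m) + \<theta> (b m) * s x / \<psi> x) (at x)"
    "((\<lambda>y. \<psi>' y * tangent y (b m) + \<theta> (b m) * s y / \<psi> y) has_real_derivative
      2 / (\<sigma> x)\<^sup>2 * (r * (\<psi> x * tangent x (b m)) - \<mu> x * (\<psi>' x * tangent x (b m) + \<theta> (b m) * s x / \<psi> x))) (at x)"
    using harmonic_onD[OF tangent_harmonic xm(1), of "b m"] unfolding at_within_I[OF xm(1)] by blast+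
  show "((\<lambda>n. \<psi> x * tangent x (b n)) has_real_derivative \<psi> x * (\<theta>' (b m) * (\<zeta> x - \<zeta> (b m)) * b' m))
      (at m within {n \<in> I. m0 \<le> n})"
    by (intro DERIV_cmult DERIV_chain2[OF tangent_deriv_left bD(4)] bD(3) xm)
qed auto

text \<open>Removing the line \<open>m = m0\<close> leaves two relatively open parts, so the
  formulas for the derivative in \<open>m\<close> on its two sides need not agree across it.\<close>

lemma V_C1: "C1_on2 (state_set \<alpha> \<beta> - {(x, m). m = m0}) V"
proof -
  let ?A = "state_set \<alpha> \<beta> - {(x, m). m = m0}"
  let ?A1 = "?A \<inter> {p. snd p < m0}" and ?A2 = "?A \<inter> {p. m0 < snd p}"
  define Vx where "Vx x m = weight m * (\<psi>' x * capped_tangent x (b (max m m0))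
    + \<theta> (min (b (max m m0)) (max x x0)) * s x / \<psi> x)" for x m
  \<comment> \<open>\<open>max m m0\<close> keeps the arguments of \<open>b\<close> and
    \<open>b'\<close> in their domain, so that continuity can be shown on all of
    \<open>?A\<close>.\<close>
  define late where "late x m = - f m * (\<psi> x * capped_tangent x (b (max m m0)))
    + (1 - F m) * (\<psi> x * (\<theta>' (b (max m m0)) * (\<zeta> (max x (b (max m m0))) - \<zeta> (b (max m m0))) * b' (max m m0)))" for x m
  define Vm where "Vm x m = (if m < m0 then - (f m * \<gamma> m) * \<psi> x else late x m)" for x m
  have sub: "?A \<subseteq> state_set \<alpha> \<beta>" by auto
  have I: "fst ` ?A \<subseteq> I" "snd ` ?A \<subseteq> I" using state_I by auto
  have xd: "((\<lambda>y. V y m) has_real_derivative Vx x m) (at x within {y. (y, m) \<in> ?A})" if "(x, m) \<in> ?A" for x m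
    unfolding Vx_def using that by (intro has_field_derivative_at_within[OF V_deriv_left]) (auto simp: state_set_def)
  have md: "((\<lambda>n. V x n) has_real_derivative Vm x m) (at m within {n. (x, n) \<in> ?A})" if "(x, m) \<in> ?A" for x m
  proof -
    have m: "m \<in> I" "m \<noteq> m0" using that by (auto simp: state_set_def)
    show ?thesis
    proof (cases "m < m0")
      case True
      then show ?thesis using has_field_derivative_at_within[OF V_deriv_early[OF m(1) True]] by (simp add: Vm_def)
    next
      case False
      then have lt: "m0 < m" using m(2) by simp
      have "((\<lambda>n. V x n) has_real_derivative late x m) (at m within {n \<in> I. m0 \<le> n})"
        using V_deriv_late[OF m(1) less_imp_le[OF lt], of x] lt by (simp add: late_def max_absorb1)
      moreover have "at m within {n \<in> I. m0 \<le> n} = at m"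
        by (rule at_within_interior, rule interiorI[of "I \<inter> {m0<..}"]) (use m lt open_I in auto)
      ultimately show ?thesis using False by (simp add: Vm_def has_field_derivative_at_within)
    qed
  qed
  have nz: "\<forall>p\<in>?A. \<psi> (fst p) \<noteq> 0" using \<psi>_nz I by auto
  note c = continuous_on_state[OF sub]
  have fs: "continuous_on ?A fst" "continuous_on ?A snd"
    by (intro continuous_on_fst continuous_on_snd continuous_on_id)+
  have bI: "(\<lambda>p. b (max (snd p) m0)) ` ?A \<subseteq> I" using I b_max_I by auto
  have bc: "continuous_on ?A (\<lambda>p. b (max (snd p) m0))" by (rule continuous_on_b[OF fs(2) I(2)])
  have b'c: "continuous_on ?A (\<lambda>p. b' (max (snd p) m0))"
    by (rule continuous_on_compose2[OF b'_cont])
      (use I max_m0_I in \<open>auto intro!: continuous_intros simp del: max.bounded_iff\<close>)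
  have Vxc: "continuous_on ?A (\<lambda>p. Vx (fst p) (snd p))"
    unfolding Vx_def
    by (intro continuous_on_mult continuous_on_add continuous_on_divide continuous_on_weight c nz fs I
        continuous_on_capped_tangent continuous_on_compose2[OF \<theta>_cont] continuous_on_cap)
      (use I cap_I in auto)
  have latec: "continuous_on ?A (\<lambda>p. late (fst p) (snd p))"
    unfolding late_def
    by (intro continuous_on_mult continuous_on_add continuous_on_diff continuous_on_minus continuous_on_const c fs I b'c
        continuous_on_capped_tangent continuous_on_compose2[OF \<theta>'_cont bc bI] continuous_on_compose2[OF \<zeta>_cont bc bI]
        continuous_on_compose2[OF \<zeta>_cont continuous_on_max[OF fs(1) bc]])
      (use I b_max_I in \<open>auto simp: max_def\<close>)
  have U: "?A = ?A1 \<union> ?A2" by force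
  have "continuous_on (?A1 \<union> ?A2) (\<lambda>p. Vm (fst p) (snd p))"
  proof (rule continuous_on_Un_local_open)
    show "openin (top_of_set (?A1 \<union> ?A2)) ?A1" "openin (top_of_set (?A1 \<union> ?A2)) ?A2"
      unfolding U[symmetric] by (intro openin_open_Int open_Collect_less continuous_intros)+
    have "continuous_on ?A1 (\<lambda>p. - (f (snd p) * \<gamma> (snd p)) * \<psi> (fst p))"
      by (rule continuous_on_subset[of ?A])
        (intro continuous_on_mult continuous_on_minus c, auto)
    then show "continuous_on ?A1 (\<lambda>p. Vm (fst p) (snd p))"
      by (rule continuous_on_eq) (auto simp: Vm_def)
    have "continuous_on ?A2 (\<lambda>p. late (fst p) (snd p))"
      by (rule continuous_on_subset[OF latec]) auto
    then show "continuous_on ?A2 (\<lambda>p. Vm (fst p) (snd p))"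
      by (rule continuous_on_eq) (auto simp: Vm_def)
  qed
  then have Vmc: "continuous_on ?A (\<lambda>p. Vm (fst p) (snd p))" unfolding U[symmetric] .
  show ?thesis
    unfolding C1_on2_def using xd md Vxc Vmc
    by (intro exI[of _ Vx] exI[of _ Vm]) (auto simp: split_beta)
qed

lemma dom_eq: "{m. m0 \<le> m \<and> ereal m < \<beta>} = {m \<in> I. m0 \<le> m}"
  using m0(1) by (auto simp: einterval_iff intro: less_le_trans[of \<alpha> "ereal m0"])

theorem V_regular: "variational_regularity \<alpha> \<beta> x0 m0 b V"
  unfolding variational_regularity_def
proof (intro conjI V_continuous V_C1 V_C21_left V_C21_right V_C21_early V_C21_stopping)
  show "C1_on {m. m0 \<le> m \<and> ereal m < \<beta>} b"
    unfolding dom_eq C1_on_def using bD(4) b'_cont by (intro exI[of _ b']) auto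
qed

text \<open>The equation for \<open>b\<close> encodes the condition on the diagonal for
  \<open>m \<ge> m0\<close>, and the choice of \<open>H\<close> ensures it below. Tangency yields
  smooth fit, and decay at \<open>\<alpha>\<close> comes from \<open>\<psi>\<close>, since the
  capped tangent is 1 to the left of \<open>x0\<close>.\<close>

theorem V_system: "variational_system r \<alpha> \<beta> \<mu> \<sigma> R x0 G F f m0 b V"
  unfolding variational_system_def
proof (intro conjI)
  show "x0 < m0" "b m0 = x0" by (rule m0)+
  show "ereal m0 < \<beta>" using m0(1) by (simp add: einterval_iff)
  show "\<forall>m. m0 \<le> m \<and> ereal m < \<beta> \<longrightarrow> x0 \<le> b m \<and> b m < m" using dom_eq bD(1,2) by blast
  show "((\<lambda>m. ereal (b (real_of_ereal m))) \<longlongrightarrow> \<beta>) (at_left \<beta>)"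
    using tendsto_at_left_ereal_iff[OF \<alpha>\<beta> m0(1), of b] bD(3) fb unfolding free_boundary_def by blast
  show "\<forall>(x, m)\<in>interior (state_set \<alpha> \<beta> - stopping_set \<alpha> \<beta> x0 m0 b). generator \<mu> \<sigma> (\<lambda>y. V y m) x - r * V x m = 0"
  proof (intro ballI, clarify)
    fix x m assume "(x, m) \<in> interior (state_set \<alpha> \<beta> - stopping_set \<alpha> \<beta> x0 m0 b)"
    then have "(x, m) \<in> state_set \<alpha> \<beta> - stopping_set \<alpha> \<beta> x0 m0 b" using interior_subset by blast
    then have x: "x \<in> I" "m \<in> I" and cs: "m < m0 \<or> m0 \<le> m \<and> x < x0 \<or> m0 \<le> m \<and> b m < x"
      by (auto simp: state_set_def stopping_set_def)
    from cs show "generator \<mu> \<sigma> (\<lambda>y. V y m) x - r * V x m = 0"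
    proof (elim disjE conjE)
      assume "m < m0"
      then show ?thesis
        by (intro generator_zero[OF harmonic_on_scale[OF \<psi>_harmonic, of "1 - F m0 - H m"] open_I x(1) order_refl])
          (simp add: V_early)
    next
      assume m: "m0 \<le> m" "x < x0"
      show ?thesis
        by (rule generator_zero[OF harmonic_on_scale[OF \<psi>_harmonic, of "1 - F m"], of "I \<inter> {..<x0}"])
          (use x m V_late capped_tangent_left bD(1)[OF x(2) m(1)] in \<open>auto intro: open_I\<close>)
    next
      assume m: "m0 \<le> m" "b m < x"
      show ?thesis
        by (rule generator_zero[OF harmonic_on_scale[OF tangent_harmonic, of "1 - F m" "b m"], of "I \<inter> {b m<..}"])
          (use x m V_late capped_tangent_right bD(1)[OF x(2) m(1)] in \<open>auto intro: open_I\<close>)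
    qed
  qed
  show "\<forall>(x, m)\<in>stopping_set \<alpha> \<beta> x0 m0 b. V x m = (1 - F m) * R x"
    using V_late capped_tangent_middle \<rho>_\<psi> by (auto simp: stopping_set_def state_set_def)
  show "\<forall>m. m0 \<le> m \<and> ereal m < \<beta> \<longrightarrow> ((\<lambda>y. V y m) has_real_derivative (1 - F m) * deriv R (b m)) (at (b m))"
  proof (intro allI impI)
    fix m assume "m0 \<le> m \<and> ereal m < \<beta>"
    then have m: "m \<in> I" "m0 \<le> m" using dom_eq by auto
    note b = bD[OF m]
    have "weight m = 1 - F m" using m by (simp add: weight_def max_absorb1 min_absorb2 H_m0)
    then show "((\<lambda>y. V y m) has_real_derivative (1 - F m) * deriv R (b m)) (at (b m))"
      using V_deriv_left[OF b(3) m(1)] m b(1) tangent_data(2)[OF b(3)] DERIV_imp_deriv[OF R_deriv[OF b(3)]]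
      by (simp add: max_absorb1 capped_tangent_right)
  qed
  show "\<forall>m\<in>I. ((\<lambda>n. V m n) has_real_derivative - f m * G m) (at m within {m..})"
  proof
    fix m assume m: "m \<in> I"
    show "((\<lambda>n. V m n) has_real_derivative - f m * G m) (at m within {m..})"
    proof (cases "m < m0")
      case True
      show ?thesis
        by (rule has_field_derivative_at_within[OF DERIV_cong[OF V_deriv_early[OF m True, of m]]])
          (simp add: \<gamma>_\<psi>[OF m, symmetric])
    next
      case False
      then have m': "m0 \<le> m" by simp
      note b = bD[OF m m']
      \<comment> \<open>The equation for \<open>b\<close>, solved for the rotation of the tangent;
        it replaces \<open>tangent m (b m)\<close> by \<open>\<gamma> m\<close> in the
        derivative.\<close>
      have "\<theta>' (b m) * (\<zeta> m - \<zeta> (b m)) * b' m = - (f m / (1 - F m) * (\<gamma> m - tangent m (b m)))"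
      proof -
        have "\<theta>' (b m) \<noteq> 0" "\<zeta> m - \<zeta> (b m) \<noteq> 0" using \<theta>'_neg[OF b(3,1)] \<zeta>_less[OF b(3) m b(2)] by auto
        then show ?thesis by (simp add: b'_def inverse_slope_def)
      qed
      moreover have "1 - F m \<noteq> 0" using F_less[OF m] by simp
      ultimately have "(1 - F m) * (\<psi> m * (\<theta>' (b m) * (\<zeta> m - \<zeta> (b m)) * b' m)) = - (f m * (\<psi> m * \<gamma> m - \<psi> m * tangent m (b m)))"
        by (simp add: right_diff_distrib)
      then have eq: "- f m * (\<psi> m * capped_tangent m (b m)) + (1 - F m) * (\<psi> m * (\<theta>' (b m) * (\<zeta> (max m (b m)) - \<zeta> (b m)) * b' m))
          = - f m * G m"
        using b \<gamma>_\<psi>[OF m] by (simp add: capped_tangent_right max_absorb1 algebra_simps)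
      have "((\<lambda>n. V m n) has_real_derivative - f m * G m) (at m within {n \<in> I. m \<le> n})"
        by (rule DERIV_subset[OF V_deriv_late[OF m m', of m, unfolded eq]]) (use m' in auto)
      moreover have "at m within {n \<in> I. m \<le> n} = at m within {m..}"
        by (rule at_within_nhd[OF m open_I]) auto
      ultimately show ?thesis by simp
    qed
  qed
  show "\<forall>m\<in>I. ((\<lambda>x. V (real_of_ereal x) m) \<longlongrightarrow> 0) (at_right \<alpha>)"
  proof
    fix m assume m: "m \<in> I"
    have "\<exists>n\<in>I. \<forall>x\<in>I. x < n \<longrightarrow> \<bar>V x m\<bar> < e" if e: "0 < e" for e
    proof -
      define k where "k = \<bar>weight m\<bar> + 1"
      have k: "0 < k" "\<bar>weight m\<bar> \<le> k" by (auto simp: k_def)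
      obtain n where n: "n \<in> I" "\<And>x. x \<in> I \<Longrightarrow> x < n \<Longrightarrow> \<bar>\<psi> x\<bar> < e / k"
        using \<psi>_vanishes[of "e / k"] e k(1) by auto
      have "\<bar>V x m\<bar> < e" if x: "x \<in> I" "x < min n x0" for x
      proof -
        have "\<bar>V x m\<bar> = \<bar>weight m\<bar> * \<bar>\<psi> x\<bar>"
          using x b_max_ge[OF m] by (simp add: V_def capped_tangent_left abs_mult)
        also have "\<dots> \<le> k * \<bar>\<psi> x\<bar>" using k(2) by (intro mult_right_mono) auto
        also have "\<dots> < k * (e / k)" using n(2)[of x] x k(1) by (intro mult_strict_left_mono) auto
        finally show ?thesis using k(1) by simp
      qed
      moreover have "min n x0 \<in> I" using n(1) x0_I by (simp add: min_def)
      ultimately show ?thesis by blast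
    qed
    then show "((\<lambda>x. V (real_of_ereal x) m) \<longlongrightarrow> 0) (at_right \<alpha>)"
      using tendsto_at_right_ereal_iff[OF \<alpha>\<beta>, of "\<lambda>x. V x m"] by blast
  qed
qed

end

section \<open>Comparison under the hazard-rate order\<close>

text \<open>Meant for the slope of \<open>G / \<psi>\<close>, whose derivative may be missing at the
  finitely many exceptional points of \<open>G\<close>. The increment is the integral of a
  nonpositive function.\<close>

lemma nonincreasing_except_finite:
  fixes f :: "real \<Rightarrow> real"
  assumes "finite E" "a \<le> b" "continuous_on {a..b} f"
    and f: "\<And>x. a < x \<Longrightarrow> x < b \<Longrightarrow> x \<notin> E \<Longrightarrow> (f has_real_derivative f' x) (at x) \<and> f' x \<le> 0"
  shows "f b \<le> f a"
proof -
  let ?g = "\<lambda>x. if a < x \<and> x < b \<and> x \<notin> E then f' x else 0"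
  have "(?g has_integral (f b - f a)) {a..b}"
    by (rule fundamental_theorem_of_calculus_interior_strong[OF assms(1,2) _ assms(3)])
      (use f in \<open>auto simp: has_real_derivative_iff_has_vector_derivative\<close>)
  then have "((\<lambda>x. - ?g x) has_integral - (f b - f a)) {a..b}" by (rule has_integral_neg)
  then have "0 \<le> - (f b - f a)"
    by (rule has_integral_nonneg) (use f in auto)
  then show ?thesis by simp
qed

lemma C1_differentiable_on_deriv:
  fixes f :: "real \<Rightarrow> real"
  assumes "f C1_differentiable_on S"
  shows "\<And>x. x \<in> S \<Longrightarrow> (f has_real_derivative deriv f x) (at x)" "continuous_on S (deriv f)"
proof -
  obtain D where D: "\<And>x. x \<in> S \<Longrightarrow> (f has_real_derivative D x) (at x)" "continuous_on S D"
    using assms unfolding C1_differentiable_on_def has_real_derivative_iff_has_vector_derivative by blast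
  have eq: "deriv f x = D x" if "x \<in> S" for x using D(1)[OF that] by (rule DERIV_imp_deriv)
  show "(f has_real_derivative deriv f x) (at x)" if "x \<in> S" for x using D(1)[OF that] eq[OF that] by simp
  show "continuous_on S (deriv f)" by (rule continuous_on_eq[OF D(2)]) (simp add: eq)
qed

lemma locally_lipschitz_on_compact:
  assumes "locally_lipschitz_on I f" "{a..b} \<subseteq> I"
  obtains L where "L-lipschitz_on {a..b} f"
proof -
  have "local_lipschitz {0::real} {a..b} (\<lambda>_. f)"
  proof (rule local_lipschitzI)
    fix t x :: real assume x: "x \<in> {a..b}"
    then obtain d L where "d > 0" "L-lipschitz_on (cball x d \<inter> I) f"
      using assms unfolding locally_lipschitz_on_def by blast
    moreover have "cball x d \<inter> {a..b} \<subseteq> cball x d \<inter> I" using assms(2) by blast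
    ultimately show "\<exists>u>0. \<exists>L. \<forall>t\<in>cball t u \<inter> {0}. L-lipschitz_on (cball x u \<inter> {a..b}) f"
      using lipschitz_on_subset by blast
  qed
  then obtain L where "\<And>t. t \<in> {0::real} \<Longrightarrow> L-lipschitz_on {a..b} f"
    by (rule local_lipschitz_compact_implies_lipschitz) auto
  then show ?thesis using that by blast
qed

lemma locally_lipschitz_on_continuous:
  assumes "locally_lipschitz_on I f" "open I"
  shows "continuous_on I f"
  unfolding continuous_on_eq_continuous_at[OF assms(2)]
proof
  fix x assume x: "x \<in> I"
  obtain d L where d: "d > 0" "L-lipschitz_on (cball x d \<inter> I) f"
    using assms(1) x unfolding locally_lipschitz_on_def by blast
  have "continuous_on (cball x d \<inter> I) f" by (rule lipschitz_on_continuous_on[OF d(2)])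
  moreover have "x \<in> interior (cball x d \<inter> I)" using d(1) x assms(2) by (simp add: interior_open)
  ultimately show "isCont f x" by (rule continuous_on_interior)
qed

lemma hazard_lipschitz:
  assumes ab: "{a..b} \<subseteq> I" and f: "locally_lipschitz_on I f" "open I"
    and F: "\<And>x. x \<in> I \<Longrightarrow> (F has_real_derivative f x) (at x)" "\<And>x. x \<in> I \<Longrightarrow> F x < (1::real)"
  shows "\<exists>L. L-lipschitz_on {a..b} (\<lambda>x. f x / (1 - F x))"
proof (cases "a \<le> b")
  case True
  \<comment> \<open>The trivial parameter set: the Lipschitz calculus is applied to functions of the
    state alone.\<close>
  let ?bl = "bounded_lipschitz {()} (\<lambda>_. {a..b})"
  have fc: "continuous_on {a..b} f"
    by (rule continuous_on_subset[OF locally_lipschitz_on_continuous[OF f] ab])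
  have Fd: "((\<lambda>x. 1 - F x) has_real_derivative - f x) (at x)" if "x \<in> {a..b}" for x
    using F(1)[of x] that ab by (auto intro!: derivative_eq_intros)
  have Fc: "continuous_on {a..b} (\<lambda>x. 1 - F x)"
    by (rule DERIV_continuous_on[OF has_field_derivative_at_within[OF Fd]])
  obtain L where "L-lipschitz_on {a..b} f" using locally_lipschitz_on_compact[OF f(1) ab] .
  then have 1: "?bl (\<lambda>_. f)" by (rule bounded_lipschitz_lipschitz_on) simp
  obtain L' where "L'-lipschitz_on {a..b} (\<lambda>x. 1 - F x)"
    using C1_lipschitz_on[OF Fd continuous_on_minus[OF fc]] .
  then have 2: "?bl (\<lambda>_ x. 1 - F x)" by (rule bounded_lipschitz_lipschitz_on) simp
  obtain u where u: "u \<in> {a..b}" "\<And>x. x \<in> {a..b} \<Longrightarrow> 1 - F u \<le> 1 - F x"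
    using continuous_attains_inf[OF compact_Icc _ Fc] True by auto
  have "0 < 1 - F u" using F(2) u(1) ab by auto
  then have "?bl (\<lambda>_ x. f x * inverse (1 - F x))"
    by (intro bounded_lipschitz_mult 1 bounded_lipschitz_inverse[OF 2, of "1 - F u"] u(2))
  then obtain M where "0 \<le> M" "\<And>x y. x \<in> {a..b} \<Longrightarrow> y \<in> {a..b} \<Longrightarrow>
      \<bar>f x * inverse (1 - F x) - f y * inverse (1 - F y)\<bar> \<le> M * \<bar>x - y\<bar>"
    unfolding bounded_lipschitz_def by blast
  then show ?thesis
    by (intro exI[of _ M] lipschitz_onI) (auto simp: dist_real_def divide_inverse)
next
  case False
  then show ?thesis by (auto intro!: exI[of _ 0] simp: lipschitz_on_def)
qed

section \<open>The law of the development cost\<close>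

lemma cdf_eq_integral:
  assumes D: "cost_distribution D f" and z: "0 \<le> z"
  shows "cdf D z = integral {0..z} f"
proof -
  obtain f' where "\<And>x. x \<in> {0..} \<Longrightarrow> (f has_real_derivative f' x) (at x within {0..})"
    using D unfolding cost_distribution_def C1_on_def by blast
  then have fc: "continuous_on {0..} f" by (rule DERIV_continuous_on)
  have pos: "0 < f x" if "0 \<le> x" for x using D that by (simp add: cost_distribution_def)
  have meas: "(\<lambda>x. indicator {0..} x * f x) \<in> borel_measurable borel"
    using borel_measurable_continuous_on_indicator[OF _ fc] by simp
  have int: "(f has_integral integral {0..z} f) {0..z}"
    by (intro integrable_integral integrable_continuous_real continuous_on_subset[OF fc]) auto
  have "emeasure D {..z} = (\<integral>\<^sup>+x. ennreal (indicator {0..} x * f x) * indicator {..z} x \<partial>lborel)"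
    using D meas by (simp add: cost_distribution_def emeasure_density)
  also have "\<dots> = (\<integral>\<^sup>+x. ennreal (indicator {0..z} x * f x) \<partial>lborel)"
    by (intro nn_integral_cong) (auto simp: indicator_def)
  also have "\<dots> = ennreal (integral {0..z} f)"
    by (rule nn_integral_has_integral_lebesgue[OF _ int]) (use pos in \<open>auto intro: less_imp_le\<close>)
  finally have e: "emeasure D {..z} = ennreal (integral {0..z} f)" .
  have "0 \<le> integral {0..z} f"
    by (rule has_integral_nonneg[OF int]) (use pos in \<open>auto intro: less_imp_le\<close>)
  then show ?thesis using e by (simp add: cdf_def measure_def)
qed

text \<open>At 0 the distribution function has a kink, since the density jumps to a positive value.
  Arguments below are values of \<open>P\<close>, which are positive.\<close>

lemma cdf_deriv:
  assumes D: "cost_distribution D f" and z: "0 < z"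
  shows "(cdf D has_real_derivative f z) (at z)"
proof -
  obtain f' where "\<And>x. x \<in> {0..} \<Longrightarrow> (f has_real_derivative f' x) (at x within {0..})"
    using D unfolding cost_distribution_def C1_on_def by blast
  then have fc: "continuous_on {0..} f" by (rule DERIV_continuous_on)
  have "((\<lambda>x. integral {0..x} f) has_real_derivative f z) (at z within {0..z + 1})"
    by (rule integral_has_real_derivative[OF continuous_on_subset[OF fc]]) (use z in auto)
  moreover have "at z within {0..z + 1} = at z" using z by (intro at_within_interior) auto
  ultimately have "((\<lambda>x. integral {0..x} f) has_real_derivative f z) (at z)" by simp
  then show ?thesis
  proof (rule has_field_derivative_transform_within_open[of _ _ _ "{0<..}"])
    show "integral {0..x} f = cdf D x" if "x \<in> {0<..}" for x
      using cdf_eq_integral[OF D, of x] that by simp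
  qed (use z in auto)
qed

text \<open>The density is positive beyond \<open>z\<close>, so mass remains there. This keeps the
  hazard rate finite.\<close>

lemma cdf_less_one:
  assumes D: "cost_distribution D f" and z: "0 < z"
  shows "cdf D z < 1"
proof -
  interpret prob_space D using D unfolding cost_distribution_def by blast
  have "\<exists>y. (cdf D has_real_derivative y) (at x) \<and> 0 < y" if "z \<le> x" for x
  proof -
    have "0 < f x" using D z that unfolding cost_distribution_def by simp
    then show ?thesis using cdf_deriv[OF D, of x] z that by auto
  qed
  then have "cdf D z < cdf D (z + 1)"
    by (intro DERIV_pos_imp_increasing[of z "z + 1" "cdf D"]) auto
  also have "\<dots> \<le> 1" by (simp add: cdf_def)
  finally show ?thesis .
qed

text \<open>Never stopping pays 0. The integrable envelope bounds all expected payoffs, so that the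
  real supremum is an upper bound of them.\<close>

lemma stopping_value_nonneg:
  assumes "discounted_sup_integrable r \<alpha> \<beta> Pr (\<lambda>x. \<bar>g x\<bar>)" and x: "x \<in> einterval \<alpha> \<beta>"
  shows "0 \<le> stopping_value r \<alpha> \<beta> Pr g x"
proof -
  let ?N = "\<integral>\<^sup>+\<omega>. (SUP t\<in>{0..}. ennreal (exp (- r * t) * \<bar>g (\<omega> t)\<bar>)) \<partial>(Pr x)"
  let ?T = "{\<tau>. stopping_time (right_filtration (einterval \<alpha> \<beta>)) \<tau>}"
  let ?E = "\<lambda>\<tau>. \<integral>\<omega>. stopped_payoff r g \<tau> \<omega> \<partial>(Pr x)"
  have N: "?N < \<infinity>" using assms unfolding discounted_sup_integrable_def by blast
  have "?E \<tau> \<le> enn2real ?N" for \<tau>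
  proof (rule integral_real_bounded)
    have "ennreal (stopped_payoff r g \<tau> \<omega>) \<le> (SUP t\<in>{0..}. ennreal (exp (- r * t) * \<bar>g (\<omega> t)\<bar>))" for \<omega>
    proof (cases "\<tau> \<omega> = \<top>")
      case False
      then have "ennreal (stopped_payoff r g \<tau> \<omega>) \<le> ennreal (exp (- r * enn2real (\<tau> \<omega>)) * \<bar>g (\<omega> (enn2real (\<tau> \<omega>)))\<bar>)"
        by (auto simp: stopped_payoff_def intro!: ennreal_leI mult_left_mono)
      also have "\<dots> \<le> (SUP t\<in>{0..}. ennreal (exp (- r * t) * \<bar>g (\<omega> t)\<bar>))"
        by (rule SUP_upper) simp
      finally show ?thesis .
    qed (simp add: stopped_payoff_def)
    then have "(\<integral>\<^sup>+\<omega>. ennreal (stopped_payoff r g \<tau> \<omega>) \<partial>(Pr x)) \<le> ?N" by (intro nn_integral_mono)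
    then show "(\<integral>\<^sup>+\<omega>. ennreal (stopped_payoff r g \<tau> \<omega>) \<partial>(Pr x)) \<le> ennreal (enn2real ?N)" using N by simp
  qed simp
  then have bdd: "bdd_above (?E ` ?T)" by (intro bdd_aboveI[of _ "enn2real ?N"]) auto
  have "?E (\<lambda>_. \<top>) \<le> (SUP \<tau>\<in>?T. ?E \<tau>)"
    by (rule cSUP_upper[OF _ bdd]) (simp add: stopping_time_const)
  then show ?thesis by (simp add: stopping_value_def stopped_payoff_def)
qed

section \<open>Assembling the comparison from the model\<close>

context diffusion_operator
begin

lemma stopping_problem_exists:
  assumes x0: "x0 \<in> I"
    and R: "\<And>x. x \<in> I \<Longrightarrow> (R has_real_derivative R' x) (at x)"
      "\<And>x. x \<in> I \<Longrightarrow> (R' has_real_derivative R'' x) (at x)" "continuous_on I R''"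
    and R_neg: "\<And>x. x \<in> I \<Longrightarrow> x0 \<le> x \<Longrightarrow> \<mu> x * R' x + (\<sigma> x)\<^sup>2 / 2 * R'' x - r * R x < 0"
    and R_nonneg: "\<And>x. x \<in> I \<Longrightarrow> x0 \<le> x \<Longrightarrow> 0 \<le> R x"
    and G: "\<And>x. x \<in> I \<Longrightarrow> (G has_real_derivative G' x) (at x)" "continuous_on I G'"
    and RG: "\<And>x. x \<in> I \<Longrightarrow> x0 \<le> x \<Longrightarrow> R x < G x"
    and G'': "finite E" "\<And>x. x \<in> I \<Longrightarrow> x \<notin> E \<Longrightarrow>
      (G' has_real_derivative G'' x) (at x) \<and> \<mu> x * G' x + (\<sigma> x)\<^sup>2 / 2 * G'' x - r * G x \<le> 0"
    and \<psi>: "harmonic_on I \<psi> \<psi>'" "\<psi> x0 = R x0" "\<psi>' x0 = R' x0"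
      "\<And>e. 0 < e \<Longrightarrow> \<exists>n\<in>I. \<forall>x\<in>I. x < n \<longrightarrow> \<bar>\<psi> x\<bar> < e"
  obtains s \<zeta> where "stopping_problem r \<alpha> \<beta> \<mu> \<sigma> R R' R'' G G' \<psi> \<psi>' s \<zeta> x0"
proof -
  have at: "at x within I = at x" if "x \<in> I" for x using that by (rule at_within_open) simp
  have d: "(\<psi> has_real_derivative \<psi>' x) (at x)"
    "(\<psi>' has_real_derivative 2 / (\<sigma> x)\<^sup>2 * (r * \<psi> x - \<mu> x * \<psi>' x)) (at x)" if "x \<in> I" for x
    using harmonic_onD[OF \<psi>(1) that] unfolding at[OF that] by auto
  \<comment> \<open>If \<open>R\<close> and \<open>R'\<close> both vanished at \<open>x0\<close>,
    then \<open>R_neg\<close> would give \<open>R'' x0 < 0\<close>, and \<open>R\<close> would be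
    negative just to the right of \<open>x0\<close>.\<close>
  have nontrivial: "\<psi> x0 \<noteq> 0 \<or> \<psi>' x0 \<noteq> 0"
  proof (rule ccontr)
    assume "\<not> ?thesis"
    then have z: "R x0 = 0" "R' x0 = 0" using \<psi> by auto
    then have "R'' x0 < 0" using R_neg[OF x0] \<sigma>_pos[OF x0] by (simp add: mult_less_0_iff)
    then obtain e where e: "e > 0" "\<And>h. 0 < h \<Longrightarrow> h < e \<Longrightarrow> R' (x0 + h) < 0"
      using has_real_derivative_neg_dec_right[OF R(2)[OF x0]] z by auto
    obtain e' where e': "e' > 0" "ball x0 e' \<subseteq> I"
      using open_contains_ball[of I] x0 open_einterval by blast
    define y where "y = x0 + min e e' / 2"
    have y: "x0 < y" "y < x0 + e" "y \<in> I" using e(1) e' by (auto simp: y_def subset_iff dist_real_def min_def)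
    have "- R x0 < - R y"
    proof (rule interval_increasing[OF I_interval x0 y(3,1), of _ "\<lambda>x. - R' x"])
      show "((\<lambda>x. - R x) has_real_derivative - R' x) (at x within I)" if "x \<in> I" for x
        using R(1)[OF that] unfolding at[OF that] by (rule DERIV_minus)
      show "0 < - R' x" if "x \<in> I" "x0 < x" "x < y" for x
        using e(2)[of "x - x0"] that y by simp
    qed
    then show False using R_nonneg[OF y(3)] z y by simp
  qed
  \<comment> \<open>So \<open>\<psi>\<close> has no zero; as \<open>\<psi> x0 = R x0\<close> is
    nonnegative, its constant sign is positive.\<close>
  have prod: "0 < \<psi> p * \<psi>' p" if "p \<in> I" for p
    by (rule harmonic_pos[OF \<psi>(1,4) x0 nontrivial that])
  have pos: "0 < \<psi> p" if p: "p \<in> I" for p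
  proof (rule ccontr)
    assume "\<not> 0 < \<psi> p"
    have x: "0 < \<psi> x0" using prod[OF x0] R_nonneg[OF x0] \<psi>(2) by (cases "\<psi> x0 = 0") auto
    have c: "continuous_on {a..b} \<psi>" if "a \<in> I" "b \<in> I" for a b
      using interval_Icc_subset[OF I_interval that]
      by (intro DERIV_continuous_on[OF has_field_derivative_at_within[OF d(1)]]) auto
    have "\<exists>q\<in>I. \<psi> q = 0"
    proof (cases "p \<le> x0")
      case True
      then show ?thesis
        using IVT'[of \<psi> p 0 x0] c[OF p x0] \<open>\<not> 0 < \<psi> p\<close> x interval_Icc_subset[OF I_interval p x0] by force
    next
      case False
      then show ?thesis
        using IVT2'[of \<psi> p 0 x0] c[OF x0 p] \<open>\<not> 0 < \<psi> p\<close> x interval_Icc_subset[OF I_interval x0 p] by force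
    qed
    then show False using prod by force
  qed
  obtain s where s: "\<And>x. x \<in> I \<Longrightarrow> 0 < s x"
    "\<And>x. x \<in> I \<Longrightarrow> (s has_real_derivative - (2 * \<mu> x / (\<sigma> x)\<^sup>2 * s x)) (at x)"
    using scale_exists by blast
  have nz: "\<psi> x \<noteq> 0" "s x \<noteq> 0" if "x \<in> I" for x using pos[OF that] s(1)[OF that] by auto
  have c: "continuous_on I \<psi>" "continuous_on I \<psi>'" "continuous_on I s" "continuous_on I G"
    by (rule DERIV_continuous_on, rule has_field_derivative_at_within, rule d s(2) G(1), assumption)+
  have \<zeta>'_cont: "continuous_on I (\<lambda>x. s x / (\<psi> x)\<^sup>2)" using nz by (auto intro!: continuous_intros c)
  obtain \<zeta> where \<zeta>: "\<And>x. x \<in> I \<Longrightarrow> (\<zeta> has_real_derivative s x / (\<psi> x)\<^sup>2) (at x within I)"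
    using antiderivative_exists[OF I_interval x0 \<zeta>'_cont] by metis
  let ?\<delta> = "\<lambda>x. (\<psi> x * G' x - \<psi>' x * G x) / s x"
  have concave: "?\<delta> y \<le> ?\<delta> x" if x: "x \<in> I" "y \<in> I" "x \<le> y" for x y
  proof (rule nonincreasing_except_finite[OF G''(1) x(3)])
    have sub: "{x..y} \<subseteq> I" by (rule interval_Icc_subset[OF I_interval x(1,2)])
    have "continuous_on I ?\<delta>" using nz by (auto intro!: continuous_intros c G(2))
    then show "continuous_on {x..y} ?\<delta>" by (rule continuous_on_subset[OF _ sub])
    fix t assume t: "x < t" "t < y" "t \<notin> E"
    then have tI: "t \<in> I" using sub by (auto simp: subset_iff)
    let ?D = "2 * \<psi> t / ((\<sigma> t)\<^sup>2 * s t) * (\<mu> t * G' t + (\<sigma> t)\<^sup>2 / 2 * G'' t - r * G t)"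
    have "(?\<delta> has_real_derivative ?D) (at t)"
      by (rule DERIV_cong[OF DERIV_divide[OF DERIV_diff[OF DERIV_mult[OF d(1)[OF tI] conjunct1[OF G''(2)[OF tI t(3)]]]
          DERIV_mult[OF d(2)[OF tI] G(1)[OF tI]]] s(2)[OF tI] nz(2)[OF tI]]])
        (use \<sigma>_nz[OF tI] nz[OF tI] in \<open>simp add: field_simps power2_eq_square\<close>)
    moreover have "?D \<le> 0"
      using G''(2)[OF tI t(3)] pos[OF tI] s(1)[OF tI]
      by (intro mult_nonneg_nonpos divide_nonneg_nonneg mult_nonneg_nonneg) auto
    ultimately show "(?\<delta> has_real_derivative ?D) (at t) \<and> ?D \<le> 0" by blast
  qed
  have "stopping_problem r \<alpha> \<beta> \<mu> \<sigma> R R' R'' G G' \<psi> \<psi>' s \<zeta> x0"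
  proof unfold_locales
    show "\<And>x. x \<in> I \<Longrightarrow> (\<zeta> has_real_derivative s x / (\<psi> x)\<^sup>2) (at x)" using \<zeta> at by simp
  qed (fact x0 R R_neg G RG \<psi> pos s concave)+
  then show ?thesis by (rule that)
qed

end

context stopping_problem
begin

text \<open>Through this, uniqueness for the variational system becomes uniqueness of the left
  endpoint for solutions of the differential equation.\<close>

lemma free_boundary_imp_system:
  assumes "\<And>m. m \<in> I \<Longrightarrow> (F has_real_derivative f m) (at m)" "\<And>m. m \<in> I \<Longrightarrow> F m < 1"
    and "\<And>m. m \<in> I \<Longrightarrow> 0 < f m" "continuous_on I f"
    and fb: "free_boundary (\<lambda>m. f m / (1 - F m)) m0 b"
  obtains V where "variational_system r \<alpha> \<beta> \<mu> \<sigma> R x0 G F f m0 b V" "variational_regularity \<alpha> \<beta> x0 m0 b V"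
proof -
  have m0: "m0 \<in> I" using fb by (simp add: free_boundary_def)
  have "continuous_on I (\<lambda>m. f m * \<gamma> m)" by (intro continuous_on_mult assms(4) \<gamma>_cont)
  then obtain H where H: "H m0 = 0" "\<And>m. m \<in> I \<Longrightarrow> (H has_real_derivative f m * \<gamma> m) (at m within I)"
    by (rule antiderivative_exists[OF I_interval m0]) blast
  interpret boundary_solution r \<alpha> \<beta> \<mu> \<sigma> R R' R'' G G' \<psi> \<psi>' s \<zeta> x0 F f b H m0
  proof unfold_locales
    show "(H has_real_derivative f m * \<gamma> m) (at m)" if "m \<in> I" for m
      using H(2)[OF that] unfolding at_within_I[OF that] .
  qed (fact assms H(1))+
  show ?thesis by (rule that[OF V_system V_regular])
qed

end

theorem proposition6:
  fixes r :: real and \<alpha> \<beta> :: ereal and \<mu> \<sigma> R U G P :: "real \<Rightarrow> real"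
    and Pr :: "real \<Rightarrow> (real \<Rightarrow> real) measure"
    and x\<^sub>R x\<^sub>U :: real
    and D1 D2 :: "real measure" and f_Z1 f_Z2 b1 b2 :: "real \<Rightarrow> real" and m1 m2 :: real
  assumes "0 < r" and "\<alpha> < \<beta>"
    and "diffusion \<alpha> \<beta> \<mu> \<sigma> Pr"
    and "\<forall>x\<in>einterval \<alpha> \<beta>. R x < U x"
    and "admissible_payoff r \<alpha> \<beta> \<mu> \<sigma> Pr R x\<^sub>R"
    and "admissible_payoff r \<alpha> \<beta> \<mu> \<sigma> Pr U x\<^sub>U"
    and "G = mean_value r \<alpha> \<beta> Pr R U"
    and "P = half_gain r \<alpha> \<beta> Pr R U"
    and "mean_value_conditions r \<alpha> \<beta> \<mu> \<sigma> Pr R G"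
    and "half_gain_conditions \<alpha> \<beta> P"
    and "cost_distribution D1 f_Z1" and "cost_distribution D2 f_Z2"
    and "locally_lipschitz_on (einterval \<alpha> \<beta>) (threshold_density P f_Z1)"
    and "\<forall>y\<in>einterval \<alpha> \<beta>. threshold_density P f_Z1 y > 0"
    and "locally_lipschitz_on (einterval \<alpha> \<beta>) (threshold_density P f_Z2)"
    and "\<forall>y\<in>einterval \<alpha> \<beta>. threshold_density P f_Z2 y > 0"
    and "optimal_free_boundary r \<alpha> \<beta> \<mu> \<sigma> R x\<^sub>R G (cdf D1 \<circ> P) (threshold_density P f_Z1) m1 b1"
    and "optimal_free_boundary r \<alpha> \<beta> \<mu> \<sigma> R x\<^sub>R G (cdf D2 \<circ> P) (threshold_density P f_Z2) m2 b2"
    and "\<forall>z\<ge>0. f_Z1 z / (1 - cdf D1 z) > f_Z2 z / (1 - cdf D2 z)"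
  shows "m1 > m2 \<and> (\<forall>m. m1 \<le> m \<and> ereal m < \<beta> \<longrightarrow> b2 m > b1 m)"
proof -
  interpret diffusion_operator r \<alpha> \<beta> \<mu> \<sigma>
    using assms(1-3) by unfold_locales (auto simp: diffusion_def)
  let ?V = "stopping_value r \<alpha> \<beta> Pr R"
  have R: "R C1_differentiable_on I" "deriv R C1_differentiable_on I"
    "discounted_sup_integrable r \<alpha> \<beta> Pr (\<lambda>x. \<bar>R x\<bar>)"
    "{x \<in> I. ?V x = R x} = {x. x\<^sub>R \<le> x \<and> ereal x < \<beta>}"
    using assms(5) unfolding admissible_payoff_def by blast+
  obtain z where z: "z \<in> I" "\<And>x. x \<in> einterval z \<beta> \<Longrightarrow> generator \<mu> \<sigma> R x - r * R x < 0"
    "x\<^sub>R \<in> einterval z \<beta>"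
    using assms(5) unfolding admissible_payoff_def by blast
  have xR: "x\<^sub>R \<in> I" "z < x\<^sub>R"
    using z(1,3) less_trans[of \<alpha> "ereal z" "ereal x\<^sub>R"] by (auto simp: einterval_iff)
  note R_deriv = C1_differentiable_on_deriv[OF R(1)] and R'_deriv = C1_differentiable_on_deriv[OF R(2)]
  have R_neg: "\<mu> x * deriv R x + (\<sigma> x)\<^sup>2 / 2 * deriv (deriv R) x - r * R x < 0" if "x \<in> I" "x\<^sub>R \<le> x" for x
    using z(2)[of x] that xR(2) by (simp add: einterval_iff generator_def)
  \<comment> \<open>To the right of \<open>x\<^sub>R\<close> the value is the payoff, so
    nonnegativity of the value and the bound of \<open>G\<close> from below pass to
    \<open>R\<close>.\<close>
  have V_eq: "?V x = R x" if "x \<in> I" "x\<^sub>R \<le> x" for x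
    using R(4) that by (auto simp: einterval_iff)
  have R_nonneg: "0 \<le> R x" if "x \<in> I" "x\<^sub>R \<le> x" for x
    using stopping_value_nonneg[OF R(3) that(1)] V_eq[OF that] by simp
  have G: "G C1_differentiable_on I" "piecewise_C2_on I G"
    "\<And>x. x \<in> I \<Longrightarrow> ?V x < G x"
    "\<And>x. x \<in> I \<Longrightarrow> deriv G differentiable at x \<Longrightarrow> generator \<mu> \<sigma> G x - r * G x \<le> 0"
    using assms(9) unfolding mean_value_conditions_def by blast+
  note G_deriv = C1_differentiable_on_deriv[OF G(1)]
  have RG: "R x < G x" if "x \<in> I" "x\<^sub>R \<le> x" for x
    using G(3)[OF that(1)] V_eq[OF that] by simp
  obtain E where E: "finite E" "\<And>x. x \<in> I \<Longrightarrow> x \<notin> E \<Longrightarrow> deriv G differentiable at x"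
    using G(2) unfolding piecewise_C2_on_def by blast
  have G'': "(deriv G has_real_derivative deriv (deriv G) x) (at x) \<and>
      \<mu> x * deriv G x + (\<sigma> x)\<^sup>2 / 2 * deriv (deriv G) x - r * G x \<le> 0" if "x \<in> I" "x \<notin> E" for x
    using E(2)[OF that] G(4)[OF that(1)] DERIV_deriv_iff_real_differentiable
    by (auto simp: generator_def)
  have P: "(P has_real_derivative deriv P x) (at x)" "0 < deriv P x" "0 < P x" if "x \<in> I" for x
    using assms(10) that DERIV_deriv_iff_real_differentiable unfolding half_gain_conditions_def by blast+
  have F_deriv: "(cdf D \<circ> P has_real_derivative threshold_density P f x) (at x)"
    if "cost_distribution D f" "x \<in> I" for D f x
    using DERIV_chain[OF cdf_deriv[OF that(1) P(3)[OF that(2)]] P(1)[OF that(2)]]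
    by (simp add: threshold_density_def mult.commute)
  have F_less: "(cdf D \<circ> P) x < 1" if "cost_distribution D f" "x \<in> I" for D f x
    using cdf_less_one[OF that(1) P(3)[OF that(2)]] by simp
  let ?F1 = "cdf D1 \<circ> P" and ?F2 = "cdf D2 \<circ> P"
    and ?f1 = "threshold_density P f_Z1" and ?f2 = "threshold_density P f_Z2"
  note F1 = F_deriv[OF assms(11)] F_less[OF assms(11)] and F2 = F_deriv[OF assms(12)] F_less[OF assms(12)]
  obtain W1 where W1: "variational_system r \<alpha> \<beta> \<mu> \<sigma> R x\<^sub>R G ?F1 ?f1 m1 b1 W1"
    "variational_regularity \<alpha> \<beta> x\<^sub>R m1 b1 W1"
    using assms(17) unfolding optimal_free_boundary_def by blast
  obtain W2 where W2: "variational_system r \<alpha> \<beta> \<mu> \<sigma> R x\<^sub>R G ?F2 ?f2 m2 b2 W2"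
    "variational_regularity \<alpha> \<beta> x\<^sub>R m2 b2 W2"
    "\<And>n c V. variational_system r \<alpha> \<beta> \<mu> \<sigma> R x\<^sub>R G ?F2 ?f2 n c V \<Longrightarrow>
      variational_regularity \<alpha> \<beta> x\<^sub>R n c V \<Longrightarrow> n = m2"
    using assms(18) unfolding optimal_free_boundary_def by blast
  have m1: "m1 \<in> I"
    using W1(1) xR(1) less_trans[of \<alpha> "ereal x\<^sub>R" "ereal m1"] by (auto simp: variational_system_def einterval_iff)
  \<comment> \<open>\<open>\<psi>\<close> depends on \<open>R\<close> and \<open>x\<^sub>R\<close>
    but not on the cost distribution, so the solution found in the first system serves both.\<close>
  obtain \<psi> \<psi>' where \<psi>: "harmonic_on I \<psi> \<psi>'" "\<psi> x\<^sub>R = R x\<^sub>R" "\<psi>' x\<^sub>R = deriv R x\<^sub>R"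
    "\<And>e. 0 < e \<Longrightarrow> \<exists>n\<in>I. \<forall>x\<in>I. x < n \<longrightarrow> \<bar>\<psi> x\<bar> < e"
    using left_solution[OF W1 xR(1) F1(2)[OF m1]] by blast
  obtain s \<zeta> where
    "stopping_problem r \<alpha> \<beta> \<mu> \<sigma> R (deriv R) (deriv (deriv R)) G (deriv G) \<psi> \<psi>' s \<zeta> x\<^sub>R"
    by (rule stopping_problem_exists[OF xR(1) R_deriv(1) R'_deriv R_neg R_nonneg G_deriv RG E(1) G'' \<psi>])
  then interpret stopping_problem r \<alpha> \<beta> \<mu> \<sigma> R "deriv R" "deriv (deriv R)" G "deriv G" \<psi> \<psi>' s \<zeta> x\<^sub>R .
  let ?h1 = "\<lambda>m. ?f1 m / (1 - ?F1 m)" and ?h2 = "\<lambda>m. ?f2 m / (1 - ?F2 m)"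
  have fb1: "free_boundary ?h1 m1 b1" by (rule system_imp_free_boundary[OF W1 F1])
  have fb2: "free_boundary ?h2 m2 b2" by (rule system_imp_free_boundary[OF W2(1,2) F2])
  have f2: "0 < ?f2 m" if "m \<in> I" for m using assms(16) that by blast
  have f2_cont: "continuous_on I ?f2" by (rule locally_lipschitz_on_continuous[OF assms(15) open_I])
  have h2: "0 < ?h2 m" if "m \<in> I" for m using f2[OF that] F2(2)[OF that] by simp
  \<comment> \<open>The hazard rate of the threshold at \<open>m\<close> is that of the cost at
    \<open>P m\<close> times the positive derivative of \<open>P\<close>, a factor common to both
    distributions.\<close>
  have h12: "?h2 m < ?h1 m" if "m \<in> I" for m
  proof -
    have "f_Z2 (P m) / (1 - cdf D2 (P m)) < f_Z1 (P m) / (1 - cdf D1 (P m))"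
      using assms(19) P(3)[OF that] by simp
    then have "deriv P m * (f_Z2 (P m) / (1 - cdf D2 (P m))) < deriv P m * (f_Z1 (P m) / (1 - cdf D1 (P m)))"
      using P(2)[OF that] by (rule mult_strict_left_mono)
    then show ?thesis by (simp add: threshold_density_def)
  qed
  have F2_cont: "continuous_on I ?F2"
    by (rule DERIV_continuous_on[OF has_field_derivative_at_within[OF F2(1)]])
  have h2_cont: "continuous_on I ?h2"
    using F2(2) by (intro continuous_on_divide continuous_on_diff continuous_on_const f2_cont F2_cont) fastforce
  have h2_lip: "\<exists>L. L-lipschitz_on {a..b} ?h2" if "a \<in> I" "b \<in> I" for a b
    by (rule hazard_lipschitz[OF interval_Icc_subset[OF I_interval that] assms(15) open_I F2])
  have unique: "n = m2" if "free_boundary ?h2 n c" for n c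
    by (rule free_boundary_imp_system[OF F2 f2 f2_cont that, rotated -1]) (rule W2(3), assumption+)
  have "m2 < m1"
    by (rule free_boundary_comparison(1)[OF fb1 fb2]) (fact h2 h12 h2_cont h2_lip unique)+
  moreover have "b1 m < b2 m" if "m \<in> I" "m1 \<le> m" for m
    by (rule free_boundary_comparison(2)[OF fb1 fb2 _ _ _ _ _ that]) (fact h2 h12 h2_cont h2_lip unique)+
  moreover have "m \<in> I" if "m1 \<le> m" "ereal m < \<beta>" for m
    using m1 that less_le_trans[of \<alpha> "ereal m1" "ereal m"] by (simp add: einterval_iff)
  ultimately show ?thesis by blast
qed

end
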